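(* Let $S\subseteq\{\neg,\overline{\ \ },\wedge,\vee,\Box,\Diamond,\mathit{true},\mathit{false}\}$. (1) If $\{\overline{\ \ },\wedge,\Box,\Diamond\}\subseteq S\subseteq\{\overline{\ \ },\wedge,\Box,\Diamond,\mathit{true},\mathit{false}\}$, then $\mathcal{L}(S)$ satisfiability is coNP-complete. (2) If $\{\wedge,\Box,\Diamond,\mathit{false}\}\subseteq S\subseteq\{\overline{\ \ },\wedge,\Box,\Diamond,\mathit{true},\mathit{false}\}$, then $\mathcal{L}(S)$ satisfiability is coNP-complete.
   Context: For $S$ a subset of the operators $\{\neg,\overline{\ \ },\wedge,\vee,\Box,\Diamond,\mathit{true},\mathit{false}\}$, $\mathcal{L}(S)$ is the set of modal formulas built from a countably infinite set of propositional variables using only operators in $S$. Here $\neg$ is general negation (applicable to any formula), $\overline{\ \ }$ is atomic negation (applicable only to propositional variables, giving $\overline{p}$), and $\mathit{true},\mathit{false}$ are constants. Semantics is standard Kripke semantics: a model $\langle W,R,\pi\rangle$ with $W$ non-empty, $R\subseteq W\times W$, $\pi$ a valuation; $\Box\phi$ holds at $w$ iff $\phi$ holds at all $R$-successors of $w$, $\Diamond\phi$ iff at some $R$-successor. $\mathcal{L}(S)$ satisfiability is the problem of deciding, given an $\mathcal{L}(S)$ formula, whether it is true at some world of some model (over the class of all frames). *)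

theory Defs
  imports "HOL-Computational_Algebra.Polynomial" "HOL-Library.Countable_Set"
begin

section \<open>Polynomial time on multitape Turing machines\<close>

type_synonym word = "bool list"

datatype dir = Lft | Stay | Rgt

text \<open>
  States are the numbers up to \<open>halt\<close>: computations start in state \<open>0\<close> and stop in state
  \<open>halt\<close>. Tape symbols are the numbers below \<open>nsyms\<close>; \<open>0\<close> is the blank, \<open>1\<close> and \<open>2\<close> stand for
  the two bits. The transition function maps a state and the list of scanned symbols to the next
  state and, for each tape, the symbol written and the head movement.
\<close>

record tm =
  ntapes :: nat
  nsyms :: nat
  halt :: nat
  trans :: "nat \<Rightarrow> nat list \<Rightarrow> nat \<times> (nat \<times> dir) list"

definition turing_machine :: "tm \<Rightarrow> bool" where
  "turing_machine M \<longleftrightarrow>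
     ntapes M \<ge> 1 \<and> nsyms M \<ge> 3 \<and>
     (\<forall>q < halt M. \<forall>ss. length ss = ntapes M \<and> set ss \<subseteq> {..<nsyms M} \<longrightarrow>
        (case trans M q ss of (q', as) \<Rightarrow>
           q' \<le> halt M \<and> length as = ntapes M \<and> fst ` set as \<subseteq> {..<nsyms M}))"

text \<open>A tape is two-way infinite and is given by the head position and the cell contents.\<close>

type_synonym tape = "int \<times> (int \<Rightarrow> nat)"
type_synonym config = "nat \<times> tape list"

fun shift :: "dir \<Rightarrow> int" where
  "shift Lft = -1"
| "shift Stay = 0"
| "shift Rgt = 1"

fun scan :: "tape \<Rightarrow> nat" where
  "scan (h, c) = c h"

fun act :: "nat \<times> dir \<Rightarrow> tape \<Rightarrow> tape" where
  "act (s, d) (h, c) = (h + shift d, c(h := s))"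

fun step :: "tm \<Rightarrow> config \<Rightarrow> config" where
  "step M (q, ts) =
     (if q = halt M then (q, ts)
      else case trans M q (map scan ts) of (q', as) \<Rightarrow> (q', map2 act as ts))"

definition bit_sym :: "bool \<Rightarrow> nat" where
  "bit_sym b = (if b then 2 else 1)"

definition word_tape :: "word \<Rightarrow> int \<Rightarrow> nat" where
  "word_tape x i = (if 0 \<le> i \<and> nat i < length x then bit_sym (x ! nat i) else 0)"

text \<open>The arguments are written on the first tapes, one per tape; the other tapes start blank.\<close>

definition start :: "tm \<Rightarrow> word list \<Rightarrow> config" where
  "start M xs =
     (0, map (\<lambda>j. (0, word_tape (if j < length xs then xs ! j else []))) [0..<ntapes M])"

text \<open>The result is the contents of the last tape; the head may stand anywhere.\<close>

definition halted_with :: "tm \<Rightarrow> word \<Rightarrow> config \<Rightarrow> bool" where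
  "halted_with M y c \<longleftrightarrow> fst c = halt M \<and> snd (last (snd c)) = word_tape y"

definition polytime :: "nat \<Rightarrow> (word list \<Rightarrow> word) \<Rightarrow> bool" where
  "polytime n f \<longleftrightarrow>
     (\<exists>M (p :: nat poly). turing_machine M \<and> n \<le> ntapes M \<and>
        (\<forall>xs. length xs = n \<longrightarrow>
           (\<exists>t \<le> poly p (sum_list (map length xs)).
              halted_with M (f xs) ((step M ^^ t) (start M xs)))))"

definition polytime_fun :: "(word \<Rightarrow> word) \<Rightarrow> bool" where
  "polytime_fun f \<longleftrightarrow> polytime 1 (\<lambda>xs. f (xs ! 0))"

definition polytime_rel :: "(word \<times> word) set \<Rightarrow> bool" where
  "polytime_rel V \<longleftrightarrow> polytime 2 (\<lambda>xs. [(xs ! 0, xs ! 1) \<in> V])"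


section \<open>NP, coNP and completeness\<close>

type_synonym language = "word set"

definition NP :: "language set" where
  "NP = {A. \<exists>V (p :: nat poly). polytime_rel V \<and>
             (\<forall>x. x \<in> A \<longleftrightarrow> (\<exists>u. length u \<le> poly p (length x) \<and> (x, u) \<in> V))}"

definition coNP :: "language set" where
  "coNP = {A. - A \<in> NP}"

definition poly_reducible :: "language \<Rightarrow> language \<Rightarrow> bool" (infix \<open>\<le>\<^sub>p\<close> 50) where
  "A \<le>\<^sub>p B \<longleftrightarrow> (\<exists>f. polytime_fun f \<and> (\<forall>x. x \<in> A \<longleftrightarrow> f x \<in> B))"

definition coNP_complete :: "language \<Rightarrow> bool" where
  "coNP_complete A \<longleftrightarrow> A \<in> coNP \<and> (\<forall>B \<in> coNP. B \<le>\<^sub>p A)"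


section \<open>Modal formulas\<close>

datatype operator = ONeg | OBar | OAnd | OOr | OBox | ODia | OTrue | OFalse

datatype fm =
    Var nat
  | BarVar nat
  | Neg fm
  | And fm fm
  | Or fm fm
  | Box fm
  | Dia fm
  | Tru
  | Fls

fun operators :: "fm \<Rightarrow> operator set" where
  "operators (Var i) = {}"
| "operators (BarVar i) = {OBar}"
| "operators (Neg \<phi>) = {ONeg} \<union> operators \<phi>"
| "operators (And \<phi> \<psi>) = {OAnd} \<union> operators \<phi> \<union> operators \<psi>"
| "operators (Or \<phi> \<psi>) = {OOr} \<union> operators \<phi> \<union> operators \<psi>"
| "operators (Box \<phi>) = {OBox} \<union> operators \<phi>"
| "operators (Dia \<phi>) = {ODia} \<union> operators \<phi>"
| "operators Tru = {OTrue}"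
| "operators Fls = {OFalse}"

definition formulas :: "operator set \<Rightarrow> fm set" where
  "formulas S = {\<phi>. operators \<phi> \<subseteq> S}"

record 'w model =
  worlds :: "'w set"
  rel :: "('w \<times> 'w) set"
  val :: "nat \<Rightarrow> 'w set"

definition kripke_model :: "'w model \<Rightarrow> bool" where
  "kripke_model M \<longleftrightarrow> worlds M \<noteq> {} \<and> rel M \<subseteq> worlds M \<times> worlds M"

fun holds :: "'w model \<Rightarrow> 'w \<Rightarrow> fm \<Rightarrow> bool" where
  "holds M w (Var i) \<longleftrightarrow> w \<in> val M i"
| "holds M w (BarVar i) \<longleftrightarrow> w \<notin> val M i"
| "holds M w (Neg \<phi>) \<longleftrightarrow> \<not> holds M w \<phi>"
| "holds M w (And \<phi> \<psi>) \<longleftrightarrow> holds M w \<phi> \<and> holds M w \<psi>"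
| "holds M w (Or \<phi> \<psi>) \<longleftrightarrow> holds M w \<phi> \<or> holds M w \<psi>"
| "holds M w (Box \<phi>) \<longleftrightarrow> (\<forall>v. (w, v) \<in> rel M \<longrightarrow> holds M v \<phi>)"
| "holds M w (Dia \<phi>) \<longleftrightarrow> (\<exists>v. (w, v) \<in> rel M \<and> holds M v \<phi>)"
| "holds M w Tru \<longleftrightarrow> True"
| "holds M w Fls \<longleftrightarrow> False"

text \<open>
  A definition cannot quantify over the type of worlds, so the worlds are natural numbers here.
  Lemma \<open>satisfiableI\<close> below shows that this is no restriction: a formula true at
  some world of some model, whatever its type of worlds, is satisfiable.
\<close>

definition satisfiable :: "fm \<Rightarrow> bool" where
  "satisfiable \<phi> \<longleftrightarrow> (\<exists>M :: nat model. kripke_model M \<and> (\<exists>w \<in> worlds M. holds M w \<phi>))"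


section \<open>Formulas as words\<close>

text \<open>
  Formulas are written in Polish notation, with four bits for each connective. The index of a
  variable is written in binary, least significant bit first, each bit preceded by the marker
  \<open>True\<close>, and terminated by \<open>False\<close>.
\<close>

fun encode_nat :: "nat \<Rightarrow> word" where
  "encode_nat n = (if n = 0 then [False] else True # odd n # encode_nat (n div 2))"

declare encode_nat.simps [simp del]

fun encode :: "fm \<Rightarrow> word" where
  "encode (Var i) = [False, False, False, False] @ encode_nat i"
| "encode (BarVar i) = [False, False, False, True] @ encode_nat i"
| "encode (Neg \<phi>) = [False, False, True, False] @ encode \<phi>"
| "encode (And \<phi> \<psi>) = [False, False, True, True] @ encode \<phi> @ encode \<psi>"
| "encode (Or \<phi> \<psi>) = [False, True, False, False] @ encode \<phi> @ encode \<psi>"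
| "encode (Box \<phi>) = [False, True, False, True] @ encode \<phi>"
| "encode (Dia \<phi>) = [False, True, True, False] @ encode \<phi>"
| "encode Tru = [False, True, True, True]"
| "encode Fls = [True, False, False, False]"

definition satisfiability :: "operator set \<Rightarrow> language" where
  "satisfiability S = {encode \<phi> | \<phi>. \<phi> \<in> formulas S \<and> satisfiable \<phi>}"


section \<open>Adequacy of the encoding and of the choice of worlds\<close>

lemma encode_nat_prefix_free:
  "encode_nat m @ xs = encode_nat n @ ys \<Longrightarrow> m = n \<and> xs = ys"
proof (induction m arbitrary: n rule: less_induct)
  case (less m)
  show ?case
  proof (cases "m = 0 \<or> n = 0")
    case True
    with less.prems show ?thesis
      using encode_nat.simps [of m] encode_nat.simps [of n] by (auto split: if_splits)
  next
    case False
    then have "odd m = odd n \<and> encode_nat (m div 2) @ xs = encode_nat (n div 2) @ ys"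
      using less.prems encode_nat.simps [of m] encode_nat.simps [of n] by simp
    moreover from this False less.IH [of "m div 2" "n div 2"]
    have "m div 2 = n div 2 \<and> xs = ys" by simp
    ultimately show ?thesis
      by (metis dvd_mult_div_cancel odd_two_times_div_two_succ)
  qed
qed

lemma encode_prefix_free:
  "encode \<phi> @ xs = encode \<psi> @ ys \<Longrightarrow> \<phi> = \<psi> \<and> xs = ys"
proof (induction \<phi> arbitrary: \<psi> xs ys)
  case (Var i) then show ?case by (cases \<psi>) (auto dest: encode_nat_prefix_free)
next
  case (BarVar i) then show ?case by (cases \<psi>) (auto dest: encode_nat_prefix_free)
next
  case (Neg \<phi>) then show ?case by (cases \<psi>) auto
next
  case (And \<phi>1 \<phi>2)
  from And.prems show ?case by (cases \<psi>) (auto dest!: And.IH)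
next
  case (Or \<phi>1 \<phi>2)
  from Or.prems show ?case by (cases \<psi>) (auto dest!: Or.IH)
next
  case (Box \<phi>) then show ?case by (cases \<psi>) auto
next
  case (Dia \<phi>) then show ?case by (cases \<psi>) auto
next
  case Tru then show ?case by (cases \<psi>) auto
next
  case Fls then show ?case by (cases \<psi>) auto
qed

lemma inj_encode: "inj encode"
  by (rule injI) (metis append_Nil2 encode_prefix_free)

lemma encode_in_satisfiability_iff:
  "encode \<phi> \<in> satisfiability S \<longleftrightarrow> \<phi> \<in> formulas S \<and> satisfiable \<phi>"
  using inj_encode by (auto simp: satisfiability_def dest: injD)

lemma satisfiableI:
  fixes M :: "'w model"
  assumes M: "kripke_model M" and w: "w \<in> worlds M" and \<phi>: "holds M w \<phi>"
  shows "satisfiable \<phi>"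
proof -
  define c where "c v \<psi> = (if \<exists>u. (v, u) \<in> rel M \<and> holds M u \<psi>
    then SOME u. (v, u) \<in> rel M \<and> holds M u \<psi> else v)" for v \<psi>
  define X where "X = range (\<lambda>l. foldl c w l)"
  have c: "(v, c v \<psi>) \<in> rel M \<and> holds M (c v \<psi>) \<psi>" if "(v, u) \<in> rel M" "holds M u \<psi>" for u v \<psi>
    using that someI_ex [of "\<lambda>u. (v, u) \<in> rel M \<and> holds M u \<psi>"] by (auto simp: c_def)
  have cX: "c v \<psi> \<in> X" if v: "v \<in> X" for v \<psi>
  proof -
    from v obtain l where "v = foldl c w l" by (auto simp: X_def)
    then have "c v \<psi> = foldl c w (l @ [\<psi>])" by simp
    then show ?thesis unfolding X_def by blast
  qed
  have wX: "w \<in> X" unfolding X_def by (rule range_eqI [of _ _ "[]"]) simp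
  have "inj (map encode)" using inj_encode by simp
  then have "countable (UNIV :: fm list set)" by (rule countableI')
  then have "countable X" by (simp add: X_def)
  then have inj: "inj_on (to_nat_on X) X" by (rule inj_on_to_nat_on)
  let ?f = "to_nat_on X"
  define N :: "nat model" where
    "N = \<lparr>worlds = ?f ` X, rel = {(?f u, ?f v) | u v. u \<in> X \<and> v \<in> X \<and> (u, v) \<in> rel M},
          val = \<lambda>i. ?f ` (val M i \<inter> X)\<rparr>"
  have eq: "?f u = ?f v \<longleftrightarrow> u = v" if "u \<in> X" "v \<in> X" for u v
    using inj that by (auto dest: inj_onD)
  have rel: "(?f v, x) \<in> rel N \<longleftrightarrow> (\<exists>u \<in> X. x = ?f u \<and> (v, u) \<in> rel M)" if "v \<in> X" for v x
    using that eq by (auto simp: N_def)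
  have val: "?f v \<in> val N i \<longleftrightarrow> v \<in> val M i" if "v \<in> X" for v i
    using that eq by (auto simp: N_def)
  have "v \<in> X \<Longrightarrow> holds N (?f v) \<psi> \<longleftrightarrow> holds M v \<psi>" for v \<psi>
  proof (induction \<psi> arbitrary: v)
    case (Box \<psi>)
    have "(\<forall>x. (?f v, x) \<in> rel N \<longrightarrow> holds N x \<psi>)
        \<longleftrightarrow> (\<forall>u \<in> X. (v, u) \<in> rel M \<longrightarrow> holds M u \<psi>)"
      using Box by (auto simp: rel)
    also have "\<dots> \<longleftrightarrow> (\<forall>u. (v, u) \<in> rel M \<longrightarrow> holds M u \<psi>)"
      using c [of v _ "Neg \<psi>"] cX [OF Box.prems, of "Neg \<psi>"] by auto
    finally show ?case by simp
  next
    case (Dia \<psi>)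
    have "(\<exists>x. (?f v, x) \<in> rel N \<and> holds N x \<psi>)
        \<longleftrightarrow> (\<exists>u \<in> X. (v, u) \<in> rel M \<and> holds M u \<psi>)"
      using Dia by (auto simp: rel)
    also have "\<dots> \<longleftrightarrow> (\<exists>u. (v, u) \<in> rel M \<and> holds M u \<psi>)"
      using c [of v _ \<psi>] cX [OF Dia.prems, of \<psi>] by auto
    finally show ?case by simp
  qed (simp_all add: val)
  with wX \<phi> have "holds N (?f w) \<phi>" by blast
  moreover have "?f w \<in> worlds N" using wX by (simp add: N_def)
  moreover have "kripke_model N" using wX by (auto simp: kripke_model_def N_def)
  ultimately show ?thesis unfolding satisfiable_def by blast
qed

end

theory Submission
  imports Defs "HOL-Library.While_Combinator"
begin

text \<open>
  A formula without disjunction and general negation is unsatisfiable iff some sequence of choices of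
  diamonds leads to a world with contradictory conjuncts, and such a sequence is a short certificate.

  For hardness, let a chain be a prefix of modalities with one modality for each of \<open>L\<close> levels,
  written down twice and followed by a variable. On a path through a conjunction of chains one diamond
  is selected at each level, and only the chains that lose no diamond survive. After \<open>L\<close>
  steps the surviving chains have disjoint sets of diamonds, and a path of length \<open>2 L\<close>
  exists iff these sets cover all levels; the conjunct that puts \<open>2 L\<close> boxes before a falsity
  makes this equivalent to unsatisfiability. Exact covers in turn encode Wang tilings, and
  Wang tilings encode the accepting computations of a Turing machine on a guessed certificate.

  Both the verifier and the reduction are programs for a small stack language that is compiled to
  multitape Turing machines.
\<close>

section \<open>A stack language for polynomial-time computations\<close>

text \<open>Without disjunction and general negation the only freedom in a refutation is which
  diamond to follow, so unsatisfiability is an existential statement, and hardness requires that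
  choices of diamonds simulate an arbitrary search. A single pass over the levels cannot do this: a
  chain whose diamond was followed at one level may still lose a diamond at a later one, so only a
  second pass can ask which levels the survivors reach. Exactness of the cover serves to compare
  colours: an edge is split into one slot per colour, one side takes its own colour and the other
  side the complement of its own. The rows of a tiling are joined into a helix so that the
  neighbours of cell \<open>s\<close> are \<open>s + 1\<close> and \<open>s + W\<close> throughout;
  every tile pattern then consists of fixed words separated by runs of an empty block, which loops
  over a few unary counters can write. The tile set depends on the machine alone and is a constant
  of the reduction. Any formula without models can serve as the falsity; this is how one reduction
  yields both claims.\<close>

type_synonym store = "nat \<Rightarrow> word"

datatype prog =
    Skip
  | Push nat bool
  | Pop nat
  | Seq prog prog  (infixr \<open>;;\<close> 55)
  | Test nat "bool option set" prog prog
  | Loop nat "bool option set" prog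

definition peek :: "word \<Rightarrow> bool option" where
  "peek w = (case w of [] \<Rightarrow> None | b # _ \<Rightarrow> Some b)"

lemma peek_simps [simp]: "peek [] = None" "peek (b # w) = Some b"
  by (simp_all add: peek_def)

lemma peek_eq_None [simp]: "peek w = None \<longleftrightarrow> w = []"
  by (cases w) simp_all

text \<open>\<open>den\<close> is total: where a loop diverges, \<open>while\<close> returns an
  unspecified store. Termination and cost are left to \<open>exec\<close>.\<close>

primrec den :: "prog \<Rightarrow> store \<Rightarrow> store" where
  "den Skip \<sigma> = \<sigma>"
| "den (Push r b) \<sigma> = \<sigma>(r := b # \<sigma> r)"
| "den (Pop r) \<sigma> = \<sigma>(r := tl (\<sigma> r))"
| "den (P ;; Q) \<sigma> = den Q (den P \<sigma>)"
| "den (Test r A P Q) \<sigma> = (if peek (\<sigma> r) \<in> A then den P \<sigma> else den Q \<sigma>)"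
| "den (Loop r A P) \<sigma> = while (\<lambda>\<sigma>. peek (\<sigma> r) \<in> A) (den P) \<sigma>"

declare den.simps(6) [simp del]

lemma den_Loop:
  "den (Loop r A P) \<sigma> = (if peek (\<sigma> r) \<in> A then den (Loop r A P) (den P \<sigma>) else \<sigma>)"
  unfolding den.simps(6) by (rule while_unfold)

primrec regs :: "prog \<Rightarrow> nat set" where
  "regs Skip = {}"
| "regs (Push r b) = {r}"
| "regs (Pop r) = {r}"
| "regs (P ;; Q) = regs P \<union> regs Q"
| "regs (Test r A P Q) = {r} \<union> regs P \<union> regs Q"
| "regs (Loop r A P) = {r} \<union> regs P"

text \<open>The costs are exactly the numbers of steps of the compiled code. \<open>Push\<close>
  takes two: the head first moves to the blank cell left of the top, then writes there.\<close>

inductive exec :: "prog \<Rightarrow> store \<Rightarrow> nat \<Rightarrow> store \<Rightarrow> bool" where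
  Skip: "exec Skip \<sigma> 1 \<sigma>"
| Push: "exec (Push r b) \<sigma> 2 (\<sigma>(r := b # \<sigma> r))"
| Pop: "exec (Pop r) \<sigma> 1 (\<sigma>(r := tl (\<sigma> r)))"
| Seq: "exec P \<sigma> s \<sigma>' \<Longrightarrow> exec Q \<sigma>' t \<sigma>'' \<Longrightarrow> exec (P ;; Q) \<sigma> (s + t) \<sigma>''"
| Test_True: "peek (\<sigma> r) \<in> A \<Longrightarrow> exec P \<sigma> t \<sigma>' \<Longrightarrow> exec (Test r A P Q) \<sigma> (1 + t) \<sigma>'"
| Test_False: "peek (\<sigma> r) \<notin> A \<Longrightarrow> exec Q \<sigma> t \<sigma>' \<Longrightarrow> exec (Test r A P Q) \<sigma> (1 + t) \<sigma>'"
| Loop_False: "peek (\<sigma> r) \<notin> A \<Longrightarrow> exec (Loop r A P) \<sigma> 1 \<sigma>"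
| Loop_True: "peek (\<sigma> r) \<in> A \<Longrightarrow> exec P \<sigma> s \<sigma>' \<Longrightarrow> exec (Loop r A P) \<sigma>' t \<sigma>''
    \<Longrightarrow> exec (Loop r A P) \<sigma> (1 + s + t) \<sigma>''"

lemma exec_length: "exec P \<sigma> t \<sigma>' \<Longrightarrow> length (\<sigma>' r) \<le> length (\<sigma> r) + t"
  by (induction rule: exec.induct) auto

section \<open>Compilation to Turing machines\<close>

definition keep :: "nat list \<Rightarrow> (nat \<times> dir) list" where
  "keep = map (\<lambda>s. (s, Stay))"

primrec len :: "prog \<Rightarrow> nat" where
  "len Skip = 1"
| "len (Push r b) = 2"
| "len (Pop r) = 1"
| "len (P ;; Q) = len P + len Q"
| "len (Test r A P Q) = 1 + len P + len Q"
| "len (Loop r A P) = 1 + len P"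

definition dec :: "nat \<Rightarrow> bool option" where
  "dec s = (if s = 0 then None else Some (s \<noteq> 1))"

text \<open>The code of a program occupies the states from \<open>b\<close> on and continues in state \<open>e\<close>.\<close>

primrec compile :: "prog \<Rightarrow> nat \<Rightarrow> nat \<Rightarrow> nat \<Rightarrow> nat list \<Rightarrow> nat \<times> (nat \<times> dir) list" where
  "compile Skip b e q ss = (e, keep ss)"
| "compile (Push r x) b e q ss =
     (if q = b then (b + 1, (keep ss)[r := (ss ! r, Lft)])
      else (e, (keep ss)[r := (bit_sym x, Stay)]))"
| "compile (Pop r) b e q ss = (e, (keep ss)[r := (0, Rgt)])"
| "compile (P ;; Q) b e q ss =
     (if q < b + len P then compile P b (b + len P) q ss else compile Q (b + len P) e q ss)"
| "compile (Test r A P Q) b e q ss =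
     (if q = b then (if dec (ss ! r) \<in> A then b + 1 else b + 1 + len P, keep ss)
      else if q < b + 1 + len P then compile P (b + 1) e q ss
      else compile Q (b + 1 + len P) e q ss)"
| "compile (Loop r A P) b e q ss =
     (if q = b then (if dec (ss ! r) \<in> A then b + 1 else e, keep ss)
      else compile P (b + 1) b q ss)"

text \<open>The top of the stack lies under the head, the rest of the word to its right, and every
  other cell is blank. The stack floats: its top moves left with each push and right with each
  pop.\<close>

definition represents :: "tape \<Rightarrow> word \<Rightarrow> bool" where
  "represents t w \<longleftrightarrow> snd t = (\<lambda>i. word_tape w (i - fst t))"

lemma word_tape_Cons: "word_tape (b # w) i = (if i = 0 then bit_sym b else word_tape w (i - 1))"
  by (auto simp: word_tape_def nth_Cons' nat_diff_distrib' Suc_nat_eq_nat_zadd1 split: if_splits)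

lemma word_tape_tl: "word_tape (tl w) i = (if i < 0 then 0 else word_tape w (i + 1))"
  by (auto simp: word_tape_def nth_tl nat_add_distrib)

lemma word_tape_Nil [simp]: "word_tape [] i = 0"
  by (simp add: word_tape_def)

lemma dec_word_tape: "dec (word_tape w 0) = peek w"
  by (cases w) (auto simp: dec_def word_tape_def bit_sym_def)

lemma dec_scan: "represents t w \<Longrightarrow> dec (scan t) = peek w"
  by (cases t) (simp add: represents_def dec_word_tape)

lemma represents_push:
  "represents t w \<Longrightarrow> represents (act (bit_sym b, Stay) (act (scan t, Lft) t)) (b # w)"
  by (cases t) (auto simp: represents_def word_tape_Cons fun_eq_iff algebra_simps)

lemma represents_pop: "represents t w \<Longrightarrow> represents (act (0, Rgt) t) (tl w)"
  by (cases t) (auto simp: represents_def word_tape_tl fun_eq_iff algebra_simps word_tape_def [of w])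

lemma act_scan [simp]: "act (scan t, Stay) t = t"
  by (cases t) simp

lemma map2_act_keep: "map2 act (keep (map scan ts)) ts = ts"
  by (induction ts) (auto simp: keep_def)

lemma step_keep:
  assumes "q \<noteq> halt M" "trans M q (map scan ts) = (q', keep (map scan ts))"
  shows "step M (q, ts) = (q', ts)"
  using assms by (simp add: map2_act_keep)

lemma map2_act_update:
  "map2 act ((keep (map scan ts))[r := a]) ts = (if r < length ts then ts[r := act a (ts ! r)] else ts)"
proof -
  have "map2 act ((keep (map scan ts))[r := a]) ts =
      (map2 act (keep (map scan ts)) ts)[r := act a (ts ! r)]" if "r < length ts"
    using that by (intro nth_equalityI) (auto simp: nth_list_update keep_def)
  moreover have "(keep (map scan ts))[r := a] = keep (map scan ts)" if "\<not> r < length ts"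
    using that by (simp add: keep_def list_update_beyond)
  ultimately show ?thesis by (simp add: map2_act_keep)
qed

lemma step_update:
  assumes "q \<noteq> halt M" "trans M q (map scan ts) = (q', (keep (map scan ts))[r := a])" "r < length ts"
  shows "step M (q, ts) = (q', ts[r := act a (ts ! r)])"
  using assms by (simp add: map2_act_update)

text \<open>Tape \<open>k\<close> is kept apart for the output, hence \<open>k + 1\<close> tapes for
  \<open>k\<close> registers.\<close>

definition stores :: "nat \<Rightarrow> tape list \<Rightarrow> store \<Rightarrow> bool" where
  "stores k ts \<sigma> \<longleftrightarrow> length ts = k + 1 \<and> (\<forall>r < k. represents (ts ! r) (\<sigma> r))"

lemma stores_update:
  "stores k ts \<sigma> \<Longrightarrow> represents t w \<Longrightarrow> r < k \<Longrightarrow> stores k (ts[r := t]) (\<sigma>(r := w))"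
  by (auto simp: stores_def nth_list_update)

lemma funpow_add_apply: "(f ^^ (m + n)) x = (f ^^ n) ((f ^^ m) x)"
  by (simp only: add.commute [of m n] funpow_add comp_apply)

lemma funpow_1_add: "f x = y \<Longrightarrow> (f ^^ n) y = z \<Longrightarrow> (f ^^ (1 + n)) x = z"
proof -
  assume fx: "f x = y" and fy: "(f ^^ n) y = z"
  from fx have "(f ^^ 1) x = y" by simp
  then show "(f ^^ (1 + n)) x = z" using fy by (simp only: funpow_add_apply)
qed

text \<open>The transition function has to agree with the code only on the states of
  \<open>P\<close> itself, so the induction can pass to subprograms, each with its own continuation
  state. For a loop body this state is the beginning of the loop.\<close>

lemma compile_correct:
  assumes "exec P \<sigma> t \<sigma>'" and "regs P \<subseteq> {..<k}" and "stores k ts \<sigma>"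
    and "\<And>q ss. b \<le> q \<Longrightarrow> q < b + len P \<Longrightarrow> length ss = k + 1 \<Longrightarrow> trans M q ss = compile P b e q ss"
    and "b + len P \<le> halt M"
  shows "\<exists>ts'. (step M ^^ t) (b, ts) = (e, ts') \<and> stores k ts' \<sigma>' \<and> ts' ! k = ts ! k"
  using assms
proof (induction arbitrary: ts b e rule: exec.induct)
  case (Skip \<sigma>)
  then have "step M (b, ts) = (e, ts)"
    by (intro step_keep) (auto simp: stores_def)
  with Skip show ?case by auto
next
  case (Push r x \<sigma>)
  let ?t = "act (scan (ts ! r), Lft) (ts ! r)"
  let ?ts = "ts[r := ?t]"
  have l: "length ts = k + 1" "r < k" using Push by (auto simp: stores_def)
  have 1: "step M (b, ts) = (b + 1, ?ts)"
    using Push.prems l by (intro step_update) auto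
  have 2: "step M (b + 1, ?ts) = (e, ?ts[r := act (bit_sym x, Stay) (?ts ! r)])"
    using Push.prems l by (intro step_update) auto
  have "stores k (ts[r := act (bit_sym x, Stay) ?t]) (\<sigma>(r := x # \<sigma> r))"
    using Push.prems l by (intro stores_update represents_push) (auto simp: stores_def)
  then show ?case using l 1 2 by (auto simp: numeral_2_eq_2 fun_upd_def simp del: step.simps)
next
  case (Pop r \<sigma>)
  have l: "length ts = k + 1" "r < k" using Pop by (auto simp: stores_def)
  have 1: "step M (b, ts) = (e, ts[r := act (0, Rgt) (ts ! r)])"
    using Pop.prems l by (intro step_update) auto
  have "stores k (ts[r := act (0, Rgt) (ts ! r)]) (\<sigma>(r := tl (\<sigma> r)))"
    using Pop.prems l by (intro stores_update represents_pop) (auto simp: stores_def)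
  then show ?case using l 1 by (auto simp: fun_upd_def simp del: step.simps)
next
  case (Seq P \<sigma> s \<sigma>' Q t \<sigma>'')
  have "\<exists>ts'. (step M ^^ s) (b, ts) = (b + len P, ts') \<and> stores k ts' \<sigma>' \<and> ts' ! k = ts ! k"
    using Seq.prems by (intro Seq.IH(1)) auto
  then obtain ts' where 1: "(step M ^^ s) (b, ts) = (b + len P, ts')" "stores k ts' \<sigma>'" "ts' ! k = ts ! k"
    by blast
  have "\<exists>ts''. (step M ^^ t) (b + len P, ts') = (e, ts'') \<and> stores k ts'' \<sigma>'' \<and> ts'' ! k = ts' ! k"
    using Seq.prems 1 by (intro Seq.IH(2)) auto
  then show ?case using 1 by (auto simp: funpow_add_apply)
next
  case (Test_True \<sigma> r A P t \<sigma>' Q)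
  have l: "length ts = k + 1" "r < k" "dec (map scan ts ! r) = peek (\<sigma> r)"
    using Test_True.prems by (auto simp: stores_def dec_scan)
  have 1: "step M (b, ts) = (b + 1, ts)"
    using Test_True.prems Test_True.hyps l by (intro step_keep) auto
  have "\<exists>ts'. (step M ^^ t) (b + 1, ts) = (e, ts') \<and> stores k ts' \<sigma>' \<and> ts' ! k = ts ! k"
    using Test_True.prems by (intro Test_True.IH) auto
  with funpow_1_add [of "step M", OF 1] show ?case by blast
next
  case (Test_False \<sigma> r A Q t \<sigma>' P)
  have l: "length ts = k + 1" "r < k" "dec (map scan ts ! r) = peek (\<sigma> r)"
    using Test_False.prems by (auto simp: stores_def dec_scan)
  have 1: "step M (b, ts) = (b + 1 + len P, ts)"
    using Test_False.prems Test_False.hyps l by (intro step_keep) auto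
  have "\<exists>ts'. (step M ^^ t) (b + 1 + len P, ts) = (e, ts') \<and> stores k ts' \<sigma>' \<and> ts' ! k = ts ! k"
    using Test_False.prems by (intro Test_False.IH) auto
  with funpow_1_add [of "step M", OF 1] show ?case by blast
next
  case (Loop_False \<sigma> r A P)
  have l: "length ts = k + 1" "r < k" "dec (map scan ts ! r) = peek (\<sigma> r)"
    using Loop_False.prems by (auto simp: stores_def dec_scan)
  have 1: "step M (b, ts) = (e, ts)"
    using Loop_False.prems Loop_False.hyps l by (intro step_keep) auto
  with Loop_False show ?case by auto
next
  case (Loop_True \<sigma> r A P s \<sigma>' t \<sigma>'')
  have l: "length ts = k + 1" "r < k" "dec (map scan ts ! r) = peek (\<sigma> r)"
    using Loop_True.prems by (auto simp: stores_def dec_scan)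
  have 0: "step M (b, ts) = (b + 1, ts)"
    using Loop_True.prems Loop_True.hyps l by (intro step_keep) auto
  have "\<exists>ts'. (step M ^^ s) (b + 1, ts) = (b, ts') \<and> stores k ts' \<sigma>' \<and> ts' ! k = ts ! k"
    using Loop_True.prems by (intro Loop_True.IH(1)) auto
  then obtain ts' where 1: "(step M ^^ s) (b + 1, ts) = (b, ts')" "stores k ts' \<sigma>'" "ts' ! k = ts ! k"
    by blast
  have "\<exists>ts''. (step M ^^ t) (b, ts') = (e, ts'') \<and> stores k ts'' \<sigma>'' \<and> ts'' ! k = ts' ! k"
    using Loop_True.prems 1 by (intro Loop_True.IH(2)) auto
  moreover have "(step M ^^ (1 + s + t)) (b, ts) = (step M ^^ t) (b, ts')"
    by (simp only: funpow_add_apply [where n = t] funpow_1_add [of "step M", OF 0 1(1)])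
  ultimately show ?case using 1 by metis
qed

definition good :: "nat \<Rightarrow> nat \<Rightarrow> nat \<times> (nat \<times> dir) list \<Rightarrow> bool" where
  "good h k a \<longleftrightarrow> fst a \<le> h \<and> length (snd a) = k + 1 \<and> fst ` set (snd a) \<subseteq> {..<3}"

lemma good_keep:
  "q \<le> h \<Longrightarrow> length ss = k + 1 \<Longrightarrow> set ss \<subseteq> {..<3} \<Longrightarrow> good h k (q, keep ss)"
  by (auto simp: good_def keep_def)

lemma good_update:
  "good h k (q, as) \<Longrightarrow> s < 3 \<Longrightarrow> good h k (q, as[r := (s, d)])"
  by (auto simp: good_def dest!: subsetD [OF set_update_subset_insert])

lemma compile_good:
  assumes "b \<le> q" "q < b + len P" "b + len P \<le> h" "e \<le> h" "regs P \<subseteq> {..<k}"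
    and ss: "length ss = k + 1" "set ss \<subseteq> {..<3}"
  shows "good h k (compile P b e q ss)"
  using assms(1-5)
proof (induction P arbitrary: b e)
  case (Push r x)
  have "ss ! r < 3" using ss Push.prems by (auto simp: subset_eq)
  with Push.prems show ?case
    using ss by (auto intro!: good_update good_keep simp: bit_sym_def)
qed (use ss in \<open>auto intro!: good_update good_keep\<close>)

text \<open>A register floats on its tape, whereas the output must start at cell 0. The additional
  state \<open>len P\<close> therefore pops register \<open>r\<close> symbol by symbol onto the
  untouched tape \<open>k\<close>, whose head still stands at 0.\<close>

definition machine :: "prog \<Rightarrow> nat \<Rightarrow> nat \<Rightarrow> tm" where
  "machine P k r = \<lparr>ntapes = k + 1, nsyms = 3, halt = len P + 1,
     trans = (\<lambda>q ss. if q < len P then compile P 0 (len P) q ss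
       else if ss ! r = 0 then (len P + 1, keep ss)
       else (len P, (keep ss)[r := (0, Rgt), k := (ss ! r, Rgt)]))\<rparr>"

lemma turing_machine_machine:
  assumes "regs P \<subseteq> {..<k}" "r < k"
  shows "turing_machine (machine P k r)"
proof -
  have "good (len P + 1) k (trans (machine P k r) q ss)"
    if "q < len P + 1" "length ss = k + 1" "set ss \<subseteq> {..<3}" for q ss
  proof -
    have "ss ! r < 3" using that assms by (auto simp: subset_eq)
    with that assms show ?thesis
      by (auto simp: machine_def intro!: good_update good_keep compile_good)
  qed
  then have "case trans (machine P k r) q ss of (q', as) \<Rightarrow>
      q' \<le> len P + 1 \<and> length as = k + 1 \<and> fst ` set as \<subseteq> {..<3}"
    if "q < len P + 1" "length ss = k + 1" "set ss \<subseteq> {..<3}" for q ss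
    using that unfolding good_def by (simp add: case_prod_beta)
  moreover have "ntapes (machine P k r) = k + 1" "nsyms (machine P k r) = 3"
    "halt (machine P k r) = len P + 1"
    by (simp_all add: machine_def)
  ultimately show ?thesis
    unfolding turing_machine_def by simp
qed

lemma map2_act_update2:
  assumes "r < length ts" "k < length ts" "r \<noteq> k"
  shows "map2 act ((keep (map scan ts))[r := a, k := b]) ts
    = ts[r := act a (ts ! r), k := act b (ts ! k)]"
  using assms by (intro nth_equalityI) (auto simp: nth_list_update keep_def)

lemma word_tape_take_Suc:
  assumes "i < length y"
  shows "(word_tape (take i y)) (int i := bit_sym (y ! i)) = word_tape (take (Suc i) y)"
  using assms by (auto simp: word_tape_def fun_eq_iff nth_append take_Suc_conv_app_nth)

lemma output_phase:
  fixes P k r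
  defines "M \<equiv> machine P k r"
  assumes "length ts = k + 1" "r < k" "represents (ts ! r) y" "ts ! k = (0, word_tape [])"
  shows "\<exists>ts'. (step M ^^ (length y + 1)) (len P, ts) = (len P + 1, ts') \<and> length ts' = k + 1
    \<and> snd (ts' ! k) = word_tape y"
proof -
  have "\<exists>ts'. (step M ^^ i) (len P, ts) = (len P, ts') \<and> length ts' = k + 1
    \<and> represents (ts' ! r) (drop i y) \<and> ts' ! k = (int i, word_tape (take i y))"
    if "i \<le> length y" for i
    using that
  proof (induction i)
    case 0
    then show ?case using assms by auto
  next
    case (Suc i)
    then obtain ts' where ts': "(step M ^^ i) (len P, ts) = (len P, ts')" "length ts' = k + 1"
      "represents (ts' ! r) (drop i y)" "ts' ! k = (int i, word_tape (take i y))"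
      by auto
    obtain h c where hc: "ts' ! r = (h, c)" by force
    have "scan (ts' ! r) = word_tape (drop i y) 0"
      using ts' hc by (simp add: represents_def)
    also have "\<dots> = bit_sym (y ! i)" using Suc.prems by (simp add: word_tape_def)
    finally have s: "scan (ts' ! r) = bit_sym (y ! i)" .
    then have "step M (len P, ts') =
      (len P, ts'[r := act (0, Rgt) (ts' ! r), k := act (bit_sym (y ! i), Rgt) (ts' ! k)])"
      using assms ts' by (simp add: machine_def map2_act_update2 bit_sym_def)
    moreover have "represents (act (0, Rgt) (ts' ! r)) (drop (Suc i) y)"
      using represents_pop [OF ts'(3)] by (simp add: drop_Suc tl_drop)
    moreover have "act (bit_sym (y ! i), Rgt) (ts' ! k) = (int (Suc i), word_tape (take (Suc i) y))"
      using Suc.prems by (simp add: ts' word_tape_take_Suc)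
    ultimately show ?case using assms ts' by simp
  qed
  from this [of "length y"] obtain ts' where ts': "(step M ^^ length y) (len P, ts) = (len P, ts')"
    "length ts' = k + 1" "represents (ts' ! r) []" "ts' ! k = (int (length y), word_tape y)"
    by auto
  obtain h c where hc: "ts' ! r = (h, c)" by force
  have "scan (ts' ! r) = 0" using ts' hc by (simp add: represents_def)
  then have "step M (len P, ts') = (len P + 1, ts')"
    using assms ts' by (intro step_keep) (auto simp: machine_def)
  with ts' show ?thesis by auto
qed

definition initial :: "word list \<Rightarrow> store" where
  "initial xs j = (if j < length xs then xs ! j else [])"

lemma machine_run:
  fixes P k r
  defines "M \<equiv> machine P k r"
  assumes "exec P (initial xs) t \<sigma>" "regs P \<subseteq> {..<k}" "r < k" "length xs \<le> k"
  shows "halted_with M (\<sigma> r) ((step M ^^ (t + length (\<sigma> r) + 1)) (start M xs))"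
proof -
  define ts where "ts = map (\<lambda>j. (0::int, word_tape (if j < length xs then xs ! j else []))) [0..<k + 1]"
  have start: "start M xs = (0, ts)" by (simp add: start_def ts_def M_def machine_def)
  have ts: "ts ! j = (0, word_tape (initial xs j))" if "j < k + 1" for j
    using that unfolding ts_def initial_def by (subst nth_map) (auto simp del: upt_Suc)
  have "stores k ts (initial xs)"
    by (auto simp: stores_def represents_def ts) (simp add: ts_def)
  then obtain ts' where ts': "(step M ^^ t) (0, ts) = (len P, ts')" "stores k ts' \<sigma>" "ts' ! k = ts ! k"
    using compile_correct [OF assms(2,3), of ts 0 M "len P"]
    by (auto simp: M_def machine_def)
  then have "ts' ! k = (0, word_tape [])" using ts [of k] assms(5) by (simp add: initial_def)
  then obtain ts'' where ts'': "(step M ^^ (length (\<sigma> r) + 1)) (len P, ts') = (len P + 1, ts'')"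
    "length ts'' = k + 1" "snd (ts'' ! k) = word_tape (\<sigma> r)"
    using output_phase [of ts' k r "\<sigma> r" P] ts' assms(4) by (auto simp: stores_def M_def)
  have "(step M ^^ (t + length (\<sigma> r) + 1)) (start M xs) = (len P + 1, ts'')"
    by (simp only: start ts'(1) ts''(1) add.assoc [of t] funpow_add_apply [where m = t])
  moreover have "last ts'' = ts'' ! k"
    using ts''(2) last_conv_nth [of ts''] by fastforce
  ultimately show ?thesis
    using ts''(3) by (simp add: halted_with_def M_def machine_def)
qed

section \<open>Polynomial running time\<close>

lemma poly_nat_mono: "m \<le> n \<Longrightarrow> poly p m \<le> poly p (n :: nat)" for p :: "nat poly"
  by (induction p) (auto intro: add_mono mult_mono)

definition poly_bounded :: "(nat \<Rightarrow> nat) \<Rightarrow> bool" where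
  "poly_bounded f \<longleftrightarrow> (\<exists>p. \<forall>n. f n \<le> poly p n)"

lemma poly_bounded_poly: "poly_bounded (poly p)"
  unfolding poly_bounded_def by blast

lemma poly_bounded_const: "poly_bounded (\<lambda>n. c)"
  unfolding poly_bounded_def by (intro exI [of _ "[:c:]"]) simp

lemma poly_bounded_id: "poly_bounded (\<lambda>n. n)"
  unfolding poly_bounded_def by (intro exI [of _ "[:0, 1:]"]) simp

lemma poly_bounded_add:
  assumes "poly_bounded f" "poly_bounded g"
  shows "poly_bounded (\<lambda>n. f n + g n)"
proof -
  obtain p q where "\<forall>n. f n \<le> poly p n" "\<forall>n. g n \<le> poly q n"
    using assms by (auto simp: poly_bounded_def)
  then have "\<forall>n. f n + g n \<le> poly (p + q) n" by (simp add: add_mono)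
  then show ?thesis unfolding poly_bounded_def by blast
qed

lemma poly_bounded_mult:
  assumes "poly_bounded f" "poly_bounded g"
  shows "poly_bounded (\<lambda>n. f n * g n)"
proof -
  obtain p q where "\<forall>n. f n \<le> poly p n" "\<forall>n. g n \<le> poly q n"
    using assms by (auto simp: poly_bounded_def)
  then have "\<forall>n. f n * g n \<le> poly (p * q) n" by (simp add: mult_mono)
  then show ?thesis unfolding poly_bounded_def by blast
qed

text \<open>Polynomials over the natural numbers are monotone, so one bound covers all arguments up
  to \<open>g n\<close>.\<close>

lemma poly_bounded_compose:
  assumes "poly_bounded f" "poly_bounded g"
  shows "\<exists>h. poly_bounded h \<and> (\<forall>n m. m \<le> g n \<longrightarrow> f m \<le> h n)"
proof -
  obtain p q where pq: "\<forall>n. f n \<le> poly p n" "\<forall>n. g n \<le> poly q n"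
    using assms by (auto simp: poly_bounded_def)
  have "f m \<le> poly (pcompose p q) n" if "m \<le> g n" for m n
    using pq that by (metis order_trans poly_nat_mono poly_pcompose)
  then show ?thesis using poly_bounded_poly by blast
qed

text \<open>
  Only the sizes of the registers in \<open>R\<close> may enter the time bound; this makes loops that write
  long outputs to registers outside \<open>R\<close> easy to bound.
\<close>

definition polytime_on :: "nat set \<Rightarrow> (store \<Rightarrow> bool) \<Rightarrow> prog \<Rightarrow> bool" where
  "polytime_on R D P \<longleftrightarrow> (\<exists>f. poly_bounded f \<and> (\<forall>n \<sigma>. D \<sigma> \<longrightarrow> (\<forall>r\<in>R. length (\<sigma> r) \<le> n)
     \<longrightarrow> (\<exists>t \<le> f n. exec P \<sigma> t (den P \<sigma>))))"

lemma polytime_onE: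
  assumes "polytime_on R D P"
  obtains f where "poly_bounded f" "mono f"
    "\<And>n \<sigma>. D \<sigma> \<Longrightarrow> \<forall>r\<in>R. length (\<sigma> r) \<le> n \<Longrightarrow> \<exists>t \<le> f n. exec P \<sigma> t (den P \<sigma>)"
proof -
  obtain f p where f: "\<forall>n. f n \<le> poly p n" "\<forall>n \<sigma>. D \<sigma> \<longrightarrow> (\<forall>r\<in>R. length (\<sigma> r) \<le> n)
     \<longrightarrow> (\<exists>t \<le> f n. exec P \<sigma> t (den P \<sigma>))"
    using assms by (auto simp: polytime_on_def poly_bounded_def)
  show ?thesis
  proof
    show "poly_bounded (poly p)" by (rule poly_bounded_poly)
    show "mono (poly p)" by (rule monoI) (rule poly_nat_mono)
    show "\<exists>t \<le> poly p n. exec P \<sigma> t (den P \<sigma>)" if "D \<sigma>" "\<forall>r\<in>R. length (\<sigma> r) \<le> n" for n \<sigma>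
      using f that by (meson order_trans)
  qed
qed

lemma polytime_on_weaken:
  assumes "polytime_on R D P" "R \<subseteq> R'" "\<And>\<sigma>. D' \<sigma> \<Longrightarrow> D \<sigma>"
  shows "polytime_on R' D' P"
  using assms unfolding polytime_on_def by (meson subsetD)

lemma polytime_on_constant:
  assumes "\<And>\<sigma>. exec P \<sigma> c (den P \<sigma>)"
  shows "polytime_on R D P"
proof -
  have "poly_bounded (\<lambda>n. c)" by (rule poly_bounded_const)
  with assms show ?thesis unfolding polytime_on_def by blast
qed

lemma polytime_on_Skip: "polytime_on R D Skip"
  by (rule polytime_on_constant) (unfold den.simps, rule exec.Skip)

lemma polytime_on_Push: "polytime_on R D (Push r b)"
  by (rule polytime_on_constant) (unfold den.simps, rule exec.Push)

lemma polytime_on_Pop: "polytime_on R D (Pop r)"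
  by (rule polytime_on_constant) (unfold den.simps, rule exec.Pop)

lemma polytime_on_Seq:
  assumes "polytime_on R D P" "polytime_on R D' Q" "\<And>\<sigma>. D \<sigma> \<Longrightarrow> D' (den P \<sigma>)"
  shows "polytime_on R D (P ;; Q)"
proof -
  obtain f where f: "poly_bounded f" "mono f"
    "\<And>n \<sigma>. D \<sigma> \<Longrightarrow> \<forall>r\<in>R. length (\<sigma> r) \<le> n \<Longrightarrow> \<exists>t \<le> f n. exec P \<sigma> t (den P \<sigma>)"
    using polytime_onE [OF assms(1)] by metis
  obtain g where g: "poly_bounded g" "mono g"
    "\<And>n \<sigma>. D' \<sigma> \<Longrightarrow> \<forall>r\<in>R. length (\<sigma> r) \<le> n \<Longrightarrow> \<exists>t \<le> g n. exec Q \<sigma> t (den Q \<sigma>)"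
    using polytime_onE [OF assms(2)] by metis
  obtain h where h: "poly_bounded h" "\<And>n m. m \<le> n + f n \<Longrightarrow> g m \<le> h n"
    using poly_bounded_compose [OF g(1) poly_bounded_add [OF poly_bounded_id f(1)]] by blast
  have "\<exists>t \<le> f n + h n. exec (P ;; Q) \<sigma> t (den (P ;; Q) \<sigma>)"
    if d: "D \<sigma>" and n: "\<forall>r\<in>R. length (\<sigma> r) \<le> n" for n \<sigma>
  proof -
    obtain s where s: "s \<le> f n" "exec P \<sigma> s (den P \<sigma>)" using f(3) [OF d n] by blast
    have "length (den P \<sigma> r) \<le> n + f n" if "r \<in> R" for r
      using exec_length [OF s(2), of r] s(1) n that by fastforce
    then have "\<forall>r\<in>R. length (den P \<sigma> r) \<le> n + f n" by blast
    then obtain t where "t \<le> g (n + f n)" "exec Q (den P \<sigma>) t (den Q (den P \<sigma>))"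
      using g(3) assms(3) [OF d] by blast
    with s h(2) [of "n + f n" n] show ?thesis
      by (intro exI [of _ "s + t"]) (auto intro: exec.Seq)
  qed
  moreover have "poly_bounded (\<lambda>n. f n + h n)"
    by (intro poly_bounded_add f(1) h(1))
  ultimately show ?thesis unfolding polytime_on_def by blast
qed

lemma polytime_on_Test:
  assumes "polytime_on R (\<lambda>\<sigma>. D \<sigma> \<and> peek (\<sigma> r) \<in> A) P" "polytime_on R (\<lambda>\<sigma>. D \<sigma> \<and> peek (\<sigma> r) \<notin> A) Q"
  shows "polytime_on R D (Test r A P Q)"
proof -
  obtain f where f: "poly_bounded f" "mono f"
    "\<And>n \<sigma>. D \<sigma> \<and> peek (\<sigma> r) \<in> A \<Longrightarrow> \<forall>r\<in>R. length (\<sigma> r) \<le> n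
      \<Longrightarrow> \<exists>t \<le> f n. exec P \<sigma> t (den P \<sigma>)"
    using polytime_onE [OF assms(1)] by metis
  obtain g where g: "poly_bounded g" "mono g"
    "\<And>n \<sigma>. D \<sigma> \<and> peek (\<sigma> r) \<notin> A \<Longrightarrow> \<forall>r\<in>R. length (\<sigma> r) \<le> n
      \<Longrightarrow> \<exists>t \<le> g n. exec Q \<sigma> t (den Q \<sigma>)"
    using polytime_onE [OF assms(2)] by metis
  have "\<exists>t \<le> 1 + f n + g n. exec (Test r A P Q) \<sigma> t (den (Test r A P Q) \<sigma>)"
    if d: "D \<sigma>" and n: "\<forall>r\<in>R. length (\<sigma> r) \<le> n" for n \<sigma>
  proof (cases "peek (\<sigma> r) \<in> A")
    case True
    then obtain t where "t \<le> f n" "exec P \<sigma> t (den P \<sigma>)" using f(3) d n by blast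
    with True show ?thesis by (intro exI [of _ "1 + t"]) (auto intro: exec.Test_True [simplified])
  next
    case False
    then obtain t where "t \<le> g n" "exec Q \<sigma> t (den Q \<sigma>)" using g(3) d n by blast
    with False show ?thesis by (intro exI [of _ "1 + t"]) (auto intro: exec.Test_False [simplified])
  qed
  moreover have "poly_bounded (\<lambda>n. 1 + f n + g n)"
    by (intro poly_bounded_add f(1) g(1) poly_bounded_const)
  ultimately show ?thesis unfolding polytime_on_def by blast
qed

text \<open>\<open>\<Phi>\<close> serves twice. It decreases, so it bounds the number of iterations,
  and it caps the registers in \<open>R\<close>: they never exceed the larger of their size at entry
  and the value of \<open>\<Phi>\<close> at entry. Without such a cap a polynomial body could let
  the sizes grow exponentially over the iterations.\<close>

lemma polytime_on_Loop:
  fixes \<Phi> :: "store \<Rightarrow> nat"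
  assumes "polytime_on R D P"
    and step: "\<And>\<sigma>. D \<sigma> \<Longrightarrow> peek (\<sigma> r) \<in> A \<Longrightarrow> D (den P \<sigma>) \<and> \<Phi> (den P \<sigma>) < \<Phi> \<sigma>"
    and size: "\<And>\<sigma> i. D \<sigma> \<Longrightarrow> peek (\<sigma> r) \<in> A \<Longrightarrow> i \<in> R
      \<Longrightarrow> length (den P \<sigma> i) \<le> max (length (\<sigma> i)) (\<Phi> \<sigma>)"
    and "poly_bounded b" "\<And>n \<sigma>. D \<sigma> \<Longrightarrow> \<forall>r\<in>R. length (\<sigma> r) \<le> n \<Longrightarrow> \<Phi> \<sigma> \<le> b n"
  shows "polytime_on R D (Loop r A P)"
proof -
  obtain f where f: "poly_bounded f" "mono f"
    "\<And>n \<sigma>. D \<sigma> \<Longrightarrow> \<forall>r\<in>R. length (\<sigma> r) \<le> n \<Longrightarrow> \<exists>t \<le> f n. exec P \<sigma> t (den P \<sigma>)"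
    using polytime_onE [OF assms(1)] by metis
  \<comment> \<open>The size \<open>n\<close> stays fixed during the whole loop and already
    dominates \<open>\<Phi>\<close>; only the bound \<open>m\<close> on the remaining iterations
    decreases.\<close>
  have loop: "\<exists>t \<le> m * (1 + f n) + 1. exec (Loop r A P) \<sigma> t (den (Loop r A P) \<sigma>)"
    if "D \<sigma>" "\<forall>r\<in>R. length (\<sigma> r) \<le> n" "\<Phi> \<sigma> \<le> m" "m \<le> n" for m n \<sigma>
    using that
  proof (induction m arbitrary: \<sigma> rule: less_induct)
    case (less m)
    show ?case
    proof (cases "peek (\<sigma> r) \<in> A")
      case False
      then show ?thesis
        by (intro exI [of _ 1]) (auto simp: den_Loop intro: exec.Loop_False [simplified])
    next
      case True
      obtain s where s: "s \<le> f n" "exec P \<sigma> s (den P \<sigma>)" using f(3) less.prems by blast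
      have 1: "D (den P \<sigma>)" "\<Phi> (den P \<sigma>) \<le> m - 1" "m > 0"
        using step [OF less.prems(1) True] less.prems(3) by auto
      have 2: "length (den P \<sigma> i) \<le> n" if "i \<in> R" for i
        using size [OF less.prems(1) True that] bspec [OF less.prems(2) that] less.prems(3,4) by auto
      have "m - 1 \<le> n" using less.prems(4) by simp
      obtain t where t: "t \<le> (m - 1) * (1 + f n) + 1"
        "exec (Loop r A P) (den P \<sigma>) t (den (Loop r A P) (den P \<sigma>))"
        using less.IH [of "m - 1" "den P \<sigma>"] 1 2 \<open>m - 1 \<le> n\<close> by (metis diff_less zero_less_one)
      have "exec (Loop r A P) \<sigma> (1 + s + t) (den (Loop r A P) \<sigma>)"
        using exec.Loop_True [OF True s(2) t(2)] True by (simp add: den_Loop [of r A P \<sigma>])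
      moreover have "1 + s + t \<le> m * (1 + f n) + 1"
        using s t(1) \<open>m > 0\<close> by (cases m) auto
      ultimately show ?thesis by blast
    qed
  qed
  obtain h where h: "poly_bounded h" "\<And>n m. m \<le> n + b n \<Longrightarrow> f m \<le> h n"
    using poly_bounded_compose [OF f(1) poly_bounded_add [OF poly_bounded_id assms(4)]] by blast
  have "\<exists>t \<le> b n * (1 + h n) + 1. exec (Loop r A P) \<sigma> t (den (Loop r A P) \<sigma>)"
    if "D \<sigma>" "\<forall>r\<in>R. length (\<sigma> r) \<le> n" for n \<sigma>
  proof -
    have "\<exists>t \<le> b n * (1 + f (n + b n)) + 1. exec (Loop r A P) \<sigma> t (den (Loop r A P) \<sigma>)"
      using that assms(5) [OF that] by (intro loop) (auto simp: trans_le_add1)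
    moreover have "b n * (1 + f (n + b n)) + 1 \<le> b n * (1 + h n) + 1"
      using h(2) [of "n + b n" n] by simp
    ultimately show ?thesis by (meson order_trans)
  qed
  moreover have "poly_bounded (\<lambda>n. b n * (1 + h n) + 1)"
    by (intro poly_bounded_add poly_bounded_mult poly_bounded_const assms(4) h(1))
  ultimately show ?thesis unfolding polytime_on_def by blast
qed

theorem polytimeI:
  assumes P: "polytime_on UNIV D P" "\<And>xs. length xs = n \<Longrightarrow> D (initial xs)"
    and f: "\<And>xs. length xs = n \<Longrightarrow> den P (initial xs) r = f xs"
  shows "polytime n f"
proof -
  have fin: "finite (regs P)" by (induction P) auto
  define k where "k = Suc (Max (insert r (insert n (regs P))))"
  have "finite (insert r (insert n (regs P)))" using fin by simp
  then have k: "x < k" if "x \<in> insert r (insert n (regs P))" for x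
    unfolding k_def using Max_ge [OF _ that] by (simp add: less_Suc_eq_le)
  obtain g where g: "poly_bounded g" "mono g"
    "\<And>n \<sigma>. D \<sigma> \<Longrightarrow> \<forall>r. length (\<sigma> r) \<le> n \<Longrightarrow> \<exists>t \<le> g n. exec P \<sigma> t (den P \<sigma>)"
    using polytime_onE [OF P(1)] by (metis UNIV_I)
  have "poly_bounded (\<lambda>n. g n + (n + g n) + 1)"
    by (intro poly_bounded_add g(1) poly_bounded_id poly_bounded_const)
  then obtain p where p: "\<And>n. g n + (n + g n) + 1 \<le> poly p n" by (auto simp: poly_bounded_def)
  let ?M = "machine P k r"
  have "\<exists>t \<le> poly p (sum_list (map length xs)). halted_with ?M (f xs) ((step ?M ^^ t) (start ?M xs))"
    if xs: "length xs = n" for xs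
  proof -
    let ?n = "sum_list (map length xs)"
    have n: "length (initial xs j) \<le> ?n" for j
      by (auto simp: initial_def intro: member_le_sum_list)
    then obtain t where t: "t \<le> g ?n" "exec P (initial xs) t (den P (initial xs))"
      using g(3) P(2) [OF xs] by blast
    have "length (f xs) \<le> ?n + g ?n"
      using exec_length [OF t(2), of r] n [of r] t(1) f [OF xs] by simp
    with t p [of ?n] have "t + length (f xs) + 1 \<le> poly p ?n" by simp
    moreover have "halted_with ?M (f xs) ((step ?M ^^ (t + length (f xs) + 1)) (start ?M xs))"
      using machine_run [OF t(2), of k r] k f [OF xs] xs by (auto simp: less_imp_le)
    ultimately show ?thesis by blast
  qed
  moreover have "turing_machine ?M" using k by (intro turing_machine_machine) auto
  moreover have "n \<le> ntapes ?M" using k [of n] by (simp add: machine_def)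
  ultimately show ?thesis unfolding polytime_def by blast
qed

section \<open>Unsatisfiability as reachability of a clash\<close>

fun flat :: "fm \<Rightarrow> fm set" where
  "flat (And \<phi> \<psi>) = flat \<phi> \<union> flat \<psi>"
| "flat \<phi> = {\<phi>}"

definition conjuncts :: "fm set \<Rightarrow> fm set" where
  "conjuncts \<Gamma> = (\<Union>\<phi>\<in>\<Gamma>. flat \<phi>)"

text \<open>The tableau move to the successor world that a chosen diamond forces to exist.\<close>

definition dia_step :: "fm set \<Rightarrow> fm set \<Rightarrow> bool" where
  "dia_step \<Gamma> \<Delta> \<longleftrightarrow> (\<exists>\<chi>. Dia \<chi> \<in> conjuncts \<Gamma> \<and> \<Delta> = insert \<chi> {\<psi>. Box \<psi> \<in> conjuncts \<Gamma>})"

definition clash :: "fm set \<Rightarrow> bool" where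
  "clash \<Gamma> \<longleftrightarrow> Fls \<in> conjuncts \<Gamma> \<or> (\<exists>i. Var i \<in> conjuncts \<Gamma> \<and> BarVar i \<in> conjuncts \<Gamma>)"

lemma holds_flat: "holds M w \<phi> \<longleftrightarrow> (\<forall>\<psi>\<in>flat \<phi>. holds M w \<psi>)"
  by (induction \<phi> rule: flat.induct) auto

lemma holds_conjuncts:
  assumes "\<forall>\<phi>\<in>\<Gamma>. holds M w \<phi>" "\<psi> \<in> conjuncts \<Gamma>"
  shows "holds M w \<psi>"
proof -
  obtain \<phi> where \<phi>: "\<phi> \<in> \<Gamma>" "\<psi> \<in> flat \<phi>" using assms(2) by (auto simp: conjuncts_def)
  then have "holds M w \<phi>" using assms(1) by blast
  then have "\<forall>\<psi>\<in>flat \<phi>. holds M w \<psi>" by (rule holds_flat [THEN iffD1])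
  with \<phi>(2) show ?thesis by blast
qed

text \<open>Any model of the first set can follow the path: the witness of each chosen diamond
  satisfies the whole next set.\<close>

lemma clash_reachable_unsat:
  assumes "dia_step\<^sup>*\<^sup>* \<Gamma> \<Delta>" "clash \<Delta>" "\<forall>\<phi>\<in>\<Gamma>. holds M w \<phi>"
  shows False
  using assms
proof (induction arbitrary: w rule: converse_rtranclp_induct)
  case base
  note * = holds_conjuncts [OF base.prems(2)]
  consider "Fls \<in> conjuncts \<Delta>" | i where "Var i \<in> conjuncts \<Delta>" "BarVar i \<in> conjuncts \<Delta>"
    using base.prems(1) unfolding clash_def by blast
  then show ?case
  proof cases
    case 1
    from * [OF this] show ?thesis by simp
  next
    case 2
    from * [OF this(1)] * [OF this(2)] show ?thesis by simp
  qed
next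
  case (step \<Gamma> \<Gamma>')
  have *: "\<forall>\<psi>\<in>conjuncts \<Gamma>. holds M w \<psi>"
    using holds_conjuncts [OF step.prems(2)] by blast
  obtain \<chi> where \<chi>: "Dia \<chi> \<in> conjuncts \<Gamma>" "\<Gamma>' = insert \<chi> {\<psi>. Box \<psi> \<in> conjuncts \<Gamma>}"
    using step.hyps(1) by (auto simp: dia_step_def)
  obtain v where v: "(w, v) \<in> rel M" "holds M v \<chi>" using bspec [OF * \<chi>(1)] by auto
  have "holds M v \<psi>" if "Box \<psi> \<in> conjuncts \<Gamma>" for \<psi>
    using bspec [OF * that] v(1) by simp
  with v \<chi> have "\<forall>\<phi>\<in>\<Gamma>'. holds M v \<phi>" by blast
  then show ?case using step.IH step.prems(1) by blast
qed

text \<open>The tableau is itself a model: its only successors are those demanded by diamonds, and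
  they contain all the boxed formulas by construction.\<close>

definition canonical :: "fm set model" where
  "canonical = \<lparr>worlds = UNIV, rel = {(\<Gamma>, \<Delta>). dia_step \<Gamma> \<Delta>}, val = \<lambda>i. {\<Gamma>. Var i \<in> conjuncts \<Gamma>}\<rparr>"

text \<open>Membership is expressed by \<open>flat\<close>, which makes the case of
  \<open>And\<close> immediate. Freedom from clashes is required of everything reachable because the
  modal cases pass to a successor; it is used at negated variables and at
  \<open>Fls\<close>.\<close>

lemma canonical_truth:
  assumes "flat \<phi> \<subseteq> conjuncts \<Gamma>" "\<And>\<Delta>. dia_step\<^sup>*\<^sup>* \<Gamma> \<Delta> \<Longrightarrow> \<not> clash \<Delta>"
    "operators \<phi> \<inter> {ONeg, OOr} = {}"
  shows "holds canonical \<Gamma> \<phi>"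
  using assms
proof (induction \<phi> arbitrary: \<Gamma>)
  case (BarVar i)
  then show ?case using BarVar.prems(2) [of \<Gamma>] by (auto simp: canonical_def clash_def)
next
  case (Box \<phi>)
  have "holds canonical \<Delta> \<phi>" if "dia_step \<Gamma> \<Delta>" for \<Delta>
  proof (rule Box.IH)
    have "\<phi> \<in> \<Delta>" using that Box.prems(1) by (auto simp: dia_step_def)
    then show "flat \<phi> \<subseteq> conjuncts \<Delta>" by (auto simp: conjuncts_def)
    show "\<not> clash \<Delta>'" if "dia_step\<^sup>*\<^sup>* \<Delta> \<Delta>'" for \<Delta>'
      using Box.prems(2) \<open>dia_step \<Gamma> \<Delta>\<close> that by (meson converse_rtranclp_into_rtranclp)
  qed (use Box.prems in auto)
  then show ?case by (auto simp: canonical_def)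
next
  case (Dia \<phi>)
  define \<Delta> where "\<Delta> = insert \<phi> {\<psi>. Box \<psi> \<in> conjuncts \<Gamma>}"
  have \<Delta>: "dia_step \<Gamma> \<Delta>" using Dia.prems(1) by (auto simp: dia_step_def \<Delta>_def)
  have "holds canonical \<Delta> \<phi>"
  proof (rule Dia.IH)
    show "flat \<phi> \<subseteq> conjuncts \<Delta>" by (auto simp: conjuncts_def \<Delta>_def)
    show "\<not> clash \<Delta>'" if "dia_step\<^sup>*\<^sup>* \<Delta> \<Delta>'" for \<Delta>'
      using Dia.prems(2) \<Delta> that by (meson converse_rtranclp_into_rtranclp)
  qed (use Dia.prems in auto)
  with \<Delta> show ?case by (auto simp: canonical_def)
next
  case Fls
  then show ?case using Fls.prems(2) [of \<Gamma>] by (auto simp: clash_def)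
qed (auto simp: canonical_def)

lemma unsat_iff_clash_reachable:
  assumes "operators \<phi> \<inter> {ONeg, OOr} = {}"
  shows "\<not> satisfiable \<phi> \<longleftrightarrow> (\<exists>\<Delta>. dia_step\<^sup>*\<^sup>* {\<phi>} \<Delta> \<and> clash \<Delta>)"
proof
  assume "\<exists>\<Delta>. dia_step\<^sup>*\<^sup>* {\<phi>} \<Delta> \<and> clash \<Delta>"
  then obtain \<Delta> where \<Delta>: "dia_step\<^sup>*\<^sup>* {\<phi>} \<Delta>" "clash \<Delta>" by blast
  have "\<not> holds M w \<phi>" for M :: "nat model" and w
    using clash_reachable_unsat [OF \<Delta>, of M w] by auto
  then show "\<not> satisfiable \<phi>" unfolding satisfiable_def by auto
next
  assume *: "\<not> satisfiable \<phi>"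
  show "\<exists>\<Delta>. dia_step\<^sup>*\<^sup>* {\<phi>} \<Delta> \<and> clash \<Delta>"
  proof (rule ccontr)
    assume "\<nexists>\<Delta>. dia_step\<^sup>*\<^sup>* {\<phi>} \<Delta> \<and> clash \<Delta>"
    then have "holds canonical {\<phi>} \<phi>"
      using assms by (intro canonical_truth) (auto simp: conjuncts_def)
    then have "satisfiable \<phi>"
      by (intro satisfiableI [of canonical "{\<phi>}"]) (auto simp: canonical_def kripke_model_def)
    with * show False ..
  qed
qed

section \<open>Exact covers as paths through alternating chains\<close>

primrec chain :: "bool list \<Rightarrow> fm" where
  "chain [] = Var 0"
| "chain (b # bs) = (if b then Dia else Box) (chain bs)"

definition chains_fm :: "bool list list \<Rightarrow> nat \<Rightarrow> fm \<Rightarrow> fm" where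
  "chains_fm bs m F = foldr And (map chain bs) ((Box ^^ m) F)"

text \<open>\<open>dia_step\<close> on words of modalities, where \<open>True\<close> is a diamond
  and \<open>False\<close> a box.\<close>

definition chain_step :: "bool list set \<Rightarrow> bool list set \<Rightarrow> bool" where
  "chain_step X Y \<longleftrightarrow> (\<exists>b. True # b \<in> X \<and> Y = insert b {c. False # c \<in> X})"

lemma holds_chains_fm:
  "holds M w (chains_fm bs m F) \<longleftrightarrow> (\<forall>b\<in>set bs. holds M w (chain b)) \<and> holds M w ((Box ^^ m) F)"
  unfolding chains_fm_def by (induction bs) auto

text \<open>The chosen diamonds lead a model through \<open>m\<close> steps, and the boxes carry
  \<open>F\<close> to the world at the end.\<close>

lemma chain_path_refutes:
  assumes "(chain_step ^^ m) X Y" "\<forall>b\<in>X. holds M w (chain b)" "holds M w ((Box ^^ m) F)"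
    "\<And>w. \<not> holds M w F"
  shows False
  using assms
proof (induction m arbitrary: X w)
  case 0
  then show ?case by simp
next
  case (Suc m)
  obtain X' where X': "chain_step X X'" "(chain_step ^^ m) X' Y"
    using Suc.prems(1) by (meson relpowp_Suc_D2)
  obtain b where b: "True # b \<in> X" "X' = insert b {c. False # c \<in> X}"
    using X'(1) by (auto simp: chain_step_def)
  obtain v where v: "(w, v) \<in> rel M" "holds M v (chain b)"
    using bspec [OF Suc.prems(2) b(1)] by auto
  have "holds M v (chain c)" if "False # c \<in> X" for c
    using bspec [OF Suc.prems(2) that] v(1) by simp
  then have "\<forall>b\<in>X'. holds M v (chain b)" using b v by blast
  then show ?case using Suc.IH [OF X'(2)] Suc.prems(3,4) v(1) by auto
qed

text \<open>Chains end in an unnegated variable, so all variables may be true everywhere; only the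
  lengths of paths matter.\<close>

definition chain_model :: "bool list set model" where
  "chain_model = \<lparr>worlds = UNIV, rel = {(X, Y). chain_step X Y}, val = \<lambda>i. UNIV\<rparr>"

lemma rel_chain_model: "(X, Y) \<in> rel chain_model \<longleftrightarrow> chain_step X Y"
  by (simp add: chain_model_def)

lemma chain_model_chain: "b \<in> X \<Longrightarrow> holds chain_model X (chain b)"
proof (induction b arbitrary: X)
  case (Cons b bs)
  show ?case
  proof (cases b)
    case True
    define Y where "Y = insert bs {c. False # c \<in> X}"
    have "chain_step X Y" using Cons.prems True by (auto simp: chain_step_def Y_def)
    moreover have "holds chain_model Y (chain bs)" by (rule Cons.IH) (simp add: Y_def)
    ultimately show ?thesis using True by (auto simp: rel_chain_model)
  next
    case False
    have "holds chain_model Y (chain bs)" if "chain_step X Y" for Y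
      using that Cons.prems False by (intro Cons.IH) (auto simp: chain_step_def)
    then show ?thesis using False by (auto simp: rel_chain_model)
  qed
qed (simp add: chain_model_def)

text \<open>Without a path of length \<open>m\<close> the boxes hold vacuously, whatever
  \<open>F\<close> is.\<close>

lemma chain_model_boxes:
  "\<forall>Y. \<not> (chain_step ^^ m) X Y \<Longrightarrow> holds chain_model X ((Box ^^ m) F)"
proof (induction m arbitrary: X)
  case (Suc m)
  have "holds chain_model Y ((Box ^^ m) F)" if "chain_step X Y" for Y
    using Suc.prems that by (intro Suc.IH) (meson relpowp_Suc_I2)
  then show ?case by (simp add: rel_chain_model)
qed simp

lemma satisfiable_chains_fm:
  assumes "\<And>M :: nat model. \<And>w. \<not> holds M w F"
  shows "satisfiable (chains_fm bs m F) \<longleftrightarrow> (\<forall>Y. \<not> (chain_step ^^ m) (set bs) Y)"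
proof
  assume "satisfiable (chains_fm bs m F)"
  then obtain M :: "nat model" and w where
    "\<forall>b\<in>set bs. holds M w (chain b)" "holds M w ((Box ^^ m) F)"
    unfolding satisfiable_def holds_chains_fm by auto
  then show "\<forall>Y. \<not> (chain_step ^^ m) (set bs) Y"
    using chain_path_refutes [of m "set bs" _ M w F] assms by auto
next
  assume "\<forall>Y. \<not> (chain_step ^^ m) (set bs) Y"
  then have "holds chain_model (set bs) (chains_fm bs m F)"
    by (auto simp: holds_chains_fm intro: chain_model_chain chain_model_boxes)
  then show "satisfiable (chains_fm bs m F)"
    by (intro satisfiableI [of chain_model "set bs"]) (auto simp: chain_model_def kripke_model_def)
qed

text \<open>
  In the first pass over the levels a chain survives only if it is the one selected at each of its
  diamonds, so the surviving chains are pairwise disjoint; the second pass needs a surviving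
  diamond at every level.
\<close>

lemma chain_path_iff_exact_cover:
  assumes len: "\<And>p. p \<in> X \<Longrightarrow> length p = L"
  shows "(\<exists>Y. (chain_step ^^ (2 * L)) ((\<lambda>p. p @ p) ` X) Y) \<longleftrightarrow>
    (\<exists>C\<subseteq>X. \<forall>l<L. \<exists>!p. p \<in> C \<and> p ! l)"
proof
  assume "\<exists>Y. (chain_step ^^ (2 * L)) ((\<lambda>p. p @ p) ` X) Y"
  then obtain G where G: "G 0 = (\<lambda>p. p @ p) ` X" "\<And>i. i < 2 * L \<Longrightarrow> chain_step (G i) (G (Suc i))"
    by (auto simp: relpowp_fun_conv)
  then obtain b where b: "\<And>i. i < 2 * L \<Longrightarrow> True # b i \<in> G i"
    "\<And>i. i < 2 * L \<Longrightarrow> G (Suc i) = insert (b i) {c. False # c \<in> G i}"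
    unfolding chain_step_def by metis
  \<comment> \<open>The members of \<open>X\<close> that survive the first \<open>i\<close>
    steps.\<close>
  define C where "C i = {p \<in> X. drop i p @ p \<in> G i}" for i
  have drop: "drop i p = p ! i # drop (Suc i) p" if "p \<in> X" "i < L" for p i
    using that len by (simp add: Cons_nth_drop_Suc)
  have GC: "G i = (\<lambda>p. drop i p @ p) ` C i" if "i \<le> L" for i
    using that
  proof (induction i)
    case (Suc i)
    have "\<exists>p\<in>X. c = drop (Suc i) p @ p" if "c \<in> G (Suc i)" for c
    proof -
      have "True # c \<in> G i \<or> False # c \<in> G i" using that b [of i] Suc.prems by auto
      then obtain p v where "p \<in> C i" "v # c = drop i p @ p" using Suc by auto
      then show ?thesis using drop [of p i] Suc.prems by (auto simp: C_def)
    qed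
    then show ?case by (auto simp: C_def)
  qed (auto simp: G C_def)
  \<comment> \<open>The suffix ends in a full copy of the pattern and so identifies it; hence the
    element of \<open>G i\<close> behind it comes from the same pattern. If that element begins with
    a diamond, it can only have survived by being the selected chain.\<close>
  have C_Suc: "p \<in> C i \<and> (p ! i \<longrightarrow> drop (Suc i) p @ p = b i)" if p: "p \<in> C (Suc i)" and i: "i < L" for p i
  proof -
    let ?c = "drop (Suc i) p @ p"
    have pX: "p \<in> X" and c: "?c \<in> G (Suc i)" using p by (auto simp: C_def)
    have same: "v = p ! i \<and> p \<in> C i" if "v # ?c \<in> G i" for v
    proof -
      have "v # ?c \<in> (\<lambda>p. drop i p @ p) ` C i" using GC [of i] that i by simp
      then obtain q where q: "q \<in> C i" "v # ?c = drop i q @ q" by blast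
      then have "v # ?c = q ! i # drop (Suc i) q @ q" "length p = length q"
        using drop [of q i] i pX len by (auto simp: C_def)
      with q show ?thesis by auto
    qed
    show ?thesis
    proof (cases "?c = b i")
      case True
      then have "True # ?c \<in> G i" using b(1) [of i] i by simp
      with same True show ?thesis by blast
    next
      case False
      then have "False # ?c \<in> G i" using b(2) [of i] i c by auto
      with same show ?thesis by blast
    qed
  qed
  have C_mono: "C j \<subseteq> C i" if "i \<le> j" "j \<le> L" for i j
    using that
  proof (induction j rule: dec_induct)
    case (step n)
    have "C (Suc n) \<subseteq> C n" using C_Suc [of _ n] step.prems by auto
    moreover have "C n \<subseteq> C i" using step.IH step.prems by simp
    ultimately show ?case by blast
  qed simp
  \<comment> \<open>The second pass can only lose chains, so every suffix that is left comes from a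
    pattern in \<open>C L\<close>.\<close>
  have G2: "G (L + i) \<subseteq> drop i ` C L" if "i \<le> L" for i
    using that
  proof (induction i)
    case 0
    have "G L = (\<lambda>p. drop L p @ p) ` C L" using GC [of L] by simp
    also have "\<dots> = id ` C L" using len by (intro image_cong) (auto simp: C_def)
    finally show ?case by simp
  next
    case (Suc i)
    show ?case
    proof
      fix c assume "c \<in> G (L + Suc i)"
      then have "True # c \<in> G (L + i) \<or> False # c \<in> G (L + i)"
        using b [of "L + i"] Suc.prems by auto
      then obtain p v where p: "p \<in> C L" "v # c = drop i p" using Suc by auto
      then have "c = drop (Suc i) p" by (metis drop_Suc list.sel(3) tl_drop)
      with p show "c \<in> drop (Suc i) ` C L" by blast
    qed
  qed
  \<comment> \<open>Existence comes from the second pass, where step \<open>L + l\<close> must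
    select a diamond at level \<open>l\<close>; uniqueness comes from the first, where step
    \<open>l\<close> kept only one chain with a diamond there.\<close>
  have "\<exists>!p. p \<in> C L \<and> p ! l" if l: "l < L" for l
  proof -
    have "True # b (L + l) \<in> drop l ` C L" using G2 [of l] b(1) [of "L + l"] l by auto
    then obtain p where p: "p \<in> C L" "drop l p = True # b (L + l)" by auto
    then have "p ! l" using drop [of p l] l by (auto simp: C_def)
    moreover have "p = q" if "p \<in> C L" "p ! l" "q \<in> C L" "q ! l" for p q
    proof -
      have "p \<in> C (Suc l)" "q \<in> C (Suc l)" using that C_mono [of "Suc l" L] l by auto
      then have "drop (Suc l) p @ p = b l" "drop (Suc l) q @ q = b l"
        using C_Suc [of p l] C_Suc [of q l] l that(2,4) by blast+
      moreover have "length p = length q" using that(1,3) len by (simp add: C_def)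
      ultimately show ?thesis by (metis append_eq_append_conv)
    qed
    ultimately show ?thesis using p(1) by (intro ex1I [of _ p]) blast+
  qed
  moreover have "C L \<subseteq> X" by (auto simp: C_def)
  ultimately show "\<exists>C\<subseteq>X. \<forall>l<L. \<exists>!p. p \<in> C \<and> p ! l" by blast
next
  assume "\<exists>C\<subseteq>X. \<forall>l<L. \<exists>!p. p \<in> C \<and> p ! l"
  then obtain C where C: "C \<subseteq> X" "\<And>l. l < L \<Longrightarrow> \<exists>!p. p \<in> C \<and> p ! l" by blast
  \<comment> \<open>Select at every level the diamond of the unique member of \<open>C\<close>
    there. The other members have boxes at that level, so no member of \<open>C\<close> is lost in
    either pass.\<close>
  have "\<exists>Y. (chain_step ^^ k) ((\<lambda>p. p @ p) ` X) Y \<and> (\<lambda>p. drop k (p @ p)) ` C \<subseteq> Y" if "k \<le> 2 * L" for k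
    using that
  proof (induction k)
    case 0
    then show ?case using C(1) by auto
  next
    case (Suc k)
    then obtain Y where Y: "(chain_step ^^ k) ((\<lambda>p. p @ p) ` X) Y" "(\<lambda>p. drop k (p @ p)) ` C \<subseteq> Y"
      by (meson Suc_leD)
    \<comment> \<open>The level of step \<open>k\<close>, be it in the first or in the second
      pass.\<close>
    define l where "l = (if k < L then k else k - L)"
    have l: "l < L" using Suc.prems by (auto simp: l_def)
    have drop: "drop k (p @ p) = p ! l # drop (Suc k) (p @ p)" if "p \<in> C" for p
    proof -
      have "length p = L" using that C(1) len by blast
      then have "(p @ p) ! k = p ! l" "k < length (p @ p)"
        using Suc.prems by (auto simp: nth_append l_def)
      then show ?thesis using Cons_nth_drop_Suc [of k "p @ p"] by (simp only:)
    qed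
    obtain p where p: "p \<in> C" "p ! l" "\<And>q. q \<in> C \<Longrightarrow> q ! l \<Longrightarrow> q = p" using C(2) [OF l] by blast
    define Y' where "Y' = insert (drop (Suc k) (p @ p)) {c. False # c \<in> Y}"
    have nxt: "q ! l # drop (Suc k) (q @ q) \<in> Y" if "q \<in> C" for q
      using Y(2) that unfolding drop [OF that, symmetric] by blast
    have "True # drop (Suc k) (p @ p) \<in> Y" using nxt [OF p(1)] p(2) by (simp only:)
    then have "chain_step Y Y'" unfolding chain_step_def Y'_def by blast
    with Y(1) have "(chain_step ^^ Suc k) ((\<lambda>p. p @ p) ` X) Y'" by (rule relpowp_Suc_I)
    moreover have "drop (Suc k) (q @ q) \<in> Y'" if "q \<in> C" for q
    proof (cases "q = p")
      case False
      then have "\<not> q ! l" using p(3) that by blast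
      then have "False # drop (Suc k) (q @ q) \<in> Y" using nxt [OF that] by (simp only:)
      then show ?thesis by (simp add: Y'_def)
    qed (simp add: Y'_def)
    ultimately show ?case by blast
  qed
  from this [of "2 * L"] show "\<exists>Y. (chain_step ^^ (2 * L)) ((\<lambda>p. p @ p) ` X) Y" by blast
qed

definition exact_cover :: "('i \<Rightarrow> 'e \<Rightarrow> bool) \<Rightarrow> 'e set \<Rightarrow> 'i set \<Rightarrow> bool" where
  "exact_cover \<theta> E C \<longleftrightarrow> (\<forall>e\<in>E. \<exists>!i. i \<in> C \<and> \<theta> i e)"

definition cover_fm :: "('i \<Rightarrow> 'e \<Rightarrow> bool) \<Rightarrow> 'e list \<Rightarrow> 'i list \<Rightarrow> fm \<Rightarrow> fm" where
  "cover_fm \<theta> es is F = chains_fm (map (\<lambda>i. map (\<theta> i) es @ map (\<theta> i) es) is) (2 * length es) F"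

text \<open>Indices with equal patterns yield the same chain, so covers by patterns and covers by
  indices have to be translated into each other; from patterns to indices, one index is picked for
  each pattern.\<close>

lemma satisfiable_cover_fm:
  assumes "\<And>M :: nat model. \<And>w. \<not> holds M w F"
  shows "satisfiable (cover_fm \<theta> es is F) \<longleftrightarrow> (\<nexists>C. C \<subseteq> set is \<and> exact_cover \<theta> (set es) C)"
proof -
  let ?p = "\<lambda>i. map (\<theta> i) es" and ?L = "length es"
  have 1: "(\<exists>C\<subseteq>?p ` set is. \<forall>l<?L. \<exists>!p. p \<in> C \<and> p ! l) \<longleftrightarrow> (\<exists>C\<subseteq>set is. exact_cover \<theta> (set es) C)"
  proof
    assume "\<exists>C\<subseteq>?p ` set is. \<forall>l<?L. \<exists>!p. p \<in> C \<and> p ! l"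
    then obtain C where C: "C \<subseteq> ?p ` set is" "\<forall>l<?L. \<exists>!p. p \<in> C \<and> p ! l" by blast
    define g where "g = inv_into (set is) ?p"
    have g: "g p \<in> set is" "?p (g p) = p" if "p \<in> C" for p
    proof -
      have "p \<in> ?p ` set is" using that C(1) by blast
      then show "g p \<in> set is" "?p (g p) = p"
        unfolding g_def by (rule inv_into_into, rule f_inv_into_f)
    qed
    have "\<exists>!i. i \<in> g ` C \<and> \<theta> i e" if "e \<in> set es" for e
    proof -
      obtain l where l: "l < ?L" "e = es ! l" using \<open>e \<in> set es\<close> unfolding in_set_conv_nth by blast
      have eq: "\<theta> (g p) e \<longleftrightarrow> p ! l" if "p \<in> C" for p
      proof -
        have "?p (g p) ! l = p ! l" by (simp only: g(2) [OF that])
        then show ?thesis using l by simp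
      qed
      have "\<exists>!p. p \<in> C \<and> p ! l" using C(2) l(1) by blast
      then obtain p where p: "p \<in> C" "p ! l" "\<forall>q. q \<in> C \<and> q ! l \<longrightarrow> q = p" by blast
      show ?thesis
      proof (rule ex1I)
        show "g p \<in> g ` C \<and> \<theta> (g p) e" using p(1,2) eq [OF p(1)] by blast
        fix i assume i: "i \<in> g ` C \<and> \<theta> i e"
        then obtain q where q: "q \<in> C" "i = g q" by blast
        with i have "q ! l" using eq [OF q(1)] by simp
        with p(3) q show "i = g p" by blast
      qed
    qed
    then have "exact_cover \<theta> (set es) (g ` C)" unfolding exact_cover_def by (rule ballI)
    moreover have "g ` C \<subseteq> set is" using g(1) by (rule image_subsetI)
    ultimately show "\<exists>C\<subseteq>set is. exact_cover \<theta> (set es) C" by (intro exI [of _ "g ` C"] conjI)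
  next
    assume "\<exists>C\<subseteq>set is. exact_cover \<theta> (set es) C"
    then obtain C where C: "C \<subseteq> set is" "exact_cover \<theta> (set es) C" by blast
    have "\<exists>!p. p \<in> ?p ` C \<and> p ! l" if "l < ?L" for l
    proof -
      have "\<exists>!i. i \<in> C \<and> \<theta> i (es ! l)" by (rule bspec [OF C(2) [unfolded exact_cover_def] nth_mem [OF that]])
      then obtain i where i: "i \<in> C" "\<theta> i (es ! l)" "\<forall>j. j \<in> C \<and> \<theta> j (es ! l) \<longrightarrow> j = i" by blast
      show ?thesis
      proof (rule ex1I)
        show "?p i \<in> ?p ` C \<and> ?p i ! l" using i(1,2) that by (intro conjI imageI) simp_all
        fix p assume p: "p \<in> ?p ` C \<and> p ! l"
        then obtain j where j: "j \<in> C" "p = ?p j" by blast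
        then have "\<theta> j (es ! l)" using p that by simp
        with i(3) j show "p = ?p i" by blast
      qed
    qed
    then have "\<forall>l<?L. \<exists>!p. p \<in> ?p ` C \<and> p ! l" by (intro allI impI)
    moreover have "?p ` C \<subseteq> ?p ` set is" using C(1) by (rule image_mono)
    ultimately show "\<exists>C\<subseteq>?p ` set is. \<forall>l<?L. \<exists>!p. p \<in> C \<and> p ! l"
      by (intro exI [of _ "?p ` C"] conjI)
  qed
  have "(\<exists>Y. (chain_step ^^ (2 * ?L)) ((\<lambda>p. p @ p) ` ?p ` set is) Y) \<longleftrightarrow>
    (\<exists>C\<subseteq>?p ` set is. \<forall>l<?L. \<exists>!p. p \<in> C \<and> p ! l)"
    by (rule chain_path_iff_exact_cover) auto
  moreover have "set (map (\<lambda>i. ?p i @ ?p i) is) = (\<lambda>p. p @ p) ` ?p ` set is"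
    by (simp add: image_image)
  moreover have "satisfiable (cover_fm \<theta> es is F) \<longleftrightarrow>
      (\<forall>Y. \<not> (chain_step ^^ (2 * ?L)) (set (map (\<lambda>i. ?p i @ ?p i) is)) Y)"
    unfolding cover_fm_def using assms by (rule satisfiable_chains_fm)
  ultimately show ?thesis using 1 by (simp only: not_ex [symmetric])
qed

section \<open>Wang tilings as exact covers\<close>

datatype ('h, 'v) tile = Tile (lf: 'h) (rt: 'h) (up: 'v) (dn: 'v)

text \<open>
  Cell \<open>s\<close> has the right neighbour \<open>s + 1\<close> and the lower neighbour \<open>s + W\<close>: the rows of a grid of
  width \<open>W\<close> are joined end to end.
\<close>

definition helix_tiling ::
  "('h, 'v) tile set \<Rightarrow> nat \<Rightarrow> nat \<Rightarrow> 'h \<Rightarrow> (nat \<Rightarrow> 'v) \<Rightarrow> 'v \<Rightarrow> (nat \<Rightarrow> ('h, 'v) tile) \<Rightarrow> bool" where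
  "helix_tiling \<Theta> W N bd ini fin \<tau> \<longleftrightarrow>
     (\<forall>s<N. \<tau> s \<in> \<Theta>) \<and>
     (\<forall>s<N. lf (\<tau> s) = (if s = 0 then bd else rt (\<tau> (s - 1)))) \<and> rt (\<tau> (N - 1)) = bd \<and>
     (\<forall>s<N. up (\<tau> s) = (if s < W then ini s else dn (\<tau> (s - W)))) \<and>
     (\<forall>s<N. N \<le> s + W \<longrightarrow> dn (\<tau> s) = fin)"

datatype ('h, 'v) slot = CellSlot | HSlot 'h | VSlot 'v

text \<open>
  The slots of block \<open>s\<close> are the cell \<open>s\<close> and the colours of its left and upper edge. A tile covers
  its own colour on its left and upper edge and all the other colours on its right and lower edge, so
  an edge is covered exactly once iff its two colours agree. The set \<open>None\<close> takes care of the
  boundary; the cells from \<open>N\<close> on form an additional row that only it can cover.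
\<close>

fun covers :: "nat \<Rightarrow> nat \<Rightarrow> 'h \<Rightarrow> (nat \<Rightarrow> 'v) \<Rightarrow> 'v \<Rightarrow> (nat \<times> ('h, 'v) tile) option
    \<Rightarrow> nat \<times> ('h, 'v) slot \<Rightarrow> bool" where
  "covers W N bd ini fin (Some (s, T)) (b, CellSlot) \<longleftrightarrow> b = s"
| "covers W N bd ini fin (Some (s, T)) (b, HSlot h) \<longleftrightarrow>
     (b = s \<and> h = lf T) \<or> (b = s + 1 \<and> h \<noteq> rt T)"
| "covers W N bd ini fin (Some (s, T)) (b, VSlot v) \<longleftrightarrow>
     (b = s \<and> v = up T) \<or> (b = s + W \<and> v \<noteq> dn T)"
| "covers W N bd ini fin None (b, CellSlot) \<longleftrightarrow> N \<le> b"
| "covers W N bd ini fin None (b, HSlot h) \<longleftrightarrow>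
     (b = 0 \<and> h \<noteq> bd) \<or> (b = N \<and> h = bd) \<or> N < b"
| "covers W N bd ini fin None (b, VSlot v) \<longleftrightarrow> (b < W \<and> v \<noteq> ini b) \<or> (N \<le> b \<and> v = fin)"

definition slots :: "'h set \<Rightarrow> 'v set \<Rightarrow> ('h, 'v) slot set" where
  "slots H V = insert CellSlot (HSlot ` H \<union> VSlot ` V)"

text \<open>The index that covers a slot in the cover obtained from a tiling. On an edge, the tile
  to the right or below owns the common colour and its predecessor the other colours; what is left
  at the boundary goes to \<open>None\<close>.\<close>

fun owner :: "nat \<Rightarrow> nat \<Rightarrow> 'h \<Rightarrow> (nat \<Rightarrow> 'v) \<Rightarrow> 'v \<Rightarrow> (nat \<Rightarrow> ('h, 'v) tile)
    \<Rightarrow> nat \<times> ('h, 'v) slot \<Rightarrow> nat option" where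
  "owner W N bd ini fin \<tau> (b, CellSlot) = (if b < N then Some b else None)"
| "owner W N bd ini fin \<tau> (b, HSlot h) =
     (if b < N \<and> h = lf (\<tau> b) then Some b
      else if 0 < b \<and> b \<le> N \<and> h \<noteq> rt (\<tau> (b - 1)) then Some (b - 1) else None)"
| "owner W N bd ini fin \<tau> (b, VSlot v) =
     (if b < N \<and> v = up (\<tau> b) then Some b
      else if W \<le> b \<and> v \<noteq> dn (\<tau> (b - W)) then Some (b - W) else None)"

lemma covers_owner:
  assumes \<tau>: "helix_tiling \<Theta> W N bd ini fin \<tau>" and W: "0 < W" "W \<le> N" and e: "fst e < N + W"
  shows "covers W N bd ini fin None e \<longleftrightarrow> owner W N bd ini fin \<tau> e = None"
    and "s < N \<Longrightarrow> covers W N bd ini fin (Some (s, \<tau> s)) e \<longleftrightarrow> owner W N bd ini fin \<tau> e = Some s"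
    and "owner W N bd ini fin \<tau> e = Some s \<Longrightarrow> s < N"
proof -
  have lf: "lf (\<tau> s) = (if s = 0 then bd else rt (\<tau> (s - 1)))" if "s < N" for s
    using \<tau> that by (simp add: helix_tiling_def)
  have rt: "rt (\<tau> (N - 1)) = bd" using \<tau> by (simp add: helix_tiling_def)
  have up: "up (\<tau> s) = (if s < W then ini s else dn (\<tau> (s - W)))" if "s < N" for s
    using \<tau> that by (simp add: helix_tiling_def)
  have dn: "dn (\<tau> s) = fin" if "s < N" "N \<le> s + W" for s
    using \<tau> that by (simp add: helix_tiling_def)
  obtain b sl where e_eq: "e = (b, sl)" by (cases e)
  have b: "b < N + W" using e by (simp add: e_eq)
  show "covers W N bd ini fin None e \<longleftrightarrow> owner W N bd ini fin \<tau> e = None"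
  proof (cases sl)
    case CellSlot
    then show ?thesis by (auto simp: e_eq)
  next
    case (HSlot h)
    consider "b = 0" | "0 < b" "b < N" | "b = N" | "N < b" by linarith
    then show ?thesis using HSlot W lf [of b] rt by cases (auto simp: e_eq)
  next
    case (VSlot v)
    consider "b < W" | "W \<le> b" "b < N" | "N \<le> b" by linarith
    then show ?thesis using VSlot W b up [of b] dn [of "b - W"] by cases (auto simp: e_eq)
  qed
  show "covers W N bd ini fin (Some (s, \<tau> s)) e \<longleftrightarrow> owner W N bd ini fin \<tau> e = Some s" if "s < N"
  proof (cases sl)
    case CellSlot
    then show ?thesis using that by (auto simp: e_eq)
  next
    case (HSlot h)
    consider "b = s" | "b = s + 1" | "b \<noteq> s" "b \<noteq> s + 1" by blast
    then show ?thesis using HSlot that lf [of b] by cases (auto simp: e_eq)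
  next
    case (VSlot v)
    consider "b = s" | "b = s + W" | "b \<noteq> s" "b \<noteq> s + W" by blast
    then show ?thesis using VSlot that W up [of b] by cases (auto simp: e_eq)
  qed
  show "s < N" if "owner W N bd ini fin \<tau> e = Some s"
    using that W b by (cases sl) (auto simp: e_eq split: if_splits)
qed

text \<open>If the two colours of an edge differ, then the colour of the right or lower tile is
  covered twice: as its own colour, and in the complement taken by its neighbour. Conversely a
  tiling gives every slot exactly one owner.\<close>

lemma exact_cover_iff_helix_tiling:
  fixes \<Theta> :: "('h, 'v) tile set"
  assumes W: "0 < W" "W \<le> N"
    and H: "\<And>T. T \<in> \<Theta> \<Longrightarrow> lf T \<in> H \<and> rt T \<in> H" and V: "\<And>T. T \<in> \<Theta> \<Longrightarrow> up T \<in> V \<and> dn T \<in> V"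
  shows "(\<exists>C\<subseteq>insert None (Some ` ({..<N} \<times> \<Theta>)).
      exact_cover (covers W N bd ini fin) ({..<N + W} \<times> slots H V) C) \<longleftrightarrow>
    (\<exists>\<tau>. helix_tiling \<Theta> W N bd ini fin \<tau>)"
proof
  let ?c = "covers W N bd ini fin"
  assume "\<exists>C\<subseteq>insert None (Some ` ({..<N} \<times> \<Theta>)). exact_cover ?c ({..<N + W} \<times> slots H V) C"
  then obtain C where C: "C \<subseteq> insert None (Some ` ({..<N} \<times> \<Theta>))"
    and cover: "exact_cover ?c ({..<N + W} \<times> slots H V) C" by blast
  have ex: "\<exists>i\<in>C. ?c i (b, sl)" and uniq: "\<And>i j. i \<in> C \<Longrightarrow> j \<in> C \<Longrightarrow> ?c i (b, sl) \<Longrightarrow> ?c j (b, sl) \<Longrightarrow> i = j"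
    if "b < N + W" "sl \<in> slots H V" for b sl
  proof -
    have "(b, sl) \<in> {..<N + W} \<times> slots H V" using that by simp
    then have "\<exists>!i. i \<in> C \<and> ?c i (b, sl)" by (rule bspec [OF cover [unfolded exact_cover_def]])
    then show "\<exists>i\<in>C. ?c i (b, sl)" "\<And>i j. i \<in> C \<Longrightarrow> j \<in> C \<Longrightarrow> ?c i (b, sl) \<Longrightarrow> ?c j (b, sl) \<Longrightarrow> i = j"
      by blast+
  qed
  have mem: "s < N \<and> T \<in> \<Theta>" if "Some (s, T) \<in> C" for s T using C that by blast
  have cell: "CellSlot \<in> slots H V" by (simp add: slots_def)
  \<comment> \<open>A tile covers only the cell slot of its own cell, so the cell slot of block
    \<open>N\<close> is left to \<open>None\<close>.\<close>
  have None: "None \<in> C"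
  proof -
    obtain i where i: "i \<in> C" "?c i (N, CellSlot)" using ex [OF _ cell, of N] W by auto
    show ?thesis
    proof (cases i)
      case (Some p)
      then show ?thesis using i mem [of "fst p" "snd p"] by (cases p) auto
    qed (use i in simp)
  qed
  have "\<exists>T. Some (s, T) \<in> C" if s: "s < N" for s
  proof -
    obtain i where i: "i \<in> C" "?c i (s, CellSlot)" using ex [OF _ cell, of s] s by auto
    show ?thesis
    proof (cases i)
      case None
      then show ?thesis using i s by simp
    next
      case (Some p)
      then show ?thesis using i by (cases p) auto
    qed
  qed
  then obtain \<tau> where \<tau>: "\<And>s. s < N \<Longrightarrow> Some (s, \<tau> s) \<in> C" by metis
  have \<tau>_eq: "T = \<tau> s" if "Some (s, T) \<in> C" for s T
    using uniq [OF _ cell that \<tau>, of s] mem [OF that] by simp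
  have \<Theta>: "\<tau> s \<in> \<Theta>" if "s < N" for s using mem [OF \<tau> [OF that]] by simp
  have Hs: "HSlot (lf (\<tau> s)) \<in> slots H V" "HSlot (rt (\<tau> s)) \<in> slots H V"
    "VSlot (up (\<tau> s)) \<in> slots H V" "VSlot (dn (\<tau> s)) \<in> slots H V" if "s < N" for s
    using H [OF \<Theta> [OF that]] V [OF \<Theta> [OF that]] by (auto simp: slots_def)
  have "lf (\<tau> s) = (if s = 0 then bd else rt (\<tau> (s - 1)))" if s: "s < N" for s
  proof (rule ccontr)
    assume ne: "lf (\<tau> s) \<noteq> (if s = 0 then bd else rt (\<tau> (s - 1)))"
    have 1: "?c (Some (s, \<tau> s)) (s, HSlot (lf (\<tau> s)))" by simp
    show False
    proof (cases "s = 0")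
      case True
      then have 2: "?c None (s, HSlot (lf (\<tau> s)))" using ne by simp
      have "s < N + W" using s by simp
      from uniq [OF this Hs(1) [OF s] \<tau> [OF s] None 1 2] show False by simp
    next
      case False
      then have 2: "?c (Some (s - 1, \<tau> (s - 1))) (s, HSlot (lf (\<tau> s)))" using ne by simp
      have sd: "s - 1 < N" and "s < N + W" using s by simp_all
      from uniq [OF this(2) Hs(1) [OF s] \<tau> [OF s] \<tau> [OF sd] 1 2]
      have "Some (s, \<tau> s) = Some (s - 1, \<tau> (s - 1))" .
      then have "s = s - 1" by simp
      then show False using False by linarith
    qed
  qed
  \<comment> \<open>At block \<open>N\<close> the last tile covers every colour except
    \<open>rt (\<tau> (N - 1))\<close>, and no other tile reaches this block horizontally. So
    \<open>None\<close> covers that colour, and there it takes only \<open>bd\<close>.\<close>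
  moreover have "rt (\<tau> (N - 1)) = bd"
  proof -
    have N: "N - 1 < N" using W by simp
    obtain i where i: "i \<in> C" "?c i (N, HSlot (rt (\<tau> (N - 1))))"
      using ex [OF _ Hs(2) [OF N], of N] W by auto
    show ?thesis
    proof (cases i)
      case (Some p)
      obtain s T where p: "p = (s, T)" by (cases p)
      then have "s < N" "T = \<tau> s" using mem \<tau>_eq i(1) Some by auto
      then show ?thesis using i(2) Some p by auto
    qed (use i W in auto)
  qed
  moreover have "up (\<tau> s) = (if s < W then ini s else dn (\<tau> (s - W)))" if s: "s < N" for s
  proof (rule ccontr)
    assume ne: "up (\<tau> s) \<noteq> (if s < W then ini s else dn (\<tau> (s - W)))"
    have 1: "?c (Some (s, \<tau> s)) (s, VSlot (up (\<tau> s)))" by simp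
    show False
    proof (cases "s < W")
      case True
      then have 2: "?c None (s, VSlot (up (\<tau> s)))" using ne by simp
      have "s < N + W" using s by simp
      from uniq [OF this Hs(3) [OF s] \<tau> [OF s] None 1 2] show False by simp
    next
      case False
      then have 2: "?c (Some (s - W, \<tau> (s - W))) (s, VSlot (up (\<tau> s)))" using ne by simp
      have sd: "s - W < N" and "s < N + W" using s by simp_all
      from uniq [OF this(2) Hs(3) [OF s] \<tau> [OF s] \<tau> [OF sd] 1 2]
      have "Some (s, \<tau> s) = Some (s - W, \<tau> (s - W))" .
      then have "s = s - W" by simp
      then show False using False W by linarith
    qed
  qed
  moreover have "dn (\<tau> s) = fin" if s: "s < N" "N \<le> s + W" for s
  proof -
    obtain i where i: "i \<in> C" "?c i (s + W, VSlot (dn (\<tau> s)))"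
      using ex [OF _ Hs(4) [OF s(1)], of "s + W"] s by auto
    show ?thesis
    proof (cases i)
      case (Some p)
      obtain t T where p: "p = (t, T)" by (cases p)
      then have "t < N" "T = \<tau> t" using mem \<tau>_eq i(1) Some by auto
      then show ?thesis using i(2) Some p s by auto
    qed (use i s in auto)
  qed
  ultimately have "helix_tiling \<Theta> W N bd ini fin \<tau>"
    using \<Theta> by (simp add: helix_tiling_def)
  then show "\<exists>\<tau>. helix_tiling \<Theta> W N bd ini fin \<tau>" by blast
next
  let ?c = "covers W N bd ini fin"
  assume "\<exists>\<tau>. helix_tiling \<Theta> W N bd ini fin \<tau>"
  then obtain \<tau> where \<tau>: "helix_tiling \<Theta> W N bd ini fin \<tau>" by blast
  define C where "C = insert None ((\<lambda>s. Some (s, \<tau> s)) ` {..<N})"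
  have "\<exists>!i. i \<in> C \<and> ?c i e" if "e \<in> {..<N + W} \<times> slots H V" for e
  proof -
    have e: "fst e < N + W" using that by auto
    note * = covers_owner [OF \<tau> W e]
    show ?thesis
    proof (cases "owner W N bd ini fin \<tau> e")
      case None
      show ?thesis
      proof (rule ex1I)
        show "None \<in> C \<and> ?c None e" using None *(1) by (simp add: C_def)
        show "i = None" if "i \<in> C \<and> ?c i e" for i
          using that None *(2) by (auto simp: C_def)
      qed
    next
      case (Some s)
      then have s: "s < N" by (rule *(3))
      show ?thesis
      proof (rule ex1I)
        show "Some (s, \<tau> s) \<in> C \<and> ?c (Some (s, \<tau> s)) e" using Some s *(2) [OF s] by (simp add: C_def)
        show "i = Some (s, \<tau> s)" if "i \<in> C \<and> ?c i e" for i
          using that Some *(1,2) by (auto simp: C_def)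
      qed
    qed
  qed
  then have "exact_cover ?c ({..<N + W} \<times> slots H V) C" unfolding exact_cover_def by (rule ballI)
  moreover have "C \<subseteq> insert None (Some ` ({..<N} \<times> \<Theta>))"
    using \<tau> by (auto simp: C_def helix_tiling_def)
  ultimately show "\<exists>C\<subseteq>insert None (Some ` ({..<N} \<times> \<Theta>)). exact_cover ?c ({..<N + W} \<times> slots H V) C"
    by (intro exI [of _ C] conjI)
qed

section \<open>Helical tilings and tilings of a rectangle\<close>

definition grid_tiling ::
  "('h, 'v) tile set \<Rightarrow> nat \<Rightarrow> nat \<Rightarrow> (nat \<Rightarrow> 'v) \<Rightarrow> 'v \<Rightarrow> (nat \<Rightarrow> nat \<Rightarrow> ('h, 'v) tile) \<Rightarrow> bool" where
  "grid_tiling \<Theta> W R ini fin T \<longleftrightarrow>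
     (\<forall>r<R. \<forall>c<W. T r c \<in> \<Theta>) \<and>
     (\<forall>r<R. \<forall>c. c + 1 < W \<longrightarrow> rt (T r c) = lf (T r (c + 1))) \<and>
     (\<forall>r<R. \<forall>c<W. up (T r c) = (if r = 0 then ini c else dn (T (r - 1) c))) \<and>
     (\<forall>c<W. dn (T (R - 1) c) = fin)"

text \<open>Of the horizontal edges only those inside a row are kept; the seam between the end of a
  row and the start of the next one is forgotten.\<close>

lemma grid_of_helix_tiling:
  assumes \<tau>: "helix_tiling \<Theta> W (R * W) bd ini fin \<tau>" and "0 < R"
  shows "grid_tiling \<Theta> W R ini fin (\<lambda>r c. \<tau> (r * W + c))"
proof -
  have lt: "r * W + c < R * W" if "r < R" "c < W" for r c
  proof -
    have "Suc r * W \<le> R * W" using that(1) by (intro mult_le_mono1) simp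
    then show ?thesis using that(2) by simp
  qed
  have "rt (\<tau> (r * W + c)) = lf (\<tau> (r * W + (c + 1)))" if "r < R" "c + 1 < W" for r c
    using \<tau> lt [OF that] unfolding helix_tiling_def by simp
  moreover have "up (\<tau> (r * W + c)) = (if r = 0 then ini c else dn (\<tau> ((r - 1) * W + c)))"
    if "r < R" "c < W" for r c
    using \<tau> lt [OF that] that unfolding helix_tiling_def by (cases r) auto
  moreover have "dn (\<tau> ((R - 1) * W + c)) = fin" if "c < W" for c
    using \<tau> lt [of "R - 1" c] \<open>0 < R\<close> that unfolding helix_tiling_def by (cases R) auto
  ultimately show ?thesis
    using \<tau> lt unfolding grid_tiling_def helix_tiling_def by simp
qed

lemma div_mod_row:
  fixes d W :: nat
  assumes "d < W"
  shows "(p * W + d) div W = p" "(p * W + d) mod W = d"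
  using assms by auto

text \<open>The seams match because every row begins and ends with the same colour
  \<open>bd\<close>.\<close>

lemma helix_of_grid_tiling:
  assumes T: "grid_tiling \<Theta> W R ini fin T" and "0 < R" "1 < W"
    and bd: "\<And>r. r < R \<Longrightarrow> lf (T r 0) = bd \<and> rt (T r (W - 1)) = bd"
  shows "helix_tiling \<Theta> W (R * W) bd ini fin (\<lambda>s. T (s div W) (s mod W))"
proof -
  have r: "s div W < R" if "s < R * W" for s using that by (simp add: less_mult_imp_div_less)
  have c: "s mod W < W" for s using \<open>1 < W\<close> by simp
  have "lf (T (s div W) (s mod W)) = (if s = 0 then bd else rt (T ((s - 1) div W) ((s - 1) mod W)))"
    if s: "s < R * W" for s
  proof (cases "s mod W = 0")
    case True
    then have "s = s div W * W" using div_mult_mod_eq [of s W] by simp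
    then obtain q where q: "s = q * W" by blast
    show ?thesis
    proof (cases q)
      case 0
      then show ?thesis using q bd [of 0] \<open>0 < R\<close> by simp
    next
      case (Suc p)
      have "s - 1 = p * W + (W - 1)" using q Suc \<open>1 < W\<close> by simp
      moreover have "(p * W + (W - 1)) div W = p" "(p * W + (W - 1)) mod W = W - 1"
        using \<open>1 < W\<close> by (intro div_mod_row; simp)+
      ultimately show ?thesis using q Suc bd [of p] bd [of q] r [OF s] \<open>1 < W\<close> by simp
    qed
  next
    case False
    define q d where "q = s div W" and "d = s mod W"
    have s_eq: "s = q * W + d" "0 < d" "d < W" using False c by (auto simp: q_def d_def)
    then have "s - 1 = q * W + (d - 1)" by simp
    then have "(s - 1) div W = q" "(s - 1) mod W = d - 1"
      using s_eq(3) div_mod_row [of "d - 1" W q] by simp_all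
    moreover have "rt (T q (d - 1)) = lf (T q d)"
    proof -
      have "rt (T q (d - 1)) = lf (T q (d - 1 + 1))"
        using T r [OF s] s_eq unfolding grid_tiling_def q_def [symmetric] by simp
      then show ?thesis using s_eq by simp
    qed
    moreover have "s \<noteq> 0" using s_eq(1,2) by simp
    ultimately show ?thesis unfolding q_def [symmetric] d_def [symmetric] by simp
  qed
  moreover have "rt (T ((R * W - 1) div W) ((R * W - 1) mod W)) = bd"
  proof -
    obtain p where p: "R = Suc p" using \<open>0 < R\<close> by (cases R) auto
    have "R * W - 1 = p * W + (W - 1)" using p \<open>1 < W\<close> by simp
    moreover have "(p * W + (W - 1)) div W = p" "(p * W + (W - 1)) mod W = W - 1"
      using \<open>1 < W\<close> by (intro div_mod_row; simp)+
    ultimately show ?thesis using bd [of p] p by simp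
  qed
  moreover have "up (T (s div W) (s mod W)) =
      (if s < W then ini s else dn (T ((s - W) div W) ((s - W) mod W)))" if s: "s < R * W" for s
  proof -
    have "up (T (s div W) (s mod W)) =
        (if s div W = 0 then ini (s mod W) else dn (T (s div W - 1) (s mod W)))"
      using T r [OF s] c unfolding grid_tiling_def by simp
    moreover have "s div W = 0 \<longleftrightarrow> s < W" using \<open>1 < W\<close> by (auto simp: div_eq_0_iff)
    moreover have "(s - W) div W = s div W - 1" "(s - W) mod W = s mod W" if "\<not> s < W"
      using that \<open>1 < W\<close> by (simp_all add: le_div_geq le_mod_geq)
    ultimately show ?thesis by simp
  qed
  moreover have "dn (T (s div W) (s mod W)) = fin" if s: "s < R * W" "R * W \<le> s + W" for s
  proof -
    obtain p where p: "R = Suc p" using \<open>0 < R\<close> by (cases R) auto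
    then have "p * W \<le> s" using s by simp
    then have "p \<le> s div W" using \<open>1 < W\<close> by (simp add: less_eq_div_iff_mult_less_eq)
    with r [OF s(1)] p have "s div W = R - 1" by simp
    then show ?thesis using T c unfolding grid_tiling_def by simp
  qed
  ultimately show ?thesis
    using T r c unfolding helix_tiling_def grid_tiling_def by simp
qed

section \<open>Computation tables as tilings\<close>

text \<open>The columns at both ends of the strip and at the origin obey special rules. The mark is
  part of the vertical colours, which pass it down the column.\<close>

datatype mark = First | Orig | Last | Mid

datatype hcol = Border | Flag bool | Row nat "nat list" "dir list" | RowFin

datatype vcol = Ini mark nat bool | Cell mark nat "(nat \<times> bool) list" | Fin

text \<open>Outer edges carry \<open>Border\<close> in every row, although different rows carry
  different states. This makes the seams of the helix match.\<close>

definition left_col :: "mark \<Rightarrow> hcol \<Rightarrow> hcol" where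
  "left_col m h = (if m = First then Border else h)"

definition right_col :: "mark \<Rightarrow> hcol \<Rightarrow> hcol" where
  "right_col m h = (if m = Last then Border else h)"

text \<open>As with \<open>step\<close>, a halted configuration repeats itself, so every run fills a
  fixed number of rows.\<close>

definition next_actions :: "tm \<Rightarrow> nat \<Rightarrow> nat list \<Rightarrow> nat \<times> (nat \<times> dir) list" where
  "next_actions M q ss = (if q = halt M then (q, keep ss) else trans M q ss)"

text \<open>
  Row 0 turns the initial colours into the starting configuration, guessing the certificate on tape 1;
  the flag says that the guessed word has not ended yet. In the other rows the horizontal colours carry
  the state, all the scanned symbols and the movements of the heads across the edge.
\<close>

inductive tm_tile :: "tm \<Rightarrow> (hcol, vcol) tile \<Rightarrow> bool" for M where
  init: "tm_tile M (Tile (left_col m (Flag f)) (right_col m (Flag f')) (Ini m a g)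
      (Cell m 0 (map (\<lambda>j. (if j = 0 then a else if j = 1 then b else 0, m = Orig)) [0..<ntapes M])))"
    if "a < 3" "b < 3" "if g then (if b = 0 then \<not> f' else f \<and> f') else b = 0 \<and> f' = f"
| step: "tm_tile M (Tile (left_col m (Row q ss lc)) (right_col m (Row q ss rc)) (Cell m q cs) (Cell m q' cs'))"
    if "q \<le> halt M" "length ss = ntapes M" "set ss \<subseteq> {..<nsyms M}"
      "length lc = ntapes M" "length rc = ntapes M" "length cs = ntapes M" "length cs' = ntapes M"
      "fst ` set cs \<subseteq> {..<nsyms M}"
      "next_actions M q ss = (q', as)"
      "\<forall>j<ntapes M.
         (snd (cs ! j) \<longrightarrow> fst (cs ! j) = ss ! j) \<and>
         (lc ! j = Lft \<longleftrightarrow> snd (cs ! j) \<and> snd (as ! j) = Lft) \<and>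
         (rc ! j = Rgt \<longleftrightarrow> snd (cs ! j) \<and> snd (as ! j) = Rgt) \<and>
         cs' ! j = (if snd (cs ! j) then fst (as ! j) else fst (cs ! j),
           snd (cs ! j) \<and> snd (as ! j) = Stay \<or> lc ! j = Rgt \<or> rc ! j = Lft) \<and>
         (m = First \<longrightarrow> lc ! j = Stay) \<and> (m = Last \<longrightarrow> rc ! j = Stay)"
| final: "tm_tile M (Tile (left_col m RowFin) (right_col m RowFin) (Cell m (halt M) cs) Fin)"
    if "length cs = ntapes M" "fst ` set cs \<subseteq> {..<nsyms M}" "m = Orig \<longrightarrow> fst (last cs) = 2"

lemma dir_UNIV: "(UNIV :: dir set) = {Lft, Stay, Rgt}"
  using dir.exhaust by auto

lemma mark_UNIV: "(UNIV :: mark set) = {First, Orig, Last, Mid}"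
  using mark.exhaust by auto

lemma fst_set_subsetI: "(\<And>j. j < length cs \<Longrightarrow> fst (cs ! j) < n) \<Longrightarrow> fst ` set cs \<subseteq> {..<n}"
  by (auto simp: in_set_conv_nth) (metis fst_conv)

lemma next_actions_valid:
  assumes M: "turing_machine M" and "q \<le> halt M" "length ss = ntapes M" "set ss \<subseteq> {..<nsyms M}"
    and "next_actions M q ss = (q', as)"
  shows "q' \<le> halt M \<and> length as = ntapes M \<and> fst ` set as \<subseteq> {..<nsyms M}"
proof (cases "q = halt M")
  case True
  then have "q' = q" "as = keep ss" using assms(5) by (simp_all add: next_actions_def)
  moreover have "fst ` set (keep ss) = set ss" by (simp add: keep_def image_image)
  ultimately show ?thesis using assms by (simp add: keep_def)
next
  case False
  then have q: "q < halt M" using assms(2) by simp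
  have "case trans M q ss of (q', as) \<Rightarrow>
      q' \<le> halt M \<and> length as = ntapes M \<and> fst ` set as \<subseteq> {..<nsyms M}"
  proof -
    have "\<forall>q<halt M. \<forall>ss. length ss = ntapes M \<and> set ss \<subseteq> {..<nsyms M} \<longrightarrow>
        (case trans M q ss of (q', as) \<Rightarrow>
           q' \<le> halt M \<and> length as = ntapes M \<and> fst ` set as \<subseteq> {..<nsyms M})"
      using M unfolding turing_machine_def by (elim conjE)
    from this [THEN spec, THEN mp, OF q, THEN spec, THEN mp, OF conjI [OF assms(3,4)]]
    show ?thesis .
  qed
  then show ?thesis using False assms(5) by (simp add: next_actions_def)
qed

text \<open>The colours are bounded in terms of the machine alone, not of its input. Thus the tiles
  can be listed once and for all inside the program of the reduction.\<close>

lemma finite_hcol_vcol: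
  assumes M: "turing_machine M"
  obtains H V where "finite H" "finite V"
    "\<And>T. tm_tile M T \<Longrightarrow> lf T \<in> H \<and> rt T \<in> H \<and> up T \<in> V \<and> dn T \<in> V"
proof -
  let ?k = "ntapes M" and ?n = "nsyms M"
  define S where "S = {ss. set ss \<subseteq> {..<?n} \<and> length ss = ?k}"
  define D where "D = {ds :: dir list. set ds \<subseteq> UNIV \<and> length ds = ?k}"
  define K where "K = {cs :: (nat \<times> bool) list. set cs \<subseteq> {..<?n} \<times> UNIV \<and> length cs = ?k}"
  define H where "H = {Border, RowFin} \<union> range Flag \<union> (\<lambda>(q, ss, ds). Row q ss ds) ` ({..halt M} \<times> S \<times> D)"
  define V where "V = insert Fin ((\<lambda>(m, a, g). Ini m a g) ` (UNIV \<times> {..<3} \<times> UNIV)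
    \<union> (\<lambda>(m, q, cs). Cell m q cs) ` (UNIV \<times> {..halt M} \<times> K))"
  have fm: "finite (UNIV :: mark set)" and fd: "finite (UNIV :: dir set)"
    by (simp_all add: mark_UNIV dir_UNIV)
  have "finite S" "finite D" "finite K"
    unfolding S_def D_def K_def using fd by (intro finite_lists_length_eq; simp)+
  then have "finite H" "finite V" unfolding H_def V_def using fm by simp_all
  moreover have "lf T \<in> H \<and> rt T \<in> H \<and> up T \<in> V \<and> dn T \<in> V" if "tm_tile M T" for T
  proof -
    have Hlr: "left_col m h \<in> H" "right_col m h \<in> H" if "h \<in> H" for m h
      using that by (auto simp: left_col_def right_col_def H_def)
    have RowH: "Row q ss ds \<in> H" if "q \<le> halt M" "ss \<in> S" "length ds = ?k" for q ss ds
    proof -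
      have "(q, ss, ds) \<in> {..halt M} \<times> S \<times> D" using that by (simp add: D_def)
      then show ?thesis unfolding H_def by (intro UnI2 image_eqI [of _ _ "(q, ss, ds)"]) simp_all
    qed
    have CellV: "Cell m q cs \<in> V" if "q \<le> halt M" "cs \<in> K" for m q cs
    proof -
      have "(m, q, cs) \<in> UNIV \<times> {..halt M} \<times> K" using that by simp
      then show ?thesis unfolding V_def by (intro insertI2 UnI2 image_eqI [of _ _ "(m, q, cs)"]) simp_all
    qed
    have KI: "cs \<in> K" if "length cs = ?k" "fst ` set cs \<subseteq> {..<?n}" for cs
      using that by (auto simp: K_def)
    have n3: "3 \<le> ?n" using M by (simp add: turing_machine_def)
    show ?thesis using that
    proof cases
      case (init a b g f' f m)
      have "fst ` set (map (\<lambda>j. (if j = 0 then a else if j = 1 then b else 0, m = Orig)) [0..<?k]) \<subseteq> {..<?n}"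
        using init n3 by auto
      then have "dn T \<in> V" unfolding init(1) tile.sel by (intro CellV KI) simp_all
      moreover have "Ini m a g \<in> V" using init(2) unfolding V_def
        by (intro insertI2 UnI1 image_eqI [of _ _ "(m, a, g)"]) simp_all
      moreover have "Flag f \<in> H" "Flag f' \<in> H" by (simp_all add: H_def)
      ultimately show ?thesis unfolding init(1) tile.sel using Hlr by blast
    next
      case (step q ss lc rc cs cs' q' as m)
      have ss: "ss \<in> S" using step by (simp add: S_def)
      have valid: "q' \<le> halt M" "length as = ?k" "fst ` set as \<subseteq> {..<?n}"
        using next_actions_valid [OF M step(2,3,4) step(10)] by auto
      have "fst (cs' ! j) < ?n" if j: "j < ?k" for j
      proof -
        have "fst (cs ! j) \<in> fst ` set cs" "fst (as ! j) \<in> fst ` set as"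
          using j step(7) valid(2) by auto
        then have "fst (cs ! j) < ?n" "fst (as ! j) < ?n" using step(9) valid(3) by blast+
        moreover have "fst (cs' ! j) = (if snd (cs ! j) then fst (as ! j) else fst (cs ! j))"
          using step(11) j by simp
        ultimately show ?thesis by simp
      qed
      then have "fst ` set cs' \<subseteq> {..<?n}" using step(8) by (intro fst_set_subsetI) simp
      then have "cs' \<in> K" "cs \<in> K" using step by (auto intro: KI)
      then show ?thesis unfolding step(1) tile.sel
        using Hlr RowH [OF step(2) ss] CellV step(2,5,6) valid(1) by simp
    next
      case (final cs m)
      have "RowFin \<in> H" "Fin \<in> V" by (simp_all add: H_def V_def)
      then show ?thesis unfolding final(1) tile.sel
        using Hlr CellV KI [OF final(2,3)] by simp
    qed
  qed
  ultimately show thesis by (rule that)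
qed

section \<open>Configurations near the origin\<close>

lemma step_next_actions:
  "next_actions M q (map scan ts) = (q', as) \<Longrightarrow> step M (q, ts) = (q', map2 act as ts)"
  by (auto simp: next_actions_def map2_act_keep split: if_splits)

text \<open>A head moves at most one cell per step, so after \<open>t\<close> steps it is within
  distance \<open>t\<close> of the origin; this determines the width of the strip.\<close>

definition valid_config :: "tm \<Rightarrow> nat \<Rightarrow> config \<Rightarrow> bool" where
  "valid_config M t c \<longleftrightarrow> fst c \<le> halt M \<and> length (snd c) = ntapes M \<and>
     (\<forall>j<ntapes M. \<bar>fst (snd c ! j)\<bar> \<le> int t \<and> (\<forall>z. snd (snd c ! j) z < nsyms M))"

lemma act_split: "act a t = (fst t + shift (snd a), (snd t)(fst t := fst a))"
  by (cases a; cases t) simp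

lemma scan_split: "scan t = snd t (fst t)"
  by (cases t) simp

lemma abs_shift: "\<bar>shift d\<bar> \<le> 1"
  by (cases d) auto

lemma valid_config_scans:
  assumes "valid_config M t (q, ts)"
  shows "length (map scan ts) = ntapes M" "set (map scan ts) \<subseteq> {..<nsyms M}"
proof -
  have len: "length ts = ntapes M" using assms by (simp add: valid_config_def)
  then show "length (map scan ts) = ntapes M" by simp
  have "scan (ts ! j) < nsyms M" if "j < ntapes M" for j
    using assms that by (simp add: valid_config_def scan_split)
  then show "set (map scan ts) \<subseteq> {..<nsyms M}" using len by (force simp: in_set_conv_nth)
qed

lemma valid_config_step:
  assumes M: "turing_machine M" and c: "valid_config M t c"
  shows "valid_config M (Suc t) (step M c)"
proof -
  obtain q ts where qts: "c = (q, ts)" by (cases c)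
  obtain q' as where na: "next_actions M q (map scan ts) = (q', as)" by force
  have v: "q' \<le> halt M" "length as = ntapes M" "fst ` set as \<subseteq> {..<nsyms M}"
  proof -
    have "q \<le> halt M" using c by (simp add: qts valid_config_def)
    from next_actions_valid [OF M this valid_config_scans [OF c [unfolded qts]] na]
    show "q' \<le> halt M" "length as = ntapes M" "fst ` set as \<subseteq> {..<nsyms M}" by simp_all
  qed
  have len: "length ts = ntapes M" using c by (simp add: qts valid_config_def)
  have "\<bar>fst (map2 act as ts ! j)\<bar> \<le> int (Suc t) \<and> (\<forall>z. snd (map2 act as ts ! j) z < nsyms M)"
    if j: "j < ntapes M" for j
  proof -
    have nth: "map2 act as ts ! j =
        (fst (ts ! j) + shift (snd (as ! j)), (snd (ts ! j))(fst (ts ! j) := fst (as ! j)))"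
      using j v(2) len by (simp add: act_split)
    have "\<bar>fst (ts ! j)\<bar> \<le> int t" "\<forall>z. snd (ts ! j) z < nsyms M"
      using c j by (auto simp: qts valid_config_def)
    moreover have "fst (as ! j) < nsyms M"
    proof -
      have "fst (as ! j) \<in> fst ` set as" using v(2) j by simp
      with v(3) show ?thesis by blast
    qed
    ultimately show ?thesis
      using abs_shift [of "snd (as ! j)"] unfolding nth by auto
  qed
  then show ?thesis
    using v(1,2) len unfolding qts step_next_actions [OF na] valid_config_def by simp
qed

lemma valid_config_start:
  assumes "turing_machine M"
  shows "valid_config M 0 (start M xs)"
proof -
  have "word_tape w z < nsyms M" for w z
    using assms by (auto simp: turing_machine_def word_tape_def bit_sym_def)
  then show ?thesis by (simp add: valid_config_def start_def)
qed

lemma valid_config_run: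
  assumes "turing_machine M"
  shows "valid_config M t ((step M ^^ t) (start M xs))"
  by (induction t) (simp_all add: valid_config_start valid_config_step assms)

definition cells :: "tape list \<Rightarrow> int \<Rightarrow> (nat \<times> bool) list" where
  "cells ts z = map (\<lambda>t. (snd t z, fst t = z)) ts"

context
  fixes M :: tm and P :: nat
begin

text \<open>The cells from \<open>-P\<close> to \<open>P\<close>, which contain all heads during the
  first \<open>P\<close> steps, and one guard column on each side.\<close>

definition width :: nat where "width = 2 * P + 3"

definition mark_of :: "nat \<Rightarrow> mark" where
  "mark_of c = (if c = 0 then First else if c = P + 1 then Orig else if c = 2 * P + 2 then Last else Mid)"

definition pos :: "nat \<Rightarrow> int" where "pos c = int c - int (P + 1)"

text \<open>The Boolean admits a guess: it marks the first \<open>g\<close> cells from the origin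
  on, so the certificate has at most \<open>g\<close> bits. The guess itself is left to the
  tile.\<close>

definition ini_col :: "word \<Rightarrow> nat \<Rightarrow> nat \<Rightarrow> vcol" where
  "ini_col x g c = Ini (mark_of c) (if P + 1 \<le> c \<and> c - (P + 1) < length x then bit_sym (x ! (c - (P + 1))) else 0)
     (P + 1 \<le> c \<and> c - (P + 1) < g)"

lemma mark_simps:
  "mark_of c = First \<longleftrightarrow> c = 0" "mark_of c = Orig \<longleftrightarrow> c = P + 1" "mark_of c = Last \<longleftrightarrow> c = 2 * P + 2"
  by (auto simp: mark_of_def)

lemma nat_pos: "nat (pos c) = c - (P + 1)" "0 \<le> pos c \<longleftrightarrow> P + 1 \<le> c"
  unfolding pos_def by (simp_all only: nat_minus_as_int) linarith

lemma init_row_sound: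
  assumes X: "\<And>c. c < width \<Longrightarrow> tm_tile M (X c) \<and> up (X c) = ini_col x g c"
    and adj: "\<And>c. c + 1 < width \<Longrightarrow> rt (X c) = lf (X (c + 1))"
    and k: "2 \<le> ntapes M" and g: "g \<le> P"
  shows "\<exists>u. length u \<le> g \<and> (\<forall>c<width. dn (X c) = Cell (mark_of c) 0 (cells (snd (start M [x, u])) (pos c)))"
proof -
  define R where "R c f f' b \<longleftrightarrow> b < 3 \<and> lf (X c) = left_col (mark_of c) (Flag f) \<and> rt (X c) = right_col (mark_of c) (Flag f') \<and>
      dn (X c) = Cell (mark_of c) 0 (map (\<lambda>j. (if j = 0 then word_tape x (pos c) else if j = 1 then b else 0,
        pos c = 0)) [0..<ntapes M]) \<and>
      (if P + 1 \<le> c \<and> c - (P + 1) < g then (if b = 0 then \<not> f' else f \<and> f') else b = 0 \<and> f' = f)" for c f f' b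
  have "\<exists>f f' b. R c f f' b"
    if c: "c < width" for c
  proof -
    have tm: "tm_tile M (X c)" and up: "up (X c) = ini_col x g c" using X [OF c] by auto
    have w: "word_tape x (pos c) =
        (if P + 1 \<le> c \<and> c - (P + 1) < length x then bit_sym (x ! (c - (P + 1))) else 0)"
      by (simp add: word_tape_def nat_pos del: One_nat_def)
    have p: "pos c = 0 \<longleftrightarrow> mark_of c = Orig" by (auto simp: mark_simps pos_def)
    from tm show ?thesis
    proof cases
      case (init a b g' f' f m)
      have m: "m = mark_of c" "a = word_tape x (pos c)" "g' \<longleftrightarrow> P + 1 \<le> c \<and> c - (P + 1) < g"
        using up unfolding init(1) ini_col_def w by simp_all
      show ?thesis
        by (rule exI [of _ f], rule exI [of _ f'], rule exI [of _ b])
          (use init(3,4) in \<open>simp add: R_def init(1) m p\<close>)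
    qed (use up in \<open>simp_all add: ini_col_def\<close>)
  qed
  then obtain f f' b where RR: "\<And>c. c < width \<Longrightarrow> R c (f c) (f' c) (b c)" by metis
  have b: "\<And>c. c < width \<Longrightarrow> b c < 3"
    and lf: "\<And>c. c < width \<Longrightarrow> lf (X c) = left_col (mark_of c) (Flag (f c))"
    and rt: "\<And>c. c < width \<Longrightarrow> rt (X c) = right_col (mark_of c) (Flag (f' c))"
    and dn: "\<And>c. c < width \<Longrightarrow> dn (X c) = Cell (mark_of c) 0 (map (\<lambda>j. (if j = 0 then word_tape x (pos c)
        else if j = 1 then b c else 0, pos c = 0)) [0..<ntapes M])"
    and guess: "\<And>c. c < width \<Longrightarrow> if P + 1 \<le> c \<and> c - (P + 1) < g
        then (if b c = 0 then \<not> f' c else f c \<and> f' c) else b c = 0 \<and> f' c = f c"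
    using RR unfolding R_def by blast+
  have ff: "f (c + 1) = f' c" if "c + 1 < width" for c
    using adj [OF that] lf [of "c + 1"] rt [of c] that
    by (simp add: left_col_def right_col_def mark_simps width_def)
  \<comment> \<open>The length of the certificate: the offset of the first blank guess, or
    \<open>g\<close> if there is none.\<close>
  define m where "m = (LEAST i. g \<le> i \<or> b (P + 1 + i) = 0)"
  have m: "g \<le> m \<or> b (P + 1 + m) = 0" unfolding m_def by (rule LeastI [of _ g]) simp
  have m_le: "m \<le> g" unfolding m_def by (rule Least_le) simp
  have less_m: "i < g \<and> b (P + 1 + i) \<noteq> 0" if "i < m" for i
    using not_less_Least [OF that [unfolded m_def]] by simp
  have closed: "\<not> f' (P + 1 + i)" if "m \<le> i" "i < g" for i
    using that
  proof (induction i rule: dec_induct)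
    case base
    then have "b (P + 1 + m) = 0" using m by simp
    then show ?case using guess [of "P + 1 + m"] base g by (simp add: width_def)
  next
    case (step i)
    then have "\<not> f (P + 1 + Suc i)" using ff [of "P + 1 + i"] g by (simp add: width_def)
    then show ?case using guess [of "P + 1 + Suc i"] step g by (simp add: width_def split: if_splits)
  qed
  have blank: "b (P + 1 + i) = 0" if "m \<le> i" "P + 1 + i < width" for i
  proof (cases "i < g")
    case True
    then show ?thesis using closed [OF that(1) True] guess [OF that(2)] by (simp split: if_splits)
  next
    case False
    then show ?thesis using guess [OF that(2)] by simp
  qed
  define u where "u = map (\<lambda>i. b (P + 1 + i) = 2) [0..<m]"
  have bu: "b c = word_tape u (pos c)" if c: "c < width" for c
  proof (cases "c < P + 1")
    case True
    then show ?thesis using guess [OF c] by (simp add: word_tape_def pos_def)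
  next
    case False
    then have "c = P + 1 + (c - (P + 1))" by simp
    then obtain i where i: "c = P + 1 + i" by blast
    then have "pos c = int i" by (simp add: pos_def)
    then have wu: "word_tape u (pos c) = (if i < m then bit_sym (b c = 2) else 0)"
      by (simp add: word_tape_def u_def i)
    show ?thesis
    proof (cases "i < m")
      case True
      have "b c \<noteq> 0" using less_m [OF True] i by simp
      then have "b c = 1 \<or> b c = 2" using b [OF c] by linarith
      then show ?thesis unfolding wu using True by (auto simp: bit_sym_def)
    next
      case False
      then show ?thesis unfolding wu using blank [of i] c i by simp
    qed
  qed
  have "dn (X c) = Cell (mark_of c) 0 (cells (snd (start M [x, u])) (pos c))" if c: "c < width" for c
  proof -
    have "cells (snd (start M [x, u])) (pos c) = map (\<lambda>j. (if j = 0 then word_tape x (pos c)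
        else if j = 1 then b c else 0, pos c = 0)) [0..<ntapes M]"
      by (rule nth_equalityI) (auto simp: cells_def start_def bu [OF c])
    then show ?thesis using dn [OF c] by simp
  qed
  moreover have "length u \<le> g" using m_le by (simp add: u_def)
  ultimately show ?thesis by blast
qed

lemma shift_cases:
  "h + shift d = z \<longleftrightarrow> (h = z \<and> d = Stay) \<or> (h = z - 1 \<and> d = Rgt) \<or> (h = z + 1 \<and> d = Lft)"
  by (cases d) auto

text \<open>The \<open>Row\<close> colours make all cells of a row agree on the state and on the
  scanned symbols. Each head is somewhere in the strip, and the tile at that place certifies its
  symbol, so the common list is the true one. Heads then pass to neighbouring cells through the
  movements recorded on the edges.\<close>

lemma step_row_sound:
  assumes X: "\<And>c. c < width \<Longrightarrow> tm_tile M (X c) \<and> up (X c) = Cell (mark_of c) q (cells ts (pos c)) \<and> dn (X c) \<noteq> Fin"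
    and adj: "\<And>c. c + 1 < width \<Longrightarrow> rt (X c) = lf (X (c + 1))"
    and valid: "valid_config M t (q, ts)" and t: "t \<le> P" and c: "c < width" and M: "turing_machine M"
  shows "dn (X c) = Cell (mark_of c) (fst (step M (q, ts))) (cells (snd (step M (q, ts))) (pos c))"
proof -
  let ?k = "ntapes M"
  define R where "R c ss lc rc q' as cs' \<longleftrightarrow> length ss = ?k \<and> length lc = ?k \<and> length rc = ?k \<and> length cs' = ?k \<and>
      lf (X c) = left_col (mark_of c) (Row q ss lc) \<and> rt (X c) = right_col (mark_of c) (Row q ss rc) \<and>
      dn (X c) = Cell (mark_of c) q' cs' \<and> next_actions M q ss = (q', as) \<and>
      (\<forall>j<?k.
         (snd (cells ts (pos c) ! j) \<longrightarrow> fst (cells ts (pos c) ! j) = ss ! j) \<and>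
         (lc ! j = Lft \<longleftrightarrow> snd (cells ts (pos c) ! j) \<and> snd (as ! j) = Lft) \<and>
         (rc ! j = Rgt \<longleftrightarrow> snd (cells ts (pos c) ! j) \<and> snd (as ! j) = Rgt) \<and>
         cs' ! j = (if snd (cells ts (pos c) ! j) then fst (as ! j) else fst (cells ts (pos c) ! j),
           snd (cells ts (pos c) ! j) \<and> snd (as ! j) = Stay \<or> lc ! j = Rgt \<or> rc ! j = Lft) \<and>
         (mark_of c = First \<longrightarrow> lc ! j = Stay) \<and> (mark_of c = Last \<longrightarrow> rc ! j = Stay))" for c ss lc rc q' as cs'
  have "\<exists>ss lc rc q' as cs'. R c ss lc rc q' as cs'"
    if c: "c < width" for c
  proof -
    have tm: "tm_tile M (X c)" and up: "up (X c) = Cell (mark_of c) q (cells ts (pos c))" and dn: "dn (X c) \<noteq> Fin"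
      using X [OF c] by auto
    from tm show ?thesis
    proof cases
      case (step q1 ss lc rc cs cs' q' as m)
      have m: "m = mark_of c" "q1 = q" "cs = cells ts (pos c)"
        using up unfolding step(1) by simp_all
      show ?thesis
        by (rule exI [of _ ss], rule exI [of _ lc], rule exI [of _ rc], rule exI [of _ q'],
            rule exI [of _ as], rule exI [of _ cs'])
          (use step(3,5,6,8,10,11) in \<open>simp only: R_def step(1) m tile.sel simp_thms\<close>)
    qed (use up dn in simp_all)
  qed
  then obtain ss lc rc q' as cs' where RR: "\<And>c. c < width \<Longrightarrow> R c (ss c) (lc c) (rc c) (q' c) (as c) (cs' c)"
    by metis
  have len: "\<And>c. c < width \<Longrightarrow> length (ss c) = ?k \<and> length (lc c) = ?k \<and> length (rc c) = ?k \<and> length (cs' c) = ?k"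
    and lf: "\<And>c. c < width \<Longrightarrow> lf (X c) = left_col (mark_of c) (Row q (ss c) (lc c))"
    and rt: "\<And>c. c < width \<Longrightarrow> rt (X c) = right_col (mark_of c) (Row q (ss c) (rc c))"
    and dn: "\<And>c. c < width \<Longrightarrow> dn (X c) = Cell (mark_of c) (q' c) (cs' c)"
    and na: "\<And>c. c < width \<Longrightarrow> next_actions M q (ss c) = (q' c, as c)"
    and loc: "\<And>c. c < width \<Longrightarrow> \<forall>j<?k.
         (snd (cells ts (pos c) ! j) \<longrightarrow> fst (cells ts (pos c) ! j) = ss c ! j) \<and>
         (lc c ! j = Lft \<longleftrightarrow> snd (cells ts (pos c) ! j) \<and> snd (as c ! j) = Lft) \<and>
         (rc c ! j = Rgt \<longleftrightarrow> snd (cells ts (pos c) ! j) \<and> snd (as c ! j) = Rgt) \<and>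
         cs' c ! j = (if snd (cells ts (pos c) ! j) then fst (as c ! j) else fst (cells ts (pos c) ! j),
           snd (cells ts (pos c) ! j) \<and> snd (as c ! j) = Stay \<or> lc c ! j = Rgt \<or> rc c ! j = Lft) \<and>
         (mark_of c = First \<longrightarrow> lc c ! j = Stay) \<and> (mark_of c = Last \<longrightarrow> rc c ! j = Stay)"
    using RR unfolding R_def by blast+
  have lts: "length ts = ?k" using valid by (simp add: valid_config_def)
  have cell: "cells ts z ! j = (snd (ts ! j) z, fst (ts ! j) = z)" if "j < ?k" for z j
    using that lts by (simp add: cells_def)
  have edge: "ss (c + 1) = ss c \<and> lc (c + 1) = rc c" if "c + 1 < width" for c
    using adj [OF that] lf [of "c + 1"] rt [of c] that
    by (simp add: left_col_def right_col_def mark_simps width_def)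
  have ss0: "ss c = ss 0" if "c < width" for c
    using that by (induction c) (use edge in \<open>simp_all\<close>)
  have scans: "ss c = map scan ts" if c: "c < width" for c
  proof (rule nth_equalityI)
    show "length (ss c) = length (map scan ts)" using len [OF c] lts by simp
    fix j assume "j < length (ss c)"
    then have j: "j < ?k" using len [OF c] by simp
    \<comment> \<open>The column in which head \<open>j\<close> stands; adding \<open>P + 1\<close>
      inverts \<open>pos\<close>.\<close>
    define d where "d = nat (fst (ts ! j) + int (P + 1))"
    have "\<bar>fst (ts ! j)\<bar> \<le> int t" using valid j by (simp add: valid_config_def)
    then have d: "d < width" "pos d = fst (ts ! j)" using t by (simp_all add: d_def width_def pos_def)
    have "snd (ts ! j) (fst (ts ! j)) = ss d ! j"
      using conjunct1 [OF loc [OF d(1), THEN spec, THEN mp, OF j]] unfolding cell [OF j] d(2) by simp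
    then show "ss c ! j = map scan ts ! j"
      using ss0 [OF c] ss0 [OF d(1)] j lts by (simp add: scan_split)
  qed
  obtain Q A where QA: "next_actions M q (map scan ts) = (Q, A)" by force
  have qa: "q' c = Q \<and> as c = A" if "c < width" for c
    using na [OF that] scans [OF that] QA by simp
  have lA: "length A = ?k"
    using next_actions_valid [OF M _ valid_config_scans [OF valid] QA] valid by (simp add: valid_config_def)
  have "cs' c = cells (map2 act A ts) (pos c)"
  proof (rule nth_equalityI)
    show "length (cs' c) = length (cells (map2 act A ts) (pos c))"
      using len [OF c] lts lA by (simp add: cells_def)
    fix j assume "j < length (cs' c)"
    then have j: "j < ?k" using len [OF c] by simp
    have 1: "cells (map2 act A ts) (pos c) ! j =
      (if fst (ts ! j) = pos c then fst (A ! j) else snd (ts ! j) (pos c), fst (ts ! j) + shift (snd (A ! j)) = pos c)"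
      using j lts lA by (auto simp: cells_def act_split)
    \<comment> \<open>A head enters from the left only if the column to the left sends it. In the
      first column the tile rule prescribes \<open>Stay\<close>, and no head is that far
      out.\<close>
    have lc: "lc c ! j = Rgt \<longleftrightarrow> fst (ts ! j) = pos c - 1 \<and> snd (A ! j) = Rgt"
    proof (cases c)
      case 0
      have "\<bar>fst (ts ! j)\<bar> \<le> int t" using valid j by (simp add: valid_config_def)
      then have "fst (ts ! j) \<noteq> pos c - 1" using t 0 by (simp add: pos_def)
      moreover have "lc c ! j = Stay" using loc [OF c] j 0 by (simp add: mark_simps)
      ultimately show ?thesis by simp
    next
      case (Suc d)
      then have d: "d + 1 < width" "d < width" using c by simp_all
      have "lc c ! j = rc d ! j" using edge [OF d(1)] Suc by simp
      moreover have "pos c - 1 = pos d" using Suc by (simp add: pos_def)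
      moreover have "rc d ! j = Rgt \<longleftrightarrow> fst (ts ! j) = pos d \<and> snd (A ! j) = Rgt"
        using loc [OF d(2)] j cell [OF j] qa [OF d(2)] by simp
      ultimately show ?thesis by simp
    qed
    have rc: "rc c ! j = Lft \<longleftrightarrow> fst (ts ! j) = pos c + 1 \<and> snd (A ! j) = Lft"
    proof (cases "c = 2 * P + 2")
      case True
      have "\<bar>fst (ts ! j)\<bar> \<le> int t" using valid j by (simp add: valid_config_def)
      then have "fst (ts ! j) \<noteq> pos c + 1" using t True by (simp add: pos_def)
      moreover have "rc c ! j = Stay" using loc [OF c] j True by (simp add: mark_simps)
      ultimately show ?thesis by simp
    next
      case False
      then have d: "c + 1 < width" using c by (simp add: width_def)
      have "rc c ! j = lc (c + 1) ! j" using edge [OF d] by simp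
      moreover have "pos c + 1 = pos (c + 1)" by (simp add: pos_def)
      moreover have "lc (c + 1) ! j = Lft \<longleftrightarrow> fst (ts ! j) = pos (c + 1) \<and> snd (A ! j) = Lft"
        using loc [OF d] j cell [OF j] qa [OF d] by simp
      ultimately show ?thesis by simp
    qed
    have 2: "cs' c ! j = (if fst (ts ! j) = pos c then fst (A ! j) else snd (ts ! j) (pos c),
        fst (ts ! j) = pos c \<and> snd (A ! j) = Stay \<or> lc c ! j = Rgt \<or> rc c ! j = Lft)"
      using conjunct1 [OF conjunct2 [OF conjunct2 [OF conjunct2 [OF loc [OF c, THEN spec, THEN mp, OF j]]]]]
      unfolding cell [OF j] fst_conv snd_conv conjunct2 [OF qa [OF c]] .
    show "cs' c ! j = cells (map2 act A ts) (pos c) ! j"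
      unfolding 1 2 lc rc shift_cases by (rule refl)
  qed
  moreover have "q' c = Q" using qa [OF c] by blast
  ultimately show ?thesis unfolding step_next_actions [OF QA] fst_conv snd_conv dn [OF c] by (simp only:)
qed

lemma tm_tile_up_not_Fin: "tm_tile M T \<Longrightarrow> up T \<noteq> Fin"
  by (erule tm_tile.cases) simp_all

lemma final_tile_accepts:
  assumes "tm_tile M T" "up T = Cell Orig q cs" "dn T = Fin"
  shows "q = halt M \<and> fst (last cs) = 2"
  using assms by cases simp_all

text \<open>A deciding machine leaves a one-bit word on its last tape from cell 0 on, and the symbol
  2 is the bit \<open>True\<close>.\<close>

definition accepts :: "word \<Rightarrow> word \<Rightarrow> bool" where
  "accepts x u \<longleftrightarrow> (case (step M ^^ P) (start M [x, u]) of (q, ts) \<Rightarrow> q = halt M \<and> snd (last ts) 0 = 2)"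

lemma last_cells: "ts \<noteq> [] \<Longrightarrow> fst (last (cells ts z)) = snd (last ts) z"
  by (simp add: cells_def last_map)

lemma grid_tiling_accepts:
  assumes T: "grid_tiling {T. tm_tile M T} width (P + 2) (ini_col x g) Fin T"
    and M: "turing_machine M" "2 \<le> ntapes M" and g: "g \<le> P"
  shows "\<exists>u. length u \<le> g \<and> accepts x u"
proof -
  have tm: "tm_tile M (T r c)" if "r < P + 2" "c < width" for r c
    using T that by (simp add: grid_tiling_def)
  have adj: "rt (T r c) = lf (T r (c + 1))" if "r < P + 2" "c + 1 < width" for r c
    using T that by (simp add: grid_tiling_def)
  have up: "up (T r c) = (if r = 0 then ini_col x g c else dn (T (r - 1) c))" if "r < P + 2" "c < width" for r c
    using T that by (simp add: grid_tiling_def)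
  have dn: "dn (T (P + 1) c) = Fin" if "c < width" for c
    using T that by (simp add: grid_tiling_def)
  have "\<exists>u. length u \<le> g \<and> (\<forall>c<width. dn (T 0 c) = Cell (mark_of c) 0 (cells (snd (start M [x, u])) (pos c)))"
  proof (rule init_row_sound [OF _ _ M(2) g])
    show "tm_tile M (T 0 c) \<and> up (T 0 c) = ini_col x g c" if "c < width" for c
      using tm [of 0 c] up [of 0 c] that by simp
    show "rt (T 0 c) = lf (T 0 (c + 1))" if "c + 1 < width" for c
      using adj [of 0 c] that by simp
  qed
  then obtain u where u: "length u \<le> g"
    and row0: "\<forall>c<width. dn (T 0 c) = Cell (mark_of c) 0 (cells (snd (start M [x, u])) (pos c))" by blast
  define cfg where "cfg t = (step M ^^ t) (start M [x, u])" for t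
  \<comment> \<open>The lower edge of row \<open>r\<close> shows the configuration after
    \<open>r\<close> steps: one initial row, \<open>P\<close> steps and one final row make up the
    \<open>P + 2\<close> rows.\<close>
  have rows: "\<forall>c<width. dn (T r c) = Cell (mark_of c) (fst (cfg r)) (cells (snd (cfg r)) (pos c))"
    if "r \<le> P" for r
    using that
  proof (induction r)
    case 0
    show ?case using row0 by (simp add: cfg_def start_def)
  next
    case (Suc r)
    then have IH: "dn (T r c) = Cell (mark_of c) (fst (cfg r)) (cells (snd (cfg r)) (pos c))"
      if "c < width" for c using that by simp
    have r: "Suc r < P + 2" "Suc (Suc r) < P + 2" "r \<le> P" using Suc.prems by simp_all
    \<comment> \<open>A final tile would have \<open>Fin\<close> below it, but no tile has
      \<open>Fin\<close> above, so no row before the last one contains a final tile.\<close>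
    have "tm_tile M (T (Suc r) c) \<and> up (T (Suc r) c) = Cell (mark_of c) (fst (cfg r)) (cells (snd (cfg r)) (pos c))
        \<and> dn (T (Suc r) c) \<noteq> Fin" if c: "c < width" for c
      using tm [OF r(1) c] up [OF r(1) c] IH [OF c] up [OF r(2) c] tm_tile_up_not_Fin [OF tm [OF r(2) c]]
      by simp
    note X = this
    have valid: "valid_config M r (fst (cfg r), snd (cfg r))"
      using valid_config_run [OF M(1)] by (simp add: cfg_def)
    have "cfg (Suc r) = step M (fst (cfg r), snd (cfg r))" by (simp add: cfg_def)
    then show ?case using step_row_sound [OF X adj [OF r(1)] valid r(3) _ M(1)] by simp
  qed
  have c: "P + 1 < width" by (simp add: width_def)
  have "up (T (P + 1) (P + 1)) = Cell Orig (fst (cfg P)) (cells (snd (cfg P)) (pos (P + 1)))"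
    using up [of "P + 1", OF _ c] rows [OF order_refl] c by (simp add: mark_of_def)
  from final_tile_accepts [OF tm [OF _ c] this dn [OF c]]
  have fin: "fst (cfg P) = halt M" "fst (last (cells (snd (cfg P)) (pos (P + 1)))) = 2" by simp_all
  have "length (snd (cfg P)) = ntapes M"
    using valid_config_run [OF M(1), of P] by (simp add: cfg_def valid_config_def)
  then have "snd (cfg P) \<noteq> []" using M(2) by auto
  moreover have "pos (P + 1) = 0" by (simp add: pos_def)
  ultimately have "snd (last (snd (cfg P))) 0 = 2" using fin(2) by (simp add: last_cells)
  then have "accepts x u" using fin(1) by (simp add: accepts_def cfg_def case_prod_beta)
  with u show ?thesis by blast
qed

section \<open>An accepting run drawn as a tiling\<close>

definition crossing :: "tape list \<Rightarrow> (nat \<times> dir) list \<Rightarrow> nat \<Rightarrow> dir list" where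
  "crossing ts as c = map (\<lambda>j. if fst (ts ! j) = pos c - 1 \<and> snd (as ! j) = Rgt then Rgt
     else if fst (ts ! j) = pos c \<and> snd (as ! j) = Lft then Lft else Stay) [0..<ntapes M]"

definition run_tile :: "word \<Rightarrow> nat \<Rightarrow> word \<Rightarrow> nat \<Rightarrow> nat \<Rightarrow> (hcol, vcol) tile" where
  "run_tile x g u r c =
    (let m = mark_of c; cfg = \<lambda>t. (step M ^^ t) (start M [x, u]); row = \<lambda>t. Cell m (fst (cfg t)) (cells (snd (cfg t)) (pos c));
         f = \<lambda>c. Flag (length u = g \<or> c \<le> P + 1 + length u) in
     if r = 0 then Tile (left_col m (f c)) (right_col m (f (c + 1))) (ini_col x g c) (row 0)
     else if r \<le> P then
       (let q = fst (cfg (r - 1)); ts = snd (cfg (r - 1)); ss = map scan ts; as = snd (next_actions M q ss) in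
        Tile (left_col m (Row q ss (crossing ts as c))) (right_col m (Row q ss (crossing ts as (c + 1))))
          (row (r - 1)) (row r))
     else Tile (left_col m RowFin) (right_col m RowFin) (row P) Fin)"

lemma run_tile_init:
  assumes "2 \<le> ntapes M" "length u \<le> g"
  shows "tm_tile M (run_tile x g u 0 c)"
proof -
  let ?f = "\<lambda>c. length u = g \<or> c \<le> P + 1 + length u"
  have w: "word_tape x (pos c) =
      (if P + 1 \<le> c \<and> c - (P + 1) < length x then bit_sym (x ! (c - (P + 1))) else 0)"
    by (simp add: word_tape_def nat_pos del: One_nat_def)
  have p: "pos c = 0 \<longleftrightarrow> mark_of c = Orig" by (auto simp: mark_simps pos_def)
  have "cells (snd (start M [x, u])) (pos c) = map (\<lambda>j. (if j = 0 then word_tape x (pos c)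
        else if j = 1 then word_tape u (pos c) else 0, mark_of c = Orig)) [0..<ntapes M]"
    unfolding p [symmetric] by (rule nth_equalityI) (auto simp: cells_def start_def)
  then have eq: "run_tile x g u 0 c = Tile (left_col (mark_of c) (Flag (?f c))) (right_col (mark_of c) (Flag (?f (c + 1))))
      (Ini (mark_of c) (word_tape x (pos c)) (P + 1 \<le> c \<and> c - (P + 1) < g))
      (Cell (mark_of c) 0 (map (\<lambda>j. (if j = 0 then word_tape x (pos c)
        else if j = 1 then word_tape u (pos c) else 0, mark_of c = Orig)) [0..<ntapes M]))"
    unfolding run_tile_def Let_def ini_col_def w by (simp add: start_def)
  have zero: "word_tape u (pos c) = 0 \<longleftrightarrow> \<not> (P + 1 \<le> c \<and> c - (P + 1) < length u)"
    by (simp add: word_tape_def nat_pos bit_sym_def del: One_nat_def)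
  show ?thesis
    unfolding eq
  proof (rule tm_tile.init)
    show "word_tape x (pos c) < 3" "word_tape u (pos c) < 3"
      by (simp_all add: word_tape_def bit_sym_def)
    show "if P + 1 \<le> c \<and> c - (P + 1) < g
      then (if word_tape u (pos c) = 0 then \<not> ?f (c + 1) else ?f c \<and> ?f (c + 1))
      else word_tape u (pos c) = 0 \<and> ?f (c + 1) = ?f c"
      unfolding zero using assms(2) by auto
  qed
qed

lemma run_tile_step:
  assumes M: "turing_machine M" and t: "t < P" and c: "c < width"
  shows "tm_tile M (run_tile x g u (Suc t) c)"
proof -
  let ?k = "ntapes M"
  obtain q ts where qt: "(step M ^^ t) (start M [x, u]) = (q, ts)" by force
  have valid: "valid_config M t (q, ts)" using valid_config_run [OF M, of t "[x, u]"] by (simp add: qt)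
  obtain Q A where QA: "next_actions M q (map scan ts) = (Q, A)" by force
  have q: "q \<le> halt M" and lts: "length ts = ?k" using valid by (simp_all add: valid_config_def)
  note scans = valid_config_scans [OF valid]
  have lA: "length A = ?k" using next_actions_valid [OF M q scans QA] by simp
  have nxt: "(step M ^^ Suc t) (start M [x, u]) = (Q, map2 act A ts)"
    using step_next_actions [OF QA] by (simp add: qt)
  have eq: "run_tile x g u (Suc t) c =
      Tile (left_col (mark_of c) (Row q (map scan ts) (crossing ts A c)))
        (right_col (mark_of c) (Row q (map scan ts) (crossing ts A (c + 1))))
        (Cell (mark_of c) q (cells ts (pos c))) (Cell (mark_of c) Q (cells (map2 act A ts) (pos c)))"
    using t unfolding run_tile_def Let_def nxt by (simp add: qt QA)
  show ?thesis
    unfolding eq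
  proof (rule tm_tile.step [OF q scans _ _ _ _ _ QA])
    show "length (crossing ts A c) = ?k" "length (crossing ts A (c + 1)) = ?k"
      by (simp_all add: crossing_def)
    show "length (cells ts (pos c)) = ?k" "length (cells (map2 act A ts) (pos c)) = ?k"
      using lts lA by (simp_all add: cells_def)
    have "snd (ts ! j) (pos c) < nsyms M" if "j < ?k" for j
      using valid that by (simp add: valid_config_def)
    then show "fst ` set (cells ts (pos c)) \<subseteq> {..<nsyms M}"
      using lts by (intro fst_set_subsetI) (simp add: cells_def)
    show "\<forall>j<?k.
      (snd (cells ts (pos c) ! j) \<longrightarrow> fst (cells ts (pos c) ! j) = map scan ts ! j) \<and>
      (crossing ts A c ! j = Lft \<longleftrightarrow> snd (cells ts (pos c) ! j) \<and> snd (A ! j) = Lft) \<and>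
      (crossing ts A (c + 1) ! j = Rgt \<longleftrightarrow> snd (cells ts (pos c) ! j) \<and> snd (A ! j) = Rgt) \<and>
      cells (map2 act A ts) (pos c) ! j =
        (if snd (cells ts (pos c) ! j) then fst (A ! j) else fst (cells ts (pos c) ! j),
         snd (cells ts (pos c) ! j) \<and> snd (A ! j) = Stay \<or>
         crossing ts A c ! j = Rgt \<or> crossing ts A (c + 1) ! j = Lft) \<and>
      (mark_of c = First \<longrightarrow> crossing ts A c ! j = Stay) \<and>
      (mark_of c = Last \<longrightarrow> crossing ts A (c + 1) ! j = Stay)"
    proof (intro allI impI)
      fix j assume j: "j < ?k"
      have cell: "cells ts (pos c) ! j = (snd (ts ! j) (pos c), fst (ts ! j) = pos c)"
        "cells (map2 act A ts) (pos c) ! j =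
          (if fst (ts ! j) = pos c then fst (A ! j) else snd (ts ! j) (pos c),
           fst (ts ! j) + shift (snd (A ! j)) = pos c)"
        using j lts lA by (auto simp: cells_def act_split)
      have cr: "crossing ts A c ! j = (if fst (ts ! j) = pos c - 1 \<and> snd (A ! j) = Rgt then Rgt
          else if fst (ts ! j) = pos c \<and> snd (A ! j) = Lft then Lft else Stay)"
        "crossing ts A (c + 1) ! j = (if fst (ts ! j) = pos c \<and> snd (A ! j) = Rgt then Rgt
          else if fst (ts ! j) = pos c + 1 \<and> snd (A ! j) = Lft then Lft else Stay)"
        using j by (simp_all add: crossing_def pos_def)
      have sc: "map scan ts ! j = snd (ts ! j) (fst (ts ! j))" using j lts by (simp add: scan_split)
      have h: "\<bar>fst (ts ! j)\<bar> \<le> int t" using valid j by (simp add: valid_config_def)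
      \<comment> \<open>The end columns are at distance \<open>P + 1\<close> from the origin, out of
        reach of all heads at time \<open>t\<close>.\<close>
      have first: "fst (ts ! j) \<noteq> pos c - 1" "fst (ts ! j) \<noteq> pos c" if "mark_of c = First"
        using that h t by (auto simp: mark_simps pos_def)
      have last: "fst (ts ! j) \<noteq> pos c + 1" "fst (ts ! j) \<noteq> pos c" if "mark_of c = Last"
        using that h t by (auto simp: mark_simps pos_def)
      show "(snd (cells ts (pos c) ! j) \<longrightarrow> fst (cells ts (pos c) ! j) = map scan ts ! j) \<and>
        (crossing ts A c ! j = Lft \<longleftrightarrow> snd (cells ts (pos c) ! j) \<and> snd (A ! j) = Lft) \<and>
        (crossing ts A (c + 1) ! j = Rgt \<longleftrightarrow> snd (cells ts (pos c) ! j) \<and> snd (A ! j) = Rgt) \<and>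
        cells (map2 act A ts) (pos c) ! j =
          (if snd (cells ts (pos c) ! j) then fst (A ! j) else fst (cells ts (pos c) ! j),
           snd (cells ts (pos c) ! j) \<and> snd (A ! j) = Stay \<or>
           crossing ts A c ! j = Rgt \<or> crossing ts A (c + 1) ! j = Lft) \<and>
        (mark_of c = First \<longrightarrow> crossing ts A c ! j = Stay) \<and>
        (mark_of c = Last \<longrightarrow> crossing ts A (c + 1) ! j = Stay)"
        unfolding cell cr sc shift_cases fst_conv snd_conv
      proof (intro conjI)
        show "mark_of c = First \<longrightarrow> (if fst (ts ! j) = pos c - 1 \<and> snd (A ! j) = Rgt then Rgt
          else if fst (ts ! j) = pos c \<and> snd (A ! j) = Lft then Lft else Stay) = Stay"
          using first by simp
        show "mark_of c = Last \<longrightarrow> (if fst (ts ! j) = pos c \<and> snd (A ! j) = Rgt then Rgt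
          else if fst (ts ! j) = pos c + 1 \<and> snd (A ! j) = Lft then Lft else Stay) = Stay"
          using last by simp
      qed (cases "snd (A ! j)"; simp)+
    qed
  qed
qed

lemma run_tile_final:
  assumes M: "turing_machine M" "2 \<le> ntapes M" and "accepts x u"
  shows "tm_tile M (run_tile x g u (P + 1) c)"
proof -
  obtain q ts where qt: "(step M ^^ P) (start M [x, u]) = (q, ts)" by force
  have valid: "valid_config M P (q, ts)" using valid_config_run [OF M(1), of P "[x, u]"] by (simp add: qt)
  have acc: "q = halt M" "snd (last ts) 0 = 2" using assms(3) by (simp_all add: accepts_def qt)
  have lts: "length ts = ntapes M" using valid by (simp add: valid_config_def)
  then have ne: "ts \<noteq> []" using M(2) by auto
  have eq: "run_tile x g u (P + 1) c =
      Tile (left_col (mark_of c) RowFin) (right_col (mark_of c) RowFin)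
        (Cell (mark_of c) (halt M) (cells ts (pos c))) Fin"
    unfolding run_tile_def Let_def using acc by (simp add: qt)
  show ?thesis
    unfolding eq
  proof (rule tm_tile.final)
    show "length (cells ts (pos c)) = ntapes M" using lts by (simp add: cells_def)
    have "snd (ts ! j) (pos c) < nsyms M" if "j < ntapes M" for j
      using valid that by (simp add: valid_config_def)
    then show "fst ` set (cells ts (pos c)) \<subseteq> {..<nsyms M}"
      using lts by (intro fst_set_subsetI) (simp add: cells_def)
    show "mark_of c = Orig \<longrightarrow> fst (last (cells ts (pos c))) = 2"
      using acc(2) ne by (auto simp: mark_simps last_cells pos_def)
  qed
qed

lemma accepts_grid_tiling:
  assumes M: "turing_machine M" "2 \<le> ntapes M" and u: "length u \<le> g" "accepts x u"
  shows "grid_tiling {T. tm_tile M T} width (P + 2) (ini_col x g) Fin (run_tile x g u)"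
  unfolding grid_tiling_def
proof (intro conjI allI impI)
  fix r c assume r: "r < P + 2" and c: "c < width"
  consider "r = 0" | t where "r = Suc t" "t < P" | "r = P + 1"
    using r by (cases r) (auto simp: less_Suc_eq)
  then have "tm_tile M (run_tile x g u r c)"
    using run_tile_init [OF M(2) u(1)] run_tile_step [OF M(1) _ c] run_tile_final [OF M u(2)] by cases simp_all
  then show "run_tile x g u r c \<in> {T. tm_tile M T}" by simp
  show "up (run_tile x g u r c) = (if r = 0 then ini_col x g c else dn (run_tile x g u (r - 1) c))"
  proof (cases "r = P + 1")
    case True
    show ?thesis unfolding run_tile_def Let_def True by (cases "P = 0") simp_all
  next
    case False
    then have "r \<le> P" using r by simp
    then show ?thesis by (cases r) (auto simp: run_tile_def Let_def)
  qed
next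
  fix r c assume "r < P + 2" and "c + 1 < width"
  then show "rt (run_tile x g u r c) = lf (run_tile x g u r (c + 1))"
    by (simp add: run_tile_def Let_def left_col_def right_col_def mark_simps width_def)
next
  fix c
  show "dn (run_tile x g u (P + 2 - 1) c) = Fin" by (simp add: run_tile_def Let_def)
qed

lemma run_tile_border:
  "lf (run_tile x g u r 0) = Border" "rt (run_tile x g u r (width - 1)) = Border"
  by (simp_all add: run_tile_def Let_def left_col_def right_col_def mark_of_def width_def)

theorem helix_tiling_iff_accepts:
  assumes M: "turing_machine M" "2 \<le> ntapes M" and g: "g \<le> P"
  shows "(\<exists>\<tau>. helix_tiling {T. tm_tile M T} width ((P + 2) * width) Border (ini_col x g) Fin \<tau>) \<longleftrightarrow>
    (\<exists>u. length u \<le> g \<and> accepts x u)"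
proof
  assume "\<exists>\<tau>. helix_tiling {T. tm_tile M T} width ((P + 2) * width) Border (ini_col x g) Fin \<tau>"
  then obtain \<tau> where "helix_tiling {T. tm_tile M T} width ((P + 2) * width) Border (ini_col x g) Fin \<tau>"
    by blast
  from grid_of_helix_tiling [OF this] show "\<exists>u. length u \<le> g \<and> accepts x u"
    by (intro grid_tiling_accepts [OF _ M g]) simp
next
  assume "\<exists>u. length u \<le> g \<and> accepts x u"
  then obtain u where u: "length u \<le> g" "accepts x u" by blast
  have "1 < width" by (simp add: width_def)
  then have "helix_tiling {T. tm_tile M T} width ((P + 2) * width) Border (ini_col x g) Fin
      (\<lambda>s. run_tile x g u (s div width) (s mod width))"
    by (intro helix_of_grid_tiling [OF accepts_grid_tiling [OF M u]] conjI run_tile_border) simp_all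
  then show "\<exists>\<tau>. helix_tiling {T. tm_tile M T} width ((P + 2) * width) Border (ini_col x g) Fin \<tau>"
    by blast
qed

end

section \<open>Programs for unary arithmetic and repeated output\<close>

primrec loop_free :: "prog \<Rightarrow> bool" where
  "loop_free Skip = True"
| "loop_free (Push r b) = True"
| "loop_free (Pop r) = True"
| "loop_free (P ;; Q) = (loop_free P \<and> loop_free Q)"
| "loop_free (Test r A P Q) = (loop_free P \<and> loop_free Q)"
| "loop_free (Loop r A P) = False"

lemma polytime_on_True: "polytime_on R (\<lambda>_. True) P \<Longrightarrow> polytime_on R D P"
  by (erule polytime_on_weaken) simp_all

lemma polytime_on_loop_free: "loop_free P \<Longrightarrow> polytime_on R D P"
proof (induction P arbitrary: D)
  case (Seq P Q)
  then show ?case by (intro polytime_on_Seq [where D' = "\<lambda>_. True"]) simp_all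
next
  case (Test r A P Q)
  then show ?case by (intro polytime_on_Test) simp_all
qed (simp_all add: polytime_on_Skip polytime_on_Push polytime_on_Pop)

primrec emit :: "nat \<Rightarrow> word \<Rightarrow> prog" where
  "emit r [] = Skip"
| "emit r (b # w) = Push r b ;; emit r w"

lemma den_emit [simp]: "den (emit r w) \<sigma> = \<sigma>(r := rev w @ \<sigma> r)"
  by (induction w arbitrary: \<sigma>) simp_all

lemma loop_free_emit [simp]: "loop_free (emit r w)"
  by (induction w) simp_all

text \<open>The transfer from one stack to another reverses the word, so a word is moved twice to
  keep its order, or built reversed.\<close>

definition move :: "nat \<Rightarrow> nat \<Rightarrow> prog" where
  "move a b = Loop a (- {None}) (Test a {Some True} (Push b True) (Push b False) ;; Pop a)"

lemma den_move:
  assumes "a \<noteq> b"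
  shows "den (move a b) \<sigma> = \<sigma>(a := [], b := rev (\<sigma> a) @ \<sigma> b)"
proof (induction "\<sigma> a" arbitrary: \<sigma>)
  case Nil
  then have "\<sigma> a = []" by simp
  then show ?case unfolding move_def by (subst den_Loop) (simp add: fun_eq_iff)
next
  case (Cons v w)
  then have v: "\<sigma> a = v # w" by simp
  have "den (move a b) \<sigma> = den (move a b) (\<sigma>(b := v # \<sigma> b, a := w))"
    unfolding move_def by (subst den_Loop) (use assms v in simp)
  also have "\<dots> = \<sigma>(a := [], b := rev (\<sigma> a) @ \<sigma> b)"
    by (subst Cons.hyps(1)) (use assms v in \<open>simp_all add: fun_eq_iff\<close>)
  finally show ?case .
qed

lemma polytime_on_move:
  assumes "a \<noteq> b"
  shows "polytime_on {a} D (move a b)"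
proof (rule polytime_on_True, unfold move_def,
    rule polytime_on_Loop [where \<Phi> = "\<lambda>\<sigma>. length (\<sigma> a)" and b = "\<lambda>n. n"])
  fix \<sigma> :: store and i
  assume "peek (\<sigma> a) \<in> - {None}"
  then obtain v w where "\<sigma> a = v # w" by (cases "\<sigma> a") auto
  then show "True \<and> length (den (Test a {Some True} (Push b True) (Push b False) ;; Pop a) \<sigma> a) < length (\<sigma> a)"
    and "i \<in> {a} \<Longrightarrow> length (den (Test a {Some True} (Push b True) (Push b False) ;; Pop a) \<sigma> i)
      \<le> max (length (\<sigma> i)) (length (\<sigma> a))"
    using assms by simp_all
qed (simp_all add: polytime_on_loop_free poly_bounded_id)

definition unary :: "nat \<Rightarrow> word" where
  "unary n = replicate n True"

lemma unary_simps [simp]: "unary 0 = []" "unary (Suc n) = True # unary n" "rev (unary n) = unary n"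
  "length (unary n) = n" "unary m @ unary n = unary (m + n)"
  by (simp_all add: unary_def replicate_add)

definition cat :: "nat \<Rightarrow> word \<Rightarrow> word" where
  "cat n w = concat (replicate n w)"

lemma cat_simps [simp]: "cat 0 w = []" "cat (Suc n) w = w @ cat n w"
  by (simp_all add: cat_def)

lemma cat_add: "cat (m + n) w = cat m w @ cat n w"
  by (simp add: cat_def replicate_add)

lemma cat_True [simp]: "cat n [True] = unary n"
  by (induction n) simp_all

text \<open>\<open>repeat a s r w\<close> appends to \<open>r\<close> as many copies of \<open>w\<close> as \<open>a\<close> has elements; \<open>s\<close> is scratch.\<close>

definition repeat_loop :: "nat \<Rightarrow> nat \<Rightarrow> nat \<Rightarrow> word \<Rightarrow> prog" where
  "repeat_loop a s r w = Loop a (- {None}) (Pop a ;; Push s True ;; emit r w)"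

definition repeat :: "nat \<Rightarrow> nat \<Rightarrow> nat \<Rightarrow> word \<Rightarrow> prog" where
  "repeat a s r w = repeat_loop a s r w ;; move s a"

lemma den_repeat_loop:
  assumes "distinct [a, s, r]" "\<sigma> a = unary m" "\<sigma> s = unary k"
  shows "den (repeat_loop a s r w) \<sigma> = \<sigma>(a := [], s := unary (m + k), r := rev (cat m w) @ \<sigma> r)"
  using assms(2,3)
proof (induction m arbitrary: \<sigma> k)
  case 0
  then show ?case unfolding repeat_loop_def by (subst den_Loop) (simp add: fun_eq_iff)
next
  case (Suc m)
  have "den (repeat_loop a s r w) \<sigma> =
      den (repeat_loop a s r w) (\<sigma>(a := unary m, s := unary (Suc k), r := rev w @ \<sigma> r))"
    unfolding repeat_loop_def by (subst den_Loop) (use assms(1) Suc.prems in simp)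
  also have "\<dots> = \<sigma>(a := [], s := unary (Suc m + k), r := rev (cat (Suc m) w) @ \<sigma> r)"
    by (subst Suc.IH [where k = "Suc k"]) (use assms(1) in \<open>auto simp: fun_eq_iff\<close>)
  finally show ?case .
qed

lemma den_repeat:
  assumes "distinct [a, s, r]" "\<sigma> a = unary m" "\<sigma> s = []"
  shows "den (repeat a s r w) \<sigma> = \<sigma>(r := rev (cat m w) @ \<sigma> r)"
  using assms by (simp add: repeat_def den_repeat_loop [where m = m and k = 0] den_move fun_eq_iff)

lemma polytime_on_repeat:
  assumes "distinct [a, s, r]"
  shows "polytime_on {a, s} D (repeat a s r w)"
proof (rule polytime_on_True)
  let ?B = "Pop a ;; Push s True ;; emit r w"
  have "polytime_on {a, s} (\<lambda>_. True) (repeat_loop a s r w)"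
    unfolding repeat_loop_def
  \<comment> \<open>Each iteration moves a symbol from \<open>a\<close> to \<open>s\<close>. The
    weight 2 makes the measure decrease although \<open>s\<close> grows, and counting
    \<open>s\<close> lets the measure cap its size. The output register \<open>r\<close> does not
    enter the bound.\<close>
  proof (rule polytime_on_Loop [where \<Phi> = "\<lambda>\<sigma>. 2 * length (\<sigma> a) + length (\<sigma> s)" and b = "\<lambda>n. 2 * n + n"])
    fix \<sigma> :: store and i
    assume "peek (\<sigma> a) \<in> - {None}"
    then obtain v w where "\<sigma> a = v # w" by (cases "\<sigma> a") auto
    then show "True \<and> 2 * length (den ?B \<sigma> a) + length (den ?B \<sigma> s) < 2 * length (\<sigma> a) + length (\<sigma> s)"
      and "i \<in> {a, s} \<Longrightarrow> length (den ?B \<sigma> i) \<le> max (length (\<sigma> i)) (2 * length (\<sigma> a) + length (\<sigma> s))"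
      using assms by auto
  qed (auto intro!: polytime_on_loop_free poly_bounded_add poly_bounded_mult poly_bounded_const poly_bounded_id)
  moreover have "polytime_on {a, s} (\<lambda>_. True) (move s a)"
    using assms by (intro polytime_on_weaken [OF polytime_on_move]) auto
  ultimately show "polytime_on {a, s} (\<lambda>_. True) (repeat a s r w)"
    unfolding repeat_def by (rule polytime_on_Seq) simp
qed

definition times :: "nat \<Rightarrow> nat \<Rightarrow> nat \<Rightarrow> nat \<Rightarrow> prog" where
  "times d n s t = Loop d (- {None}) (Pop d ;; repeat n s t [True])"

lemma den_times:
  assumes "distinct [d, n, s, t]" "\<sigma> d = unary a" "\<sigma> n = unary m" "\<sigma> s = []" "\<sigma> t = unary b"
  shows "den (times d n s t) \<sigma> = \<sigma>(d := [], t := unary (a * m + b))"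
  using assms(2-)
proof (induction a arbitrary: \<sigma> b)
  case 0
  then show ?case unfolding times_def by (subst den_Loop) (simp add: fun_eq_iff)
next
  case (Suc a)
  have 1: "den (repeat n s t [True]) (\<sigma>(d := unary a)) = \<sigma>(d := unary a, t := unary (m + b))"
    by (subst den_repeat [where m = m]) (use assms(1) Suc.prems in \<open>auto simp: fun_eq_iff\<close>)
  have "den (times d n s t) \<sigma> = den (times d n s t) (\<sigma>(d := unary a, t := unary (m + b)))"
    unfolding times_def by (subst den_Loop) (use Suc.prems(1) 1 in simp)
  also have "\<dots> = \<sigma>(d := [], t := unary (Suc a * m + b))"
    by (subst Suc.IH [where b = "m + b"]) (use assms(1) Suc.prems in \<open>auto simp: fun_eq_iff algebra_simps\<close>)
  finally show ?case .
qed

lemma polytime_on_times: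
  assumes d: "distinct [d, n, s, t]"
  shows "polytime_on {d, n, s, t} (\<lambda>\<sigma>. (\<exists>a. \<sigma> d = unary a) \<and> (\<exists>m. \<sigma> n = unary m) \<and> \<sigma> s = [] \<and> (\<exists>b. \<sigma> t = unary b))
    (times d n s t)"
  unfolding times_def
\<comment> \<open>The final length of \<open>t\<close> plus the number of iterations left: an
  iteration adds the length of register \<open>n\<close> to \<open>t\<close> and takes that length
  plus 1 from the product.\<close>
proof (rule polytime_on_Loop [where \<Phi> = "\<lambda>\<sigma>. length (\<sigma> t) + length (\<sigma> d) * (length (\<sigma> n) + 1)"
      and b = "\<lambda>k. k + k * (k + 1)"])
  let ?D = "\<lambda>\<sigma>. (\<exists>a. \<sigma> d = unary a) \<and> (\<exists>m. \<sigma> n = unary m) \<and> \<sigma> s = [] \<and> (\<exists>b. \<sigma> t = unary b)"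
  have "polytime_on {d, n, s, t} D (repeat n s t [True])" for D
    by (rule polytime_on_weaken [OF polytime_on_repeat]) (use d in auto)
  then show "polytime_on {d, n, s, t} ?D (Pop d ;; repeat n s t [True])"
    by (intro polytime_on_Seq [where D' = "\<lambda>_. True"] polytime_on_Pop) simp_all
  fix \<sigma> :: store and i
  assume "?D \<sigma>" "peek (\<sigma> d) \<in> - {None}"
  then obtain a m b where *: "\<sigma> d = unary a" "\<sigma> n = unary m" "\<sigma> s = []" "\<sigma> t = unary b" "a \<noteq> 0"
    by (metis ComplD insertI1 peek_simps(1) unary_simps(1))
  then obtain c where c: "a = Suc c" by (cases a) auto
  have eq: "den (Pop d ;; repeat n s t [True]) \<sigma> = \<sigma>(d := unary c, t := unary (m + b))"
    unfolding den.simps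
    by (subst den_repeat [where m = m]) (use d * c in \<open>auto simp: fun_eq_iff\<close>)
  show "?D (den (Pop d ;; repeat n s t [True]) \<sigma>) \<and>
      length (den (Pop d ;; repeat n s t [True]) \<sigma> t) + length (den (Pop d ;; repeat n s t [True]) \<sigma> d) *
        (length (den (Pop d ;; repeat n s t [True]) \<sigma> n) + 1)
      < length (\<sigma> t) + length (\<sigma> d) * (length (\<sigma> n) + 1)"
    unfolding eq using d * c by auto
  show "i \<in> {d, n, s, t} \<Longrightarrow> length (den (Pop d ;; repeat n s t [True]) \<sigma> i)
      \<le> max (length (\<sigma> i)) (length (\<sigma> t) + length (\<sigma> d) * (length (\<sigma> n) + 1))"
    unfolding eq using d * c by auto
next
  show "poly_bounded (\<lambda>k. k + k * (k + 1))"
    by (intro poly_bounded_add poly_bounded_mult poly_bounded_const poly_bounded_id)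
  show "length (\<sigma> t) + length (\<sigma> d) * (length (\<sigma> n) + 1) \<le> k + k * (k + 1)"
    if "\<forall>r\<in>{d, n, s, t}. length (\<sigma> r) \<le> k" for k and \<sigma> :: store
    using that by (intro add_mono mult_mono) auto
qed

section \<open>Evaluating polynomials in unary\<close>

primrec horner :: "nat \<Rightarrow> nat \<Rightarrow> nat \<Rightarrow> nat \<Rightarrow> nat list \<Rightarrow> prog" where
  "horner d n s t [] = Skip"
| "horner d n s t (c # cs) = horner d n s t cs ;; times d n s t ;; move t d ;; emit d (unary c)"

lemma den_horner:
  assumes "distinct [d, n, s, t]" "\<sigma> d = []" "\<sigma> n = unary m" "\<sigma> s = []" "\<sigma> t = []"
  shows "den (horner d n s t cs) \<sigma> = \<sigma>(d := unary (poly (Poly cs) m))"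
proof (induction cs)
  case Nil
  then show ?case using assms by (simp add: fun_eq_iff)
next
  case (Cons c cs)
  let ?a = "poly (Poly cs) m"
  have 1: "den (times d n s t) (\<sigma>(d := unary ?a)) = \<sigma>(d := [], t := unary (?a * m))"
    by (subst den_times [where a = ?a and m = m and b = 0]) (use assms in \<open>auto simp: fun_eq_iff\<close>)
  show ?case unfolding horner.simps den.simps Cons.IH 1
    using assms by (simp add: den_move fun_eq_iff mult.commute)
qed

definition horner_ok :: "nat \<Rightarrow> nat \<Rightarrow> nat \<Rightarrow> nat \<Rightarrow> store \<Rightarrow> bool" where
  "horner_ok d n s t \<sigma> \<longleftrightarrow> \<sigma> d = [] \<and> (\<exists>m. \<sigma> n = unary m) \<and> \<sigma> s = [] \<and> \<sigma> t = []"

lemma polytime_on_horner: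
  assumes d: "distinct [d, n, s, t]"
  shows "polytime_on UNIV (horner_ok d n s t) (horner d n s t cs)"
proof (induction cs)
  case Nil
  then show ?case by (simp add: polytime_on_Skip)
next
  case (Cons c cs)
  let ?D = "\<lambda>\<sigma>. (\<exists>a. \<sigma> d = unary a) \<and> (\<exists>m. \<sigma> n = unary m) \<and> \<sigma> s = [] \<and> (\<exists>b. \<sigma> t = unary b)"
  have 1: "polytime_on UNIV ?D (times d n s t)"
    by (rule polytime_on_weaken [OF polytime_on_times [OF d]]) auto
  have 2: "polytime_on UNIV (\<lambda>_. True) (move t d)"
    by (rule polytime_on_weaken [OF polytime_on_move]) (use d in auto)
  have 3: "polytime_on UNIV ?D (times d n s t ;; move t d ;; emit d (unary c))"
    by (rule polytime_on_Seq [OF 1 polytime_on_Seq [OF 2 polytime_on_loop_free]]) simp_all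
  have "?D (den (horner d n s t cs) \<sigma>)" if ok: "horner_ok d n s t \<sigma>" for \<sigma>
  proof -
    obtain m where m: "\<sigma> d = []" "\<sigma> n = unary m" "\<sigma> s = []" "\<sigma> t = []"
      using ok by (auto simp: horner_ok_def)
    have "\<exists>b. [] = unary b" by (rule exI [of _ 0]) simp
    then show ?thesis unfolding den_horner [OF d m] using d m by auto
  qed
  with Cons.IH 3 show ?case unfolding horner.simps by (rule polytime_on_Seq)
qed

text \<open>On an empty register it does nothing, so a traversal may run past the end of the input
  into the blank part of the tape.\<close>

definition move_top :: "nat \<Rightarrow> nat \<Rightarrow> prog" where
  "move_top a b = Test a {Some True} (Pop a ;; Push b True) (Test a {Some False} (Pop a ;; Push b False) Skip)"

lemma loop_free_move_top [simp]: "loop_free (move_top a b)"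
  by (simp add: move_top_def)

lemma den_move_top:
  "a \<noteq> b \<Longrightarrow> den (move_top a b) \<sigma> = \<sigma>(a := tl (\<sigma> a), b := rev (take 1 (\<sigma> a)) @ \<sigma> b)"
  by (cases "\<sigma> a") (auto simp: move_top_def fun_eq_iff)

definition measure_loop :: "nat \<Rightarrow> nat \<Rightarrow> nat \<Rightarrow> prog" where
  "measure_loop a b r = Loop a (- {None}) (move_top a b ;; Push r True)"

lemma den_measure_loop:
  assumes "distinct [a, b, r]" "\<sigma> r = unary k"
  shows "den (measure_loop a b r) \<sigma> = \<sigma>(a := [], b := rev (\<sigma> a) @ \<sigma> b, r := unary (length (\<sigma> a) + k))"
  using assms(2)
proof (induction "\<sigma> a" arbitrary: \<sigma> k)
  case Nil
  then have "\<sigma> a = []" by simp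
  with Nil.prems show ?case unfolding measure_loop_def by (subst den_Loop) (simp add: fun_eq_iff)
next
  case (Cons v w)
  then have v: "\<sigma> a = v # w" by simp
  have "den (measure_loop a b r) \<sigma> = den (measure_loop a b r) (\<sigma>(a := w, b := v # \<sigma> b, r := unary (Suc k)))"
    unfolding measure_loop_def by (subst den_Loop) (use assms(1) v Cons.prems in \<open>simp add: den_move_top\<close>)
  also have "\<dots> = \<sigma>(a := [], b := rev (\<sigma> a) @ \<sigma> b, r := unary (length (\<sigma> a) + k))"
    by (subst Cons.hyps(1) [where k = "Suc k"]) (use assms(1) v in \<open>auto simp: fun_eq_iff\<close>)
  finally show ?case .
qed

lemma polytime_on_measure_loop:
  assumes "distinct [a, b, r]"
  shows "polytime_on {a} D (measure_loop a b r)"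
proof (rule polytime_on_True, unfold measure_loop_def,
    rule polytime_on_Loop [where \<Phi> = "\<lambda>\<sigma>. length (\<sigma> a)" and b = "\<lambda>n. n"])
  fix \<sigma> :: store and i
  assume "peek (\<sigma> a) \<in> - {None}"
  then obtain v w where "\<sigma> a = v # w" by (cases "\<sigma> a") auto
  then show "True \<and> length (den (move_top a b ;; Push r True) \<sigma> a) < length (\<sigma> a)"
    and "i \<in> {a} \<Longrightarrow> length (den (move_top a b ;; Push r True) \<sigma> i) \<le> max (length (\<sigma> i)) (length (\<sigma> a))"
    using assms by (simp_all add: den_move_top)
qed (simp_all add: polytime_on_loop_free poly_bounded_id)

section \<open>The program writing the reduction\<close>

definition first_sym :: "word \<Rightarrow> nat" where
  "first_sym w = (case w of [] \<Rightarrow> 0 | b # _ \<Rightarrow> bit_sym b)"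

definition and_word :: word where "and_word = [False, False, True, True]"
definition var_word :: word where "var_word = [False, False, False, False, False]"

text \<open>
  Registers: 0 input (1 its reverse), 2 input length, 3 and 4 scratch, 5 and 7 the bounds \<open>P\<close> and \<open>g\<close>
  (6 and 8 partners during traversal), 9 and 10 the numbers of cells before and after the current one,
  11 width minus 2, 12 number of cells minus width, 13 output reversed, 14 output.
\<close>

context
  fixes z0 wO wN wL wF :: word and zi :: "mark \<Rightarrow> nat \<Rightarrow> bool \<Rightarrow> word"
    and wE wX wD :: "(hcol, vcol) tile \<Rightarrow> word" and Ts :: "(hcol, vcol) tile list"
begin

text \<open>The words \<open>z0\<close>, \<open>zi\<close>, \<open>wO\<close>, \<open>wN\<close>,
  \<open>wL\<close>, \<open>wE\<close>, \<open>wX\<close> and \<open>wD\<close> stand for encodings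
  of single blocks of slots and are constants of the program. A column reads the next input symbol
  and one unit of \<open>g\<close> and saves both in the partner registers for the way back.\<close>

definition col_prog :: "mark \<Rightarrow> prog" where
  "col_prog m = Test 0 {None} (Test 7 {None} (emit 13 (zi m 0 False)) (emit 13 (zi m 0 True)))
     (Test 0 {Some True} (Test 7 {None} (emit 13 (zi m 2 False)) (emit 13 (zi m 2 True)))
       (Test 7 {None} (emit 13 (zi m 1 False)) (emit 13 (zi m 1 True)))) ;;
     move_top 0 1 ;; move_top 7 8"

lemma loop_free_col_prog [simp]: "loop_free (col_prog m)"
  by (simp add: col_prog_def)

lemma den_col_prog:
  "den (col_prog m) \<sigma> = \<sigma>(0 := tl (\<sigma> 0), 1 := rev (take 1 (\<sigma> 0)) @ \<sigma> 1, 7 := tl (\<sigma> 7),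
     8 := rev (take 1 (\<sigma> 7)) @ \<sigma> 8, 13 := rev (zi m (first_sym (\<sigma> 0)) (\<sigma> 7 \<noteq> [])) @ \<sigma> 13)"
proof -
  have A: "den (Test 0 {None} (Test 7 {None} (emit 13 (zi m 0 False)) (emit 13 (zi m 0 True)))
     (Test 0 {Some True} (Test 7 {None} (emit 13 (zi m 2 False)) (emit 13 (zi m 2 True)))
       (Test 7 {None} (emit 13 (zi m 1 False)) (emit 13 (zi m 1 True))))) \<sigma> =
    \<sigma>(13 := rev (zi m (first_sym (\<sigma> 0)) (\<sigma> 7 \<noteq> [])) @ \<sigma> 13)"
    by (cases "\<sigma> 0"; cases "\<sigma> 7") (auto simp: first_sym_def bit_sym_def)
  show ?thesis unfolding col_prog_def den.simps(4) A by (simp add: den_move_top fun_eq_iff)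
qed

definition cols_loop :: prog where
  "cols_loop = Loop 5 (- {None}) (col_prog Mid ;; Pop 5 ;; Push 6 True)"

lemma take_Suc_tl: "take (Suc r) w = take 1 w @ take r (tl w)"
  by (cases w) simp_all

lemma upt_0_Suc: "[0..<Suc r] = 0 # map Suc [0..<r]"
  by (simp add: map_Suc_upt upt_conv_Cons del: upt_Suc)

lemma den_cols_loop:
  assumes "\<sigma> 5 = unary r" "\<sigma> 6 = unary k"
  shows "den cols_loop \<sigma> = \<sigma>(5 := [], 6 := unary (r + k), 0 := drop r (\<sigma> 0),
    1 := rev (take r (\<sigma> 0)) @ \<sigma> 1, 7 := drop r (\<sigma> 7), 8 := rev (take r (\<sigma> 7)) @ \<sigma> 8,
    13 := rev (concat (map (\<lambda>i. zi Mid (first_sym (drop i (\<sigma> 0))) (i < length (\<sigma> 7))) [0..<r])) @ \<sigma> 13)"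
  using assms
proof (induction r arbitrary: \<sigma> k)
  case 0
  then show ?case unfolding cols_loop_def by (subst den_Loop) (simp add: fun_eq_iff)
next
  case (Suc r)
  define \<sigma>' where "\<sigma>' = \<sigma>(5 := unary r, 6 := unary (Suc k), 0 := tl (\<sigma> 0), 1 := rev (take 1 (\<sigma> 0)) @ \<sigma> 1,
    7 := tl (\<sigma> 7), 8 := rev (take 1 (\<sigma> 7)) @ \<sigma> 8,
    13 := rev (zi Mid (first_sym (\<sigma> 0)) (\<sigma> 7 \<noteq> [])) @ \<sigma> 13)"
  have body: "den (col_prog Mid ;; Pop 5 ;; Push 6 True) \<sigma> = \<sigma>'"
    using Suc.prems by (simp add: den_col_prog \<sigma>'_def fun_eq_iff)
  have "den cols_loop \<sigma> = den cols_loop \<sigma>'"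
    unfolding cols_loop_def by (subst den_Loop) (use Suc.prems(1) in \<open>simp only: body, simp\<close>)
  also have "\<dots> = \<sigma>'(5 := [], 6 := unary (r + Suc k), 0 := drop r (\<sigma>' 0),
    1 := rev (take r (\<sigma>' 0)) @ \<sigma>' 1, 7 := drop r (\<sigma>' 7), 8 := rev (take r (\<sigma>' 7)) @ \<sigma>' 8,
    13 := rev (concat (map (\<lambda>i. zi Mid (first_sym (drop i (\<sigma>' 0))) (i < length (\<sigma>' 7))) [0..<r])) @ \<sigma>' 13)"
    by (rule Suc.IH) (simp_all add: \<sigma>'_def)
  also have "\<dots> = \<sigma>(5 := [], 6 := unary (Suc r + k), 0 := drop (Suc r) (\<sigma> 0),
    1 := rev (take (Suc r) (\<sigma> 0)) @ \<sigma> 1, 7 := drop (Suc r) (\<sigma> 7), 8 := rev (take (Suc r) (\<sigma> 7)) @ \<sigma> 8,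
    13 := rev (concat (map (\<lambda>i. zi Mid (first_sym (drop i (\<sigma> 0))) (i < length (\<sigma> 7))) [0..<Suc r])) @ \<sigma> 13)"
    unfolding upt_0_Suc take_Suc_tl \<sigma>'_def
    by (rule ext) (simp add: drop_Suc comp_def less_diff_conv del: take_Suc_Cons)
  finally show ?case .
qed

text \<open>The columns in the order of the strip: left end, \<open>P\<close> blank cells, the
  origin, \<open>P\<close> cells to its right and the right end. The traversed registers are
  restored because the pattern is written twice.\<close>

definition row_prog :: prog where
  "row_prog = emit 13 z0 ;; repeat 5 3 13 (zi Mid 0 False) ;; col_prog Orig ;; cols_loop ;;
     move 6 5 ;; emit 13 (zi Last 0 False) ;; move 1 0 ;; move 8 7"

text \<open>Register 11 holds the width minus 2, so one more \<open>wL\<close> completes the blocks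
  after block \<open>N\<close>, of which there are one fewer than the width.\<close>

definition border_prog :: prog where
  "border_prog = row_prog ;; repeat 12 3 13 wO ;; emit 13 wN ;; repeat 11 3 13 wL ;; emit 13 wL"

text \<open>On the helix a tile at cell \<open>s\<close> meets only the blocks \<open>s\<close>,
  \<open>s + 1\<close> and \<open>s + width\<close>; the rest are runs of empty blocks. Their
  lengths are \<open>s\<close>, \<open>width - 2\<close> and the number of cells after
  \<open>s\<close>.\<close>

definition tile_prog :: "(hcol, vcol) tile \<Rightarrow> prog" where
  "tile_prog T = repeat 9 3 13 wO ;; emit 13 (wE T @ wX T) ;; repeat 11 3 13 wO ;; emit 13 (wD T) ;;
     repeat 10 3 13 wO"

primrec tiles_prog :: "(hcol, vcol) tile list \<Rightarrow> prog" where
  "tiles_prog [] = Skip"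
| "tiles_prog (T # Us) = emit 13 and_word ;; tile_prog T ;; tile_prog T ;; emit 13 var_word ;; tiles_prog Us"

definition main_loop :: prog where
  "main_loop = Loop 10 (- {None}) (Pop 10 ;; tiles_prog Ts ;; Push 9 True)"

text \<open>After the main loop register 9 holds the number \<open>N\<close> of all cells. Adding
  \<open>width - 2\<close> and 2 gives one block of boxes for each of the \<open>N + width\<close>
  blocks of slots.\<close>

definition boxes_prog :: prog where
  "boxes_prog = repeat 9 3 13 wO ;; repeat 11 3 13 wO ;; emit 13 (wO @ wO)"

definition ready :: "word \<Rightarrow> nat \<Rightarrow> nat \<Rightarrow> nat \<Rightarrow> nat \<Rightarrow> nat \<Rightarrow> nat \<Rightarrow> store \<Rightarrow> bool" where
  "ready x P g a b W Z \<sigma> \<longleftrightarrow> \<sigma> 0 = x \<and> \<sigma> 1 = [] \<and> \<sigma> 3 = [] \<and> \<sigma> 5 = unary P \<and> \<sigma> 6 = [] \<and> \<sigma> 7 = unary g \<and>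
     \<sigma> 8 = [] \<and> \<sigma> 9 = unary a \<and> \<sigma> 10 = unary b \<and> \<sigma> 11 = unary W \<and> \<sigma> 12 = unary Z"

lemma ready_output [simp]: "ready x P g a b W Z (\<sigma>(13 := v)) = ready x P g a b W Z \<sigma>"
  by (simp add: ready_def)

definition row_word :: "word \<Rightarrow> nat \<Rightarrow> nat \<Rightarrow> word" where
  "row_word x P g = z0 @ cat P (zi Mid 0 False) @ zi Orig (first_sym x) (0 < g) @
     concat (map (\<lambda>i. zi Mid (first_sym (drop (Suc i) x)) (Suc i < g)) [0..<P]) @ zi Last 0 False"

lemma den_row_prog:
  assumes "ready x P g a b W Z \<sigma>"
  shows "den row_prog \<sigma> = \<sigma>(13 := rev (row_word x P g) @ \<sigma> 13)"
proof -
  have r: "\<sigma> 0 = x" "\<sigma> 1 = []" "\<sigma> 3 = []" "\<sigma> 5 = unary P" "\<sigma> 6 = []" "\<sigma> 7 = unary g" "\<sigma> 8 = []"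
    using assms by (simp_all add: ready_def)
  note r2 = r(2) [unfolded One_nat_def]
  have ug: "unary g \<noteq> [] \<longleftrightarrow> 0 < g" "length (tl (unary g)) = g - 1" by (cases g; simp)+
  have 1: "den (repeat 5 3 13 (zi Mid 0 False)) (\<sigma>(13 := v)) = \<sigma>(13 := rev (cat P (zi Mid 0 False)) @ v)" for v
    by (subst den_repeat [where m = P]) (simp_all add: r)
  have 2: "den (col_prog Orig) (\<sigma>(13 := v)) = \<sigma>(0 := tl x, 1 := rev (take 1 x), 7 := tl (unary g),
     8 := rev (take 1 (unary g)), 13 := rev (zi Orig (first_sym x) (0 < g)) @ v)" for v
    unfolding den_col_prog by (simp add: r r2 ug fun_eq_iff)
  have 3: "den cols_loop (\<sigma>(0 := tl x, 1 := rev (take 1 x), 7 := tl (unary g), 8 := rev (take 1 (unary g)), 13 := v)) =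
    \<sigma>(5 := [], 6 := unary P, 0 := drop P (tl x), 1 := rev (take P (tl x)) @ rev (take 1 x), 7 := drop P (tl (unary g)),
      8 := rev (take P (tl (unary g))) @ rev (take 1 (unary g)),
      13 := rev (concat (map (\<lambda>i. zi Mid (first_sym (drop (Suc i) x)) (Suc i < g)) [0..<P])) @ v)" for v
    by (subst den_cols_loop [where r = P and k = 0]) (simp_all add: r r2 ug fun_eq_iff drop_Suc less_diff_conv)
  have tk: "take 1 w @ take P (tl w) @ drop P (tl w) = w" for w :: word
    by (cases w) simp_all
  have tk1: "take (Suc 0) w @ tl w = w" for w :: word
    by (cases w) simp_all
  show ?thesis
    unfolding row_prog_def den.simps(4) den_emit fun_upd_same fun_upd_upd 1 2 3
    by (simp add: den_move row_word_def fun_eq_iff r r2 tk tk1)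
qed

definition border_word :: "word \<Rightarrow> nat \<Rightarrow> nat \<Rightarrow> nat \<Rightarrow> nat \<Rightarrow> word" where
  "border_word x P g W Z = row_word x P g @ cat Z wO @ wN @ cat (Suc W) wL"

lemma den_repeat_ready:
  assumes "ready x P g a b W Z \<sigma>"
  shows "den (repeat 9 3 13 w) \<sigma> = \<sigma>(13 := rev (cat a w) @ \<sigma> 13)"
    "den (repeat 10 3 13 w) \<sigma> = \<sigma>(13 := rev (cat b w) @ \<sigma> 13)"
    "den (repeat 11 3 13 w) \<sigma> = \<sigma>(13 := rev (cat W w) @ \<sigma> 13)"
    "den (repeat 12 3 13 w) \<sigma> = \<sigma>(13 := rev (cat Z w) @ \<sigma> 13)"
  using assms by (simp_all add: ready_def den_repeat)

lemma cat_Suc_right: "cat (Suc n) w = cat n w @ w"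
  using cat_add [of n 1 w] by (simp add: cat_def)

lemma den_border_prog:
  assumes "ready x P g a b W Z \<sigma>"
  shows "den border_prog \<sigma> = \<sigma>(13 := rev (border_word x P g W Z) @ \<sigma> 13)"
proof -
  have r: "ready x P g a b W Z (\<sigma>(13 := v))" for v using assms by simp
  show ?thesis
    by (simp add: border_prog_def den_row_prog [OF assms] den_repeat_ready [OF r] border_word_def
        cat_Suc_right del: cat_simps(2))
qed

definition tile_word :: "nat \<Rightarrow> nat \<Rightarrow> nat \<Rightarrow> (hcol, vcol) tile \<Rightarrow> word" where
  "tile_word W a b T = cat a wO @ wE T @ wX T @ cat W wO @ wD T @ cat b wO"

lemma den_tile_prog:
  assumes "ready x P g a b W Z \<sigma>"
  shows "den (tile_prog T) \<sigma> = \<sigma>(13 := rev (tile_word W a b T) @ \<sigma> 13)"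
proof -
  have r: "ready x P g a b W Z (\<sigma>(13 := v))" for v using assms by simp
  show ?thesis
    by (simp add: tile_prog_def den_repeat_ready [OF assms] den_repeat_ready [OF r] tile_word_def)
qed

definition tiles_word :: "nat \<Rightarrow> nat \<Rightarrow> nat \<Rightarrow> (hcol, vcol) tile list \<Rightarrow> word" where
  "tiles_word W a b Us =
     concat (map (\<lambda>T. and_word @ tile_word W a b T @ tile_word W a b T @ var_word) Us)"

lemma den_tiles_prog:
  "ready x P g a b W Z \<sigma> \<Longrightarrow> den (tiles_prog Us) \<sigma> = \<sigma>(13 := rev (tiles_word W a b Us) @ \<sigma> 13)"
proof (induction Us arbitrary: \<sigma>)
  case Nil
  then show ?case by (simp add: tiles_word_def)
next
  case (Cons T Us)
  have r: "ready x P g a b W Z (\<sigma>(13 := v))" for v using Cons.prems by simp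
  show ?case
    by (simp add: tiles_word_def den_tile_prog [OF r] Cons.IH [OF r] fun_eq_iff)
qed

lemma den_main_body:
  assumes "ready x P g a (Suc b) W Z \<sigma>"
  shows "den (Pop 10 ;; tiles_prog Ts ;; Push 9 True) \<sigma> =
    \<sigma>(9 := unary (Suc a), 10 := unary b, 13 := rev (tiles_word W a b Ts) @ \<sigma> 13)"
proof -
  have "den (Pop 10) \<sigma> = \<sigma>(10 := unary b)" using assms by (simp add: ready_def)
  moreover have r: "ready x P g a b W Z (\<sigma>(10 := unary b))" using assms by (simp add: ready_def)
  ultimately show ?thesis
    unfolding den.simps(4) using assms by (simp add: den_tiles_prog [OF r] ready_def fun_eq_iff)
qed

lemma den_main_loop:
  "ready x P g a b W Z \<sigma> \<Longrightarrow> den main_loop \<sigma> = \<sigma>(9 := unary (a + b), 10 := [],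
     13 := rev (concat (map (\<lambda>s. tiles_word W s (a + b - Suc s) Ts) [a..<a + b])) @ \<sigma> 13)"
proof (induction b arbitrary: a \<sigma>)
  case 0
  then show ?case unfolding main_loop_def by (subst den_Loop) (simp add: ready_def fun_eq_iff)
next
  case (Suc b)
  let ?\<sigma> = "\<sigma>(9 := unary (Suc a), 10 := unary b, 13 := rev (tiles_word W a b Ts) @ \<sigma> 13)"
  have "peek (\<sigma> 10) \<in> - {None}" using Suc.prems by (simp add: ready_def)
  then have "den main_loop \<sigma> = den main_loop ?\<sigma>"
    unfolding main_loop_def by (subst den_Loop) (simp only: den_main_body [OF Suc.prems] if_True)
  also have "\<dots> = ?\<sigma>(9 := unary (Suc a + b), 10 := [],
     13 := rev (concat (map (\<lambda>s. tiles_word W s (Suc a + b - Suc s) Ts) [Suc a..<Suc a + b])) @ ?\<sigma> 13)"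
    by (rule Suc.IH) (use Suc.prems in \<open>simp add: ready_def\<close>)
  also have "\<dots> = \<sigma>(9 := unary (a + Suc b), 10 := [],
     13 := rev (concat (map (\<lambda>s. tiles_word W s (a + Suc b - Suc s) Ts) [a..<a + Suc b])) @ \<sigma> 13)"
    by (simp add: upt_conv_Cons fun_eq_iff del: upt_Suc)
  finally show ?case .
qed

section \<open>Running time of the program that writes the formula\<close>

lemma polytime_on_emit: "polytime_on R D (emit r w)"
  by (rule polytime_on_loop_free) simp

lemma polytime_on_col_prog: "polytime_on R D (col_prog m)"
  by (rule polytime_on_loop_free) simp

lemma polytime_on_tiles_prog: "polytime_on {3, 9, 10, 11} D (tiles_prog Us)"
proof (rule polytime_on_True, induction Us)
  case Nil
  show ?case by (simp add: polytime_on_Skip)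
next
  case (Cons T Us)
  have r: "polytime_on {3, 9, 10, 11} D (repeat i 3 13 w)" if "i \<in> {9, 10, 11}" for i w D
    by (rule polytime_on_weaken [OF polytime_on_repeat]) (use that in auto)
  have "polytime_on {3, 9, 10, 11} (\<lambda>_. True) (tile_prog T)"
    unfolding tile_prog_def
    by (intro polytime_on_Seq [where D' = "\<lambda>_. True"] r polytime_on_emit) simp_all
  then show ?case unfolding tiles_prog.simps
    by (intro polytime_on_Seq [where D' = "\<lambda>_. True"] Cons.IH polytime_on_emit) simp_all
qed

lemma polytime_on_main_loop:
  "polytime_on {3, 9, 10, 11} (\<lambda>\<sigma>. \<exists>x P g a b W Z. ready x P g a b W Z \<sigma>) main_loop"
  unfolding main_loop_def
\<comment> \<open>As in \<open>polytime_on_repeat\<close>, one counter is drained into another, here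
  10 into 9.\<close>
proof (rule polytime_on_Loop [where \<Phi> = "\<lambda>\<sigma>. 2 * length (\<sigma> 10) + length (\<sigma> 9)" and b = "\<lambda>n. 2 * n + n"])
  let ?D = "\<lambda>\<sigma>. \<exists>x P g a b W Z. ready x P g a b W Z \<sigma>"
  let ?B = "Pop 10 ;; tiles_prog Ts ;; Push 9 True"
  show "polytime_on {3, 9, 10, 11} ?D ?B"
    by (intro polytime_on_Seq [where D' = "\<lambda>_. True"] polytime_on_tiles_prog polytime_on_Pop polytime_on_Push) simp_all
  fix \<sigma> :: store and i
  assume "?D \<sigma>" and p: "peek (\<sigma> 10) \<in> - {None}"
  then obtain x P g a b W Z where r: "ready x P g a b W Z \<sigma>" by blast
  then obtain c where c: "b = Suc c" using p by (cases b) (auto simp: ready_def)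
  note eq = den_main_body [OF r [unfolded c]]
  have s: "\<sigma> 9 = unary a" "\<sigma> 10 = unary (Suc c)" using r c by (simp_all add: ready_def)
  have "ready x P g (Suc a) c W Z (den ?B \<sigma>)" unfolding eq using r by (simp add: ready_def)
  then have 1: "?D (den ?B \<sigma>)" by blast
  have "2 * length (den ?B \<sigma> 10) + length (den ?B \<sigma> 9) < 2 * length (\<sigma> 10) + length (\<sigma> 9)"
    unfolding eq using s by auto
  with 1 show "?D (den ?B \<sigma>) \<and> 2 * length (den ?B \<sigma> 10) + length (den ?B \<sigma> 9) < 2 * length (\<sigma> 10) + length (\<sigma> 9)" ..
  show "i \<in> {3, 9, 10, 11} \<Longrightarrow> length (den ?B \<sigma> i) \<le> max (length (\<sigma> i)) (2 * length (\<sigma> 10) + length (\<sigma> 9))"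
    unfolding eq using s by auto
qed (auto intro!: poly_bounded_add poly_bounded_mult poly_bounded_const poly_bounded_id)

lemma polytime_on_border_prog: "polytime_on UNIV D border_prog"
proof (rule polytime_on_True)
  have r: "polytime_on UNIV D (repeat i 3 13 w)" if "i \<in> {5, 11, 12}" for i w D
    by (rule polytime_on_weaken [OF polytime_on_repeat]) (use that in auto)
  have m: "polytime_on UNIV D (move i j)" if "i \<noteq> j" for i j D
    by (rule polytime_on_weaken [OF polytime_on_move]) (use that in auto)
  have l: "polytime_on UNIV D cols_loop" for D
  proof (rule polytime_on_True, rule polytime_on_weaken [where R = "{5}"], unfold cols_loop_def,
      rule polytime_on_Loop [where \<Phi> = "\<lambda>\<sigma>. length (\<sigma> 5)" and b = "\<lambda>n. n"])
    fix \<sigma> :: store and i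
    assume "peek (\<sigma> 5) \<in> - {None}"
    then obtain v w where "\<sigma> 5 = v # w" by (cases "\<sigma> 5") auto
    then show "True \<and> length (den (col_prog Mid ;; Pop 5 ;; Push 6 True) \<sigma> 5) < length (\<sigma> 5)"
      and "i \<in> {5} \<Longrightarrow> length (den (col_prog Mid ;; Pop 5 ;; Push 6 True) \<sigma> i) \<le> max (length (\<sigma> i)) (length (\<sigma> 5))"
      by (simp_all add: den_col_prog)
  qed (simp_all add: polytime_on_loop_free poly_bounded_id)
  show "polytime_on UNIV (\<lambda>_. True) border_prog"
    unfolding border_prog_def row_prog_def
    by (intro polytime_on_Seq [where D' = "\<lambda>_. True"] r m l polytime_on_emit polytime_on_col_prog) simp_all
qed

lemma polytime_on_boxes_prog: "polytime_on UNIV D boxes_prog"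
proof (rule polytime_on_True)
  have r: "polytime_on UNIV D (repeat i 3 13 w)" if "i \<in> {9, 11}" for i w D
    by (rule polytime_on_weaken [OF polytime_on_repeat]) (use that in auto)
  show "polytime_on UNIV (\<lambda>_. True) boxes_prog"
    unfolding boxes_prog_def
    by (intro polytime_on_Seq [where D' = "\<lambda>_. True"] r polytime_on_emit) simp_all
qed

definition write_prog :: prog where
  "write_prog = emit 13 and_word ;; border_prog ;; border_prog ;; emit 13 var_word ;; main_loop ;;
     boxes_prog ;; boxes_prog ;; emit 13 wF ;; move 13 14"

definition reduction_word :: "word \<Rightarrow> nat \<Rightarrow> nat \<Rightarrow> nat \<Rightarrow> nat \<Rightarrow> nat \<Rightarrow> word" where
  "reduction_word x P g N W Z = and_word @ border_word x P g W Z @ border_word x P g W Z @ var_word @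
     concat (map (\<lambda>s. tiles_word W s (N - Suc s) Ts) [0..<N]) @
     cat (N + W + 2) wO @ cat (N + W + 2) wO @ wF"

lemma den_boxes_prog:
  assumes "ready x P g a b W Z \<sigma>"
  shows "den boxes_prog \<sigma> = \<sigma>(13 := rev (cat (a + W + 2) wO) @ \<sigma> 13)"
proof -
  have r: "ready x P g a b W Z (\<sigma>(13 := v))" for v using assms by simp
  have "cat (a + W + 2) wO = cat a wO @ cat W wO @ wO @ wO"
    by (simp only: cat_add numeral_2_eq_2 cat_simps append_Nil2 append_assoc)
  then show ?thesis
    by (simp add: boxes_prog_def den_repeat_ready [OF assms] den_repeat_ready [OF r])
qed

lemma den_write_prog:
  assumes r: "ready x P g 0 N W Z \<sigma>" and "\<sigma> 13 = []" "\<sigma> 14 = []"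
  shows "den write_prog \<sigma> 14 = reduction_word x P g N W Z"
proof -
  have r0: "ready x P g 0 N W Z (\<sigma>(13 := v))" for v using r by simp
  have r1: "ready x P g N 0 W Z (\<sigma>(9 := unary N, 10 := [], 13 := v))" for v
    using r by (simp add: ready_def)
  show ?thesis
    using assms(2,3)
    by (simp add: write_prog_def den_border_prog [OF r0] den_main_loop [OF r0] den_boxes_prog [OF r1]
        den_move reduction_word_def del: cat_simps(2) add_2_eq_Suc')
qed

lemma polytime_on_write_prog:
  "polytime_on UNIV (\<lambda>\<sigma>. \<exists>x P g N W Z. ready x P g 0 N W Z \<sigma>) write_prog"
proof -
  let ?D = "\<lambda>\<sigma>. \<exists>x P g N W Z. ready x P g 0 N W Z \<sigma>"
  have ml: "polytime_on UNIV ?D main_loop"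
    by (rule polytime_on_weaken [OF polytime_on_main_loop]) blast+
  have m: "polytime_on UNIV D (move 13 14)" for D
    by (rule polytime_on_weaken [OF polytime_on_move]) auto
  have tl: "polytime_on UNIV ?D (main_loop ;; boxes_prog ;; boxes_prog ;; emit 13 wF ;; move 13 14)"
    by (intro polytime_on_Seq [OF ml] polytime_on_Seq [where D' = "\<lambda>_. True"]
        polytime_on_boxes_prog m polytime_on_emit) simp_all
  have e: "?D (den (emit 13 w) \<sigma>)" "?D (den border_prog \<sigma>)" if "?D \<sigma>" for \<sigma> w
  proof -
    obtain x P g N W Z where r: "ready x P g 0 N W Z \<sigma>" using \<open>?D \<sigma>\<close> by blast
    then have "ready x P g 0 N W Z (den (emit 13 w) \<sigma>)" "ready x P g 0 N W Z (den border_prog \<sigma>)"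
      by (simp_all add: den_border_prog [OF r])
    then show "?D (den (emit 13 w) \<sigma>)" "?D (den border_prog \<sigma>)" by blast+
  qed
  have b: "polytime_on UNIV ?D border_prog" by (rule polytime_on_border_prog)
  have em: "polytime_on UNIV ?D (emit 13 w)" for w by (rule polytime_on_loop_free) simp
  show ?thesis unfolding write_prog_def
    by (rule polytime_on_Seq [OF em polytime_on_Seq [OF b polytime_on_Seq [OF b
          polytime_on_Seq [OF em tl e(1)] e(2)] e(2)] e(1)])
qed

definition setup_prog :: "nat poly \<Rightarrow> nat poly \<Rightarrow> nat poly \<Rightarrow> nat poly \<Rightarrow> nat poly \<Rightarrow> prog" where
  "setup_prog pP pG pN pW pZ = measure_loop 0 1 2 ;; move 1 0 ;; horner 5 2 3 4 (coeffs pP) ;;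
     horner 7 2 3 4 (coeffs pG) ;; horner 10 2 3 4 (coeffs pN) ;; horner 11 2 3 4 (coeffs pW) ;;
     horner 12 2 3 4 (coeffs pZ)"

definition reduction_prog :: "nat poly \<Rightarrow> nat poly \<Rightarrow> nat poly \<Rightarrow> nat poly \<Rightarrow> nat poly \<Rightarrow> prog" where
  "reduction_prog pP pG pN pW pZ = setup_prog pP pG pN pW pZ ;; write_prog"

lemma den_horner_coeffs:
  assumes "distinct [d, n, s, t]" "horner_ok d n s t \<sigma>" "\<sigma> n = unary m"
  shows "den (horner d n s t (coeffs p)) \<sigma> = \<sigma>(d := unary (poly p m))"
  using assms by (subst den_horner [where m = m]) (simp_all add: horner_ok_def)

definition inputs :: "word \<Rightarrow> store" where
  "inputs x = (\<lambda>_. [])(0 := x, 2 := unary (length x))"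

lemma setup_steps:
  "den (measure_loop 0 1 2 ;; move 1 0) (initial [x]) = inputs x"
  "i \<in> {5, 7, 10, 11, 12} \<Longrightarrow> \<sigma> i = [] \<Longrightarrow> \<sigma> 2 = unary (length x) \<Longrightarrow> \<sigma> 3 = [] \<Longrightarrow> \<sigma> 4 = [] \<Longrightarrow>
     horner_ok i 2 3 4 \<sigma> \<and> den (horner i 2 3 4 (coeffs p)) \<sigma> = \<sigma>(i := unary (poly p (length x)))"
proof -
  have "den (measure_loop 0 1 2) (initial [x]) = (initial [x])(0 := [], 1 := rev x, 2 := unary (length x))"
    by (subst den_measure_loop [where k = 0]) (simp_all add: initial_def fun_eq_iff)
  then show "den (measure_loop 0 1 2 ;; move 1 0) (initial [x]) = inputs x"
    by (simp add: den_move inputs_def initial_def fun_eq_iff)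
next
  assume a: "i \<in> {5, 7, 10, 11, 12}" "\<sigma> i = []" "\<sigma> 2 = unary (length x)" "\<sigma> 3 = []" "\<sigma> 4 = []"
  then have ok: "horner_ok i 2 3 4 \<sigma>" by (auto simp: horner_ok_def)
  moreover have "distinct [i, 2, 3, 4]" using a(1) by auto
  ultimately show "horner_ok i 2 3 4 \<sigma> \<and> den (horner i 2 3 4 (coeffs p)) \<sigma> = \<sigma>(i := unary (poly p (length x)))"
    using den_horner_coeffs [of i 2 3 4 \<sigma>] a(3) by simp
qed

lemma polytime_on_reduction_prog:
  "polytime_on UNIV (\<lambda>\<sigma>. \<exists>x. \<sigma> = initial [x]) (reduction_prog pP pG pN pW pZ)"
  and den_reduction_prog:
  "den (reduction_prog pP pG pN pW pZ) (initial [x]) 14 =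
     reduction_word x (poly pP (length x)) (poly pG (length x)) (poly pN (length x)) (poly pW (length x))
       (poly pZ (length x))"
proof -
  define s1 where "s1 x = (inputs x)(5 := unary (poly pP (length x)))" for x
  define s2 where "s2 x = (s1 x)(7 := unary (poly pG (length x)))" for x
  define s3 where "s3 x = (s2 x)(10 := unary (poly pN (length x)))" for x
  define s4 where "s4 x = (s3 x)(11 := unary (poly pW (length x)))" for x
  define s5 where "s5 x = (s4 x)(12 := unary (poly pZ (length x)))" for x
  note ss = s1_def s2_def s3_def s4_def s5_def inputs_def
  have h: "horner_ok 5 2 3 4 (inputs x) \<and> den (horner 5 2 3 4 (coeffs pP)) (inputs x) = s1 x"
    "horner_ok 7 2 3 4 (s1 x) \<and> den (horner 7 2 3 4 (coeffs pG)) (s1 x) = s2 x"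
    "horner_ok 10 2 3 4 (s2 x) \<and> den (horner 10 2 3 4 (coeffs pN)) (s2 x) = s3 x"
    "horner_ok 11 2 3 4 (s3 x) \<and> den (horner 11 2 3 4 (coeffs pW)) (s3 x) = s4 x"
    "horner_ok 12 2 3 4 (s4 x) \<and> den (horner 12 2 3 4 (coeffs pZ)) (s4 x) = s5 x" for x
    unfolding s1_def [of x] s2_def [of x] s3_def [of x] s4_def [of x] s5_def [of x]
    by (rule setup_steps(2); simp add: inputs_def)+
  have ready: "ready x (poly pP (length x)) (poly pG (length x)) 0 (poly pN (length x)) (poly pW (length x))
      (poly pZ (length x)) (s5 x)" "s5 x 13 = []" "s5 x 14 = []" for x
    by (simp_all add: ss ready_def)
  have den: "den (setup_prog pP pG pN pW pZ) (initial [x]) = s5 x" for x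
    using setup_steps(1) [of x] h [of x] unfolding setup_prog_def by simp
  show "den (reduction_prog pP pG pN pW pZ) (initial [x]) 14 =
     reduction_word x (poly pP (length x)) (poly pG (length x)) (poly pN (length x)) (poly pW (length x))
       (poly pZ (length x))"
    unfolding reduction_prog_def den.simps(4) den by (rule den_write_prog [OF ready])
  have hp: "polytime_on UNIV (\<lambda>\<sigma>. \<exists>x. \<sigma> = s x) (horner i 2 3 4 (coeffs p))"
    if "\<And>x. horner_ok i 2 3 4 (s x)" "i \<in> {5, 7, 10, 11, 12}" for i s p
    by (rule polytime_on_weaken [OF polytime_on_horner]) (use that in auto)
  have p0: "polytime_on UNIV (\<lambda>\<sigma>. \<exists>x. \<sigma> = initial [x]) (measure_loop 0 1 2)"
    by (rule polytime_on_weaken [OF polytime_on_measure_loop]) auto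
  have p1: "polytime_on UNIV (\<lambda>\<sigma>. \<exists>x. \<sigma> = den (measure_loop 0 1 2) (initial [x])) (move 1 0)"
    by (rule polytime_on_weaken [OF polytime_on_move]) auto
  have in1: "den (move 1 0) (den (measure_loop 0 1 2) (initial [x])) = inputs x" for x
    using setup_steps(1) by simp
  have p5: "polytime_on UNIV (\<lambda>\<sigma>. \<exists>x. \<sigma> = s4 x) (horner 12 2 3 4 (coeffs pZ))"
    by (rule hp) (use h in simp_all)
  have p4: "polytime_on UNIV (\<lambda>\<sigma>. \<exists>x. \<sigma> = s3 x) (horner 11 2 3 4 (coeffs pW) ;; horner 12 2 3 4 (coeffs pZ))"
    by (rule polytime_on_Seq [OF hp p5]) (use h in auto)
  have p3: "polytime_on UNIV (\<lambda>\<sigma>. \<exists>x. \<sigma> = s2 x)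
      (horner 10 2 3 4 (coeffs pN) ;; horner 11 2 3 4 (coeffs pW) ;; horner 12 2 3 4 (coeffs pZ))"
    by (rule polytime_on_Seq [OF hp p4]) (use h in auto)
  have p2: "polytime_on UNIV (\<lambda>\<sigma>. \<exists>x. \<sigma> = s1 x) (horner 7 2 3 4 (coeffs pG) ;;
      horner 10 2 3 4 (coeffs pN) ;; horner 11 2 3 4 (coeffs pW) ;; horner 12 2 3 4 (coeffs pZ))"
    by (rule polytime_on_Seq [OF hp p3]) (use h in auto)
  have p: "polytime_on UNIV (\<lambda>\<sigma>. \<exists>x. \<sigma> = inputs x) (horner 5 2 3 4 (coeffs pP) ;; horner 7 2 3 4 (coeffs pG) ;;
      horner 10 2 3 4 (coeffs pN) ;; horner 11 2 3 4 (coeffs pW) ;; horner 12 2 3 4 (coeffs pZ))"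
    by (rule polytime_on_Seq [OF hp p2]) (use h in auto)
  have "polytime_on UNIV (\<lambda>\<sigma>. \<exists>x. \<sigma> = initial [x]) (setup_prog pP pG pN pW pZ)"
    unfolding setup_prog_def
    by (rule polytime_on_Seq [OF p0 polytime_on_Seq [OF p1 p]]) (use in1 in auto)
  then show "polytime_on UNIV (\<lambda>\<sigma>. \<exists>x. \<sigma> = initial [x]) (reduction_prog pP pG pN pW pZ)"
    unfolding reduction_prog_def
  proof (rule polytime_on_Seq [OF _ polytime_on_write_prog])
    fix \<sigma> assume "\<exists>x. \<sigma> = initial [x]"
    then obtain x where "\<sigma> = initial [x]" by blast
    then have "den (setup_prog pP pG pN pW pZ) \<sigma> = s5 x" using den by simp
    with ready(1) [of x] show "\<exists>x P g N W Z. ready x P g 0 N W Z (den (setup_prog pP pG pN pW pZ) \<sigma>)"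
      by metis
  qed
qed

end

section \<open>coNP-hardness\<close>

definition dia_box_word :: "bool \<Rightarrow> word" where
  "dia_box_word b = (if b then [False, True, True, False] else [False, True, False, True])"

lemma encode_chain: "encode (chain bs) = concat (map dia_box_word bs) @ var_word"
  by (induction bs) (auto simp: dia_box_word_def var_word_def encode_nat.simps)

lemma encode_boxes: "encode ((Box ^^ m) F) = cat m (dia_box_word False) @ encode F"
  by (induction m) (auto simp: dia_box_word_def)

lemma encode_chains_fm:
  "encode (chains_fm bs m F) =
     concat (map (\<lambda>b. and_word @ encode (chain b)) bs) @ cat m (dia_box_word False) @ encode F"
  unfolding chains_fm_def by (induction bs) (auto simp: and_word_def encode_boxes)

lemma cat_mult: "cat (m * n) w = cat m (cat n w)"
  by (induction m) (simp_all add: cat_add)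

lemma concat_map_const:
  assumes "\<And>b. i \<le> b \<Longrightarrow> b < j \<Longrightarrow> f b = w"
  shows "concat (map f [i..<j]) = cat (j - i) w"
proof -
  have "map f [i..<j] = map (\<lambda>_. w) [i..<j]" using assms by (intro map_cong) auto
  then show ?thesis by (simp add: cat_def map_replicate_const)
qed

lemma concat_map_split: "i \<le> j \<Longrightarrow> j \<le> k \<Longrightarrow>
    concat (map f [i..<k]) = concat (map f [i..<j]) @ concat (map f [j..<k])"
  by (metis concat_append le_iff_add map_append upt_add_eq_append)

lemma concat_map_first: "i < k \<Longrightarrow> concat (map f [i..<k]) = f i @ concat (map f [Suc i..<k])"
  by (simp add: upt_conv_Cons)

lemma first_sym_drop: "first_sym (drop i x) = (if i < length x then bit_sym (x ! i) else 0)"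
proof (cases "i < length x")
  case True
  then have "drop i x = x ! i # drop (Suc i) x" by (simp add: Cons_nth_drop_Suc)
  with True show ?thesis by (simp add: first_sym_def)
qed (simp add: first_sym_def)

context
  fixes hs :: "hcol list" and vs :: "vcol list"
begin

definition slot_list :: "(hcol, vcol) slot list" where
  "slot_list = CellSlot # map HSlot hs @ map VSlot vs"

definition slot_word :: "((hcol, vcol) slot \<Rightarrow> bool) \<Rightarrow> word" where
  "slot_word f = concat (map (\<lambda>sl. dia_box_word (f sl)) slot_list)"

abbreviation word_of :: "bool \<Rightarrow> (hcol \<Rightarrow> bool) \<Rightarrow> (vcol \<Rightarrow> bool) \<Rightarrow> word" where
  "word_of c f g \<equiv> slot_word (case_slot c f g)"

lemma concat_product_word:
  "concat (map dia_box_word (map \<theta> (List.product bs slot_list))) =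
     concat (map (\<lambda>b. slot_word (\<lambda>sl. \<theta> (b, sl))) bs)"
  by (induction bs) (simp_all add: slot_word_def comp_def)

abbreviation "empty_w \<equiv> slot_word (\<lambda>_. False)"
abbreviation "first_w \<equiv> word_of False (\<lambda>h. h \<noteq> Border) (\<lambda>v. v \<noteq> Ini First 0 False)"
abbreviation "ini_w \<equiv> \<lambda>m a g. word_of False (\<lambda>_. False) (\<lambda>v. v \<noteq> Ini m a g)"
abbreviation "end_w \<equiv> word_of True (\<lambda>h. h = Border) (\<lambda>v. v = Fin)"
abbreviation "last_w \<equiv> word_of True (\<lambda>_. True) (\<lambda>v. v = Fin)"
abbreviation "own_w \<equiv> \<lambda>T. word_of True (\<lambda>h. h = lf T) (\<lambda>v. v = up T)"
abbreviation "right_w \<equiv> \<lambda>T. word_of False (\<lambda>h. h \<noteq> rt T) (\<lambda>_. False)"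
abbreviation "down_w \<equiv> \<lambda>T. word_of False (\<lambda>_. False) (\<lambda>v. v \<noteq> dn T)"

lemma empty_w: "empty_w = cat (length slot_list) (dia_box_word False)"
  by (simp add: slot_word_def cat_def map_replicate_const)

text \<open>\<open>2 \<le> W\<close> keeps the three blocks touched by the tile distinct and in this
  order.\<close>

lemma tile_blocks:
  assumes "s < N" "2 \<le> W"
  shows "concat (map (\<lambda>b. slot_word (\<lambda>sl. covers W N bd ini fin (Some (s, T)) (b, sl))) [0..<N + W]) =
    tile_word empty_w own_w right_w down_w (W - 2) s (N - Suc s) T"
proof -
  let ?f = "\<lambda>b. slot_word (\<lambda>sl. covers W N bd ini fin (Some (s, T)) (b, sl))"
  have e: "?f b = empty_w" if "b \<noteq> s" "b \<noteq> s + 1" "b \<noteq> s + W" for b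
    by (rule arg_cong [where f = slot_word], rule ext, rename_tac sl, case_tac sl) (use that in auto)
  have o: "?f s = own_w T"
    by (rule arg_cong [where f = slot_word], rule ext, rename_tac sl, case_tac sl) (use assms in auto)
  have r: "?f (Suc s) = right_w T"
    by (rule arg_cong [where f = slot_word], rule ext, rename_tac sl, case_tac sl) (use assms in auto)
  have d: "?f (s + W) = down_w T"
    by (rule arg_cong [where f = slot_word], rule ext, rename_tac sl, case_tac sl) (use assms in auto)
  have "concat (map ?f [0..<N + W]) = concat (map ?f [0..<s]) @ concat (map ?f [s..<N + W])"
    by (rule concat_map_split) (use assms in simp_all)
  also have "concat (map ?f [0..<s]) = cat s empty_w"
    by (subst concat_map_const [where w = empty_w]) (simp_all add: e)
  also have "concat (map ?f [s..<N + W]) = ?f s @ concat (map ?f [Suc s..<N + W])"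
    by (rule concat_map_first) (use assms in simp)
  also have "concat (map ?f [Suc s..<N + W]) = ?f (Suc s) @ concat (map ?f [Suc (Suc s)..<N + W])"
    by (rule concat_map_first) (use assms in simp)
  also have "concat (map ?f [Suc (Suc s)..<N + W]) =
      concat (map ?f [Suc (Suc s)..<s + W]) @ concat (map ?f [s + W..<N + W])"
    by (rule concat_map_split) (use assms in simp_all)
  also have "concat (map ?f [Suc (Suc s)..<s + W]) = cat (W - 2) empty_w"
    by (subst concat_map_const [where w = empty_w]) (auto intro!: e)
  also have "concat (map ?f [s + W..<N + W]) = ?f (s + W) @ concat (map ?f [Suc (s + W)..<N + W])"
    by (rule concat_map_first) (use assms in simp)
  also have "concat (map ?f [Suc (s + W)..<N + W]) = cat (N - Suc s) empty_w"
    by (subst concat_map_const [where w = empty_w]) (use assms in \<open>auto intro!: e\<close>)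
  finally show ?thesis unfolding o r d by (simp add: tile_word_def)
qed

text \<open>The initial row occupies the blocks below \<open>width P\<close>, the additional row the
  last \<open>width P\<close> ones; between them \<open>None\<close> covers nothing. Block
  \<open>N\<close> differs from the later ones because its left edge belongs to the last cell: there
  \<open>None\<close> takes \<open>Border\<close> only.\<close>

lemma border_blocks:
  assumes "length x \<le> P" "g \<le> P" "width P \<le> N"
  shows "concat (map (\<lambda>b. slot_word (\<lambda>sl. covers (width P) N Border (ini_col P x g) Fin None (b, sl)))
      [0..<N + width P]) =
    border_word first_w empty_w end_w last_w ini_w x P g (2 * P + 1) (N - width P)"
proof -
  let ?f = "\<lambda>b. slot_word (\<lambda>sl. covers (width P) N Border (ini_col P x g) Fin None (b, sl))"
  let ?W = "width P"
  have W: "?W = 2 * P + 3" by (simp add: width_def)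
  have i0: "?f 0 = first_w"
    by (rule arg_cong [where f = slot_word], rule ext, rename_tac sl, case_tac sl)
      (use assms W in \<open>auto simp: ini_col_def mark_of_def\<close>)
  have i: "?f b = word_of False (\<lambda>_. False) (\<lambda>v. v \<noteq> ini_col P x g b)" if "0 < b" "b < ?W" for b
    by (rule arg_cong [where f = slot_word], rule ext, rename_tac sl, case_tac sl) (use assms that in auto)
  have blank: "?f b = ini_w Mid 0 False" if "1 \<le> b" "b < P + 1" for b
    using i [of b] that W by (simp add: ini_col_def mark_of_def)
  have orig: "?f (P + 1) = ini_w Orig (first_sym x) (0 < g)"
    using i [of "P + 1"] W first_sym_drop [of 0 x] by (simp add: ini_col_def mark_of_def)
  have mid: "?f (P + 2 + j) = ini_w Mid (first_sym (drop (Suc j) x)) (Suc j < g)" if "j < P" for j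
    using i [of "P + 2 + j"] that W by (simp add: ini_col_def mark_of_def first_sym_drop)
  have last: "?f (2 * P + 2) = ini_w Last 0 False"
    using i [of "2 * P + 2"] W assms by (simp add: ini_col_def mark_of_def)
  have e: "?f b = empty_w" if "?W \<le> b" "b < N" for b
    by (rule arg_cong [where f = slot_word], rule ext, rename_tac sl, case_tac sl) (use that W in auto)
  have n: "?f N = end_w"
    by (rule arg_cong [where f = slot_word], rule ext, rename_tac sl, case_tac sl) (use assms W in auto)
  have l: "?f b = last_w" if "N < b" for b
    by (rule arg_cong [where f = slot_word], rule ext, rename_tac sl, case_tac sl) (use that assms W in auto)
  have "concat (map ?f [0..<?W]) = ?f 0 @ concat (map ?f [1..<?W])"
    using concat_map_first [of 0 ?W ?f] W by simp
  also have "concat (map ?f [1..<?W]) = concat (map ?f [1..<P + 1]) @ concat (map ?f [P + 1..<?W])"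
    by (rule concat_map_split) (simp_all add: W)
  also have "concat (map ?f [1..<P + 1]) = cat P (ini_w Mid 0 False)"
    by (subst concat_map_const [where w = "ini_w Mid 0 False"]) (use blank in auto)
  also have "concat (map ?f [P + 1..<?W]) = ?f (P + 1) @ concat (map ?f [P + 2..<?W])"
    using concat_map_first [of "P + 1" ?W ?f] W by simp
  also have "concat (map ?f [P + 2..<?W]) = concat (map ?f [P + 2..<2 * P + 2]) @ concat (map ?f [2 * P + 2..<?W])"
    by (rule concat_map_split) (simp_all add: W)
  also have "map ?f [P + 2..<2 * P + 2] =
      map (\<lambda>j. ini_w Mid (first_sym (drop (Suc j) x)) (Suc j < g)) [0..<P]"
    by (rule nth_equalityI) (use mid in \<open>auto simp del: upt_Suc\<close>)
  also have "concat (map ?f [2 * P + 2..<?W]) = ?f (2 * P + 2)"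
    using concat_map_first [of "2 * P + 2" ?W ?f] W by simp
  finally have row: "concat (map ?f [0..<?W]) = row_word first_w ini_w x P g"
    unfolding i0 orig last row_word_def by simp
  have "concat (map ?f [0..<N + ?W]) = concat (map ?f [0..<?W]) @ concat (map ?f [?W..<N + ?W])"
    by (rule concat_map_split) simp_all
  also have "concat (map ?f [?W..<N + ?W]) = concat (map ?f [?W..<N]) @ concat (map ?f [N..<N + ?W])"
    by (rule concat_map_split) (use assms in simp_all)
  also have "concat (map ?f [?W..<N]) = cat (N - ?W) empty_w"
    by (rule concat_map_const) (rule e)
  also have "concat (map ?f [N..<N + ?W]) = ?f N @ concat (map ?f [Suc N..<N + ?W])"
    by (rule concat_map_first) (simp add: W)
  also have "concat (map ?f [Suc N..<N + ?W]) = cat (Suc (2 * P + 1)) last_w"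
    by (subst concat_map_const [where w = last_w]) (use l W in auto)
  finally show ?thesis unfolding row n border_word_def .
qed

text \<open>The orders of the two lists are those of the program: slots block by block, tiles cell
  by cell. The numeric arguments at the end are \<open>width P - 2\<close> and the number of empty
  blocks before block \<open>N\<close>.\<close>

lemma encode_cover_fm:
  assumes "length x \<le> P" "g \<le> P" "width P \<le> N"
  shows "encode (cover_fm (covers (width P) N Border (ini_col P x g) Fin)
      (List.product [0..<N + width P] slot_list) (None # map Some (List.product [0..<N] Ts)) F) =
    reduction_word first_w empty_w end_w last_w (encode F) ini_w own_w right_w down_w Ts
      x P g N (2 * P + 1) (N - width P)"
proof -
  let ?\<theta> = "covers (width P) N Border (ini_col P x g) Fin"
  let ?es = "List.product [0..<N + width P] slot_list"
  have W: "width P = 2 * P + 3" by (simp add: width_def)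
  have chain: "encode (chain (map (?\<theta> i) ?es @ map (?\<theta> i) ?es)) =
      concat (map (\<lambda>b. slot_word (\<lambda>sl. ?\<theta> i (b, sl))) [0..<N + width P]) @
      concat (map (\<lambda>b. slot_word (\<lambda>sl. ?\<theta> i (b, sl))) [0..<N + width P]) @ var_word" for i
    by (simp only: encode_chain map_append concat_append concat_product_word append_assoc)
  define G where "G i = and_word @ encode (chain (map (?\<theta> i) ?es @ map (?\<theta> i) ?es))" for i
  have G_None: "G None = and_word @ border_word first_w empty_w end_w last_w ini_w x P g (2 * P + 1) (N - width P) @
      border_word first_w empty_w end_w last_w ini_w x P g (2 * P + 1) (N - width P) @ var_word"
    unfolding G_def chain border_blocks [OF assms] ..
  have G_Some: "G (Some (s, T)) = and_word @ tile_word empty_w own_w right_w down_w (2 * P + 1) s (N - Suc s) T @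
      tile_word empty_w own_w right_w down_w (2 * P + 1) s (N - Suc s) T @ var_word" if "s < N" for s T
    unfolding G_def chain using tile_blocks [OF that, of "width P"] W by simp
  have row: "concat (map G (map Some (map (Pair s) Us))) =
      tiles_word empty_w own_w right_w down_w (2 * P + 1) s (N - Suc s) Us" if "s < N" for s Us
    unfolding tiles_word_def by (induction Us) (simp_all add: G_Some [OF that])
  have "concat (map G (map Some (List.product ss Ts))) =
    concat (map (\<lambda>s. tiles_word empty_w own_w right_w down_w (2 * P + 1) s (N - Suc s) Ts) ss)"
    if "set ss \<subseteq> {..<N}" for ss
    using that
  proof (induction ss)
    case (Cons s ss)
    then have "s < N" "set ss \<subseteq> {..<N}" by simp_all
    with Cons.IH row [of s Ts] show ?case by (simp del: map_map)
  qed simp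
  from this [of "[0..<N]"] have tiles: "concat (map G (map Some (List.product [0..<N] Ts))) =
    concat (map (\<lambda>s. tiles_word empty_w own_w right_w down_w (2 * P + 1) s (N - Suc s) Ts) [0..<N])"
    by (simp only: set_upt atLeast0LessThan order_refl)
  have "2 * length ?es = (N + (2 * P + 1) + 2) * length slot_list + (N + (2 * P + 1) + 2) * length slot_list"
    by (simp add: W algebra_simps)
  then have boxes: "cat (2 * length ?es) (dia_box_word False) =
      cat (N + (2 * P + 1) + 2) empty_w @ cat (N + (2 * P + 1) + 2) empty_w"
    by (simp only: cat_add cat_mult empty_w)
  have "encode (cover_fm ?\<theta> ?es is F) =
      concat (map G is) @ cat (2 * length ?es) (dia_box_word False) @ encode F" for "is"
    unfolding cover_fm_def encode_chains_fm map_map comp_def G_def ..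
  then show ?thesis
    by (simp only: list.map concat.simps tiles boxes G_None reduction_word_def append_assoc)
qed

end

lemma operators_chains_fm:
  "operators (chains_fm bs m F) \<subseteq> {OAnd, OBox, ODia} \<union> operators F"
proof -
  have "operators (chain b) \<subseteq> {OBox, ODia}" for b by (induction b) auto
  moreover have "operators ((Box ^^ m) F) \<subseteq> {OBox} \<union> operators F" by (induction m) auto
  ultimately show ?thesis unfolding chains_fm_def by (induction bs) fastforce+
qed

lemma halted_stays: "fst c = halt M \<Longrightarrow> (step M ^^ n) c = c"
  by (induction n) (cases c; simp)+

text \<open>A halted machine stays put, so the answer reached at time \<open>t\<close> can still be
  read at the common time \<open>P\<close>.\<close>

lemma accepts_iff:
  assumes "halted_with M [b] ((step M ^^ t) (start M [x, u]))" "t \<le> P"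
  shows "accepts M P x u \<longleftrightarrow> b"
proof -
  let ?c = "(step M ^^ t) (start M [x, u])"
  have c: "fst ?c = halt M" "snd (last (snd ?c)) = word_tape [b]"
    using assms(1) by (simp_all add: halted_with_def)
  have "(step M ^^ P) (start M [x, u]) = (step M ^^ (P - t)) ?c"
    using assms(2) by (metis funpow_add_apply le_add_diff_inverse)
  also have "\<dots> = ?c" using c(1) by (rule halted_stays)
  finally have "accepts M P x u \<longleftrightarrow> fst ?c = halt M \<and> snd (last (snd ?c)) 0 = 2"
    unfolding accepts_def by (simp add: case_prod_beta)
  also have "\<dots> \<longleftrightarrow> b" using c by (simp add: word_tape_def bit_sym_def)
  finally show ?thesis .
qed

text \<open>\<open>F\<close> is left open: the two parts of the result differ only in which
  contradiction the operators can express.\<close>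

theorem coNP_hard:
  assumes F: "\<And>M :: nat model. \<And>w. \<not> holds M w F" "operators F \<subseteq> S" and S: "{OAnd, OBox, ODia} \<subseteq> S"
    and B: "B \<in> coNP"
  shows "B \<le>\<^sub>p satisfiability S"
proof -
  obtain V p where V: "polytime_rel V"
    and BV: "\<And>x. x \<in> - B \<longleftrightarrow> (\<exists>u. length u \<le> poly p (length x) \<and> (x, u) \<in> V)"
    using B unfolding coNP_def NP_def by blast
  obtain M q where M: "turing_machine M" "2 \<le> ntapes M"
    and run: "\<And>xs. length xs = 2 \<Longrightarrow> \<exists>t \<le> poly q (sum_list (map length xs)).
      halted_with M [(xs ! 0, xs ! 1) \<in> V] ((step M ^^ t) (start M xs))"
    using V unfolding polytime_rel_def polytime_def by blast
  \<comment> \<open>The first summand bounds the running time on every admissible certificate. The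
    others make \<open>P\<close> at least the length of the input and the bound on the certificate,
    so that both fit into the strip.\<close>
  define pP where "pP = pcompose q ([:0, 1:] + p) + [:0, 1:] + p"
  \<comment> \<open>\<open>P + 2\<close> rows of the given width. Likewise \<open>pW\<close> is the
    width minus 2 and \<open>pZ\<close> is \<open>N\<close> minus the width, written without
    subtraction because the program obtains its counters by evaluating polynomials.\<close>
  define pN where "pN = (pP + [:2:]) * ([:2:] * pP + [:3:])"
  define pW where "pW = [:2:] * pP + [:1:]"
  define pZ where "pZ = (pP + [:1:]) * ([:2:] * pP + [:3:])"
  have P: "poly pP n = poly q (n + poly p n) + n + poly p n" for n
    by (simp add: pP_def poly_pcompose)
  have polys: "poly pN n = (poly pP n + 2) * width (poly pP n)" "poly pW n = 2 * poly pP n + 1"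
    "poly pZ n = (poly pP n + 1) * width (poly pP n)" for n
    by (simp_all add: pN_def pW_def pZ_def width_def)
  obtain H Vc where HV: "finite H" "finite Vc"
    "\<And>T. tm_tile M T \<Longrightarrow> lf T \<in> H \<and> rt T \<in> H \<and> up T \<in> Vc \<and> dn T \<in> Vc"
    using finite_hcol_vcol [OF M(1)] by metis
  let ?\<Theta> = "{T. tm_tile M T}"
  have "?\<Theta> \<subseteq> (\<lambda>(l, r, u, d). Tile l r u d) ` (H \<times> H \<times> Vc \<times> Vc)"
  proof
    fix T assume "T \<in> ?\<Theta>"
    then have "(lf T, rt T, up T, dn T) \<in> H \<times> H \<times> Vc \<times> Vc" using HV(3) by simp
    moreover have "T = (\<lambda>(l, r, u, d). Tile l r u d) (lf T, rt T, up T, dn T)" by simp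
    ultimately show "T \<in> (\<lambda>(l, r, u, d). Tile l r u d) ` (H \<times> H \<times> Vc \<times> Vc)" by (rule rev_image_eqI)
  qed
  then have "finite ?\<Theta>" by (rule finite_subset) (use HV in simp)
  then obtain Ts where Ts: "set Ts = ?\<Theta>" using finite_list by blast
  obtain hs where hs: "set hs = H" using HV(1) finite_list by blast
  obtain vs where vs: "set vs = Vc" using HV(2) finite_list by blast
  define fm_of where "fm_of x = (let n = length x; P = poly pP n; N = poly pN n in
    cover_fm (covers (width P) N Border (ini_col P x (poly p n)) Fin)
      (List.product [0..<N + width P] (slot_list hs vs)) (None # map Some (List.product [0..<N] Ts)) F)" for x
  define R where "R = reduction_prog (first_w hs vs) (empty_w hs vs) (end_w hs vs) (last_w hs vs)
    (encode F) (ini_w hs vs) (own_w hs vs) (right_w hs vs) (down_w hs vs) Ts pP p pN pW pZ"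
  have den: "den R (initial [x]) 14 = encode (fm_of x)" for x
  proof -
    let ?n = "length x"
    have "width (poly pP ?n) \<le> poly pN ?n" "poly pZ ?n = poly pN ?n - width (poly pP ?n)"
      unfolding polys by simp_all
    then show ?thesis
      unfolding R_def den_reduction_prog fm_of_def Let_def
      by (subst encode_cover_fm) (simp_all add: P polys(2))
  qed
  have "polytime 1 (\<lambda>xs. encode (fm_of (xs ! 0)))"
  proof (rule polytimeI)
    show "polytime_on UNIV (\<lambda>\<sigma>. \<exists>x. \<sigma> = initial [x]) R"
      unfolding R_def by (rule polytime_on_reduction_prog)
    fix xs :: "word list" assume "length xs = 1"
    then have xs: "xs = [xs ! 0]" by (cases xs) auto
    show "\<exists>x. initial xs = initial [x]" using xs by metis
    show "den R (initial xs) 14 = encode (fm_of (xs ! 0))" using den [of "xs ! 0"] xs by simp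
  qed
  then have poly: "polytime_fun (\<lambda>x. encode (fm_of x))" unfolding polytime_fun_def .
  have "x \<in> B \<longleftrightarrow> encode (fm_of x) \<in> satisfiability S" for x
  proof -
    let ?n = "length x"
    let ?P = "poly pP ?n" and ?g = "poly p ?n"
    let ?W = "width ?P" and ?N = "poly pN ?n"
    let ?\<theta> = "covers ?W ?N Border (ini_col ?P x ?g) Fin"
    have g: "?g \<le> ?P" unfolding P by simp
    have "accepts M ?P x u \<longleftrightarrow> (x, u) \<in> V" if "length u \<le> ?g" for u
    proof -
      obtain t where t: "t \<le> poly q (?n + length u)"
        "halted_with M [(x, u) \<in> V] ((step M ^^ t) (start M [x, u]))"
        using run [of "[x, u]"] by auto
      have "poly q (?n + length u) \<le> poly q (?n + ?g)" using that by (intro poly_nat_mono) simp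
      then have "t \<le> ?P" unfolding P using t(1) by simp
      with t(2) show ?thesis by (rule accepts_iff)
    qed
    then have "x \<notin> B \<longleftrightarrow> (\<exists>u. length u \<le> ?g \<and> accepts M ?P x u)" using BV [of x] by auto
    also have "\<dots> \<longleftrightarrow> (\<exists>\<tau>. helix_tiling ?\<Theta> ?W ?N Border (ini_col ?P x ?g) Fin \<tau>)"
      unfolding polys by (rule helix_tiling_iff_accepts [OF M g, symmetric])
    also have "\<dots> \<longleftrightarrow> (\<exists>C\<subseteq>insert None (Some ` ({..<?N} \<times> ?\<Theta>)).
        exact_cover ?\<theta> ({..<?N + ?W} \<times> slots H Vc) C)"
      by (rule exact_cover_iff_helix_tiling [symmetric]) (use HV(3) in \<open>auto simp: polys width_def\<close>)
    also have "insert None (Some ` ({..<?N} \<times> ?\<Theta>)) = set (None # map Some (List.product [0..<?N] Ts))"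
      by (simp add: Ts atLeast0LessThan)
    also have "{..<?N + ?W} \<times> slots H Vc = set (List.product [0..<?N + ?W] (slot_list hs vs))"
      by (simp add: hs vs slots_def slot_list_def atLeast0LessThan)
    finally have "x \<in> B \<longleftrightarrow> satisfiable (fm_of x)"
      unfolding fm_of_def Let_def satisfiable_cover_fm [OF F(1)] by blast
    moreover have "fm_of x \<in> formulas S"
      using operators_chains_fm F(2) S unfolding fm_of_def Let_def cover_fm_def formulas_def by blast
    ultimately show ?thesis by (simp add: encode_in_satisfiability_iff)
  qed
  with poly show ?thesis unfolding poly_reducible_def by blast
qed

section \<open>A program reading formulas\<close>

text \<open>
  Register 0 holds the text to be read, register 5 receives a symbol at every error. Register 4 lists
  what remains to be read: \<open>True\<close> stands for a formula, \<open>False\<close> for the index of a variable.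
\<close>

definition read_bit :: "nat \<Rightarrow> (bool \<Rightarrow> prog) \<Rightarrow> prog" where
  "read_bit r k = Test 0 {None} (Push 5 True)
     (Test 0 {Some True} (Pop 0 ;; Push r True ;; k True) (Pop 0 ;; Push r False ;; k False))"

definition read_token :: "nat \<Rightarrow> (bool \<Rightarrow> bool \<Rightarrow> bool \<Rightarrow> bool \<Rightarrow> prog) \<Rightarrow> prog" where
  "read_token r k = read_bit r (\<lambda>a. read_bit r (\<lambda>b. read_bit r (\<lambda>c. read_bit r (k a b c))))"

context
  fixes S :: "operator set"
begin

text \<open>Whether an operator belongs to \<open>S\<close> is settled when the program is built,
  not while it runs.\<close>

definition allow :: "operator \<Rightarrow> prog \<Rightarrow> prog" where
  "allow c P = (if c \<in> S then P else Push 5 True)"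

fun expect :: "bool \<Rightarrow> bool \<Rightarrow> bool \<Rightarrow> bool \<Rightarrow> prog" where
  "expect False False False False = Push 4 False"
| "expect False False False True = allow OBar (Push 4 False)"
| "expect False False True True = allow OAnd (Push 4 True ;; Push 4 True)"
| "expect False True False True = allow OBox (Push 4 True)"
| "expect False True True False = allow ODia (Push 4 True)"
| "expect False True True True = allow OTrue Skip"
| "expect True False False False = allow OFalse Skip"
| "expect _ _ _ _ = Push 5 True"

text \<open>The most significant digit written by \<open>encode_nat\<close> is 1, so a digit 0 must
  be followed by a further digit; anything else is an error. When the text runs out at a marker, the
  pending item is dropped as well, so that the reader terminates.\<close>

definition read_index :: "nat \<Rightarrow> prog" where
  "read_index r = Test 0 {Some True}
     (Pop 0 ;; Push r True ;; Test 0 {None} (Push 5 True)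
        (Test 0 {Some True} (Pop 0 ;; Push r True)
           (Pop 0 ;; Push r False ;; Test 0 {Some True} Skip (Push 5 True))))
     (Test 0 {None} (Pop 4 ;; Push 5 True) (Pop 0 ;; Push r False ;; Pop 4))"

definition copy_step :: "nat \<Rightarrow> prog" where
  "copy_step r = Test 4 {Some False} (read_index r) (Pop 4 ;; read_token r expect)"

definition copy :: "nat \<Rightarrow> prog" where
  "copy r = Loop 4 (- {None}) (copy_step r)"

lemma den_copy:
  "den (copy r) \<sigma> = (if \<sigma> 4 = [] then \<sigma> else den (copy r) (den (copy_step r) \<sigma>))"
  unfolding copy_def by (subst den_Loop) simp

lemma den_read_bit_simps [simp]:
  "\<sigma> 0 = [] \<Longrightarrow> den (read_bit r k) \<sigma> = \<sigma>(5 := True # \<sigma> 5)"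
  "\<sigma> 0 = b # w \<Longrightarrow> r \<noteq> 0 \<Longrightarrow> den (read_bit r k) \<sigma> = den (k b) (\<sigma>(0 := w, r := b # \<sigma> r))"
  by (cases b; simp add: read_bit_def)+

lemma den_read_token:
  assumes "\<sigma> 0 = a # b # c # d # w" "r \<noteq> 0"
  shows "den (read_token r k) \<sigma> = den (k a b c d) (\<sigma>(0 := w, r := d # c # b # a # \<sigma> r))"
  using assms by (simp add: read_token_def)

lemma copy_unfold: "\<sigma> 4 = c # cs \<Longrightarrow> den (copy_step r) \<sigma> = \<sigma>' \<Longrightarrow> den (copy r) \<sigma> = den (copy r) \<sigma>'"
  using den_copy [of r \<sigma>] by (simp only: list.distinct if_False)

lemma copy_token:
  assumes "\<sigma> 0 = a # b # c # d # w" "\<sigma> 4 = True # cs" "r \<noteq> 0" "r \<noteq> 4" "r \<noteq> 5"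
    and \<sigma>': "den (expect a b c d) (\<sigma>(4 := cs, 0 := w, r := d # c # b # a # \<sigma> r)) = \<sigma>'"
  shows "den (copy r) \<sigma> = den (copy r) \<sigma>'"
proof (rule copy_unfold [of \<sigma>, OF assms(2)])
  show "den (copy_step r) \<sigma> = \<sigma>'"
    unfolding \<sigma>' [symmetric] using assms by (simp add: copy_step_def den_read_token)
qed

lemma encode_nat_0: "encode_nat 0 = [False]"
  by (simp add: encode_nat.simps)

lemma encode_nat_pos: "n \<noteq> 0 \<Longrightarrow> encode_nat n = True # odd n # encode_nat (n div 2)"
  by (subst encode_nat.simps) simp

text \<open>Stated, like \<open>copy_formula\<close>, as an equation between two runs of the loop:
  such equations compose by transitivity, without dividing the loop into segments.\<close>

lemma copy_index:
  assumes r: "r \<noteq> 0" "r \<noteq> 4" "r \<noteq> 5"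
  shows "\<sigma> 0 = encode_nat n @ w \<Longrightarrow> \<sigma> 4 = False # cs \<Longrightarrow>
    \<sigma>' = \<sigma>(0 := w, r := rev (encode_nat n) @ \<sigma> r, 4 := cs) \<Longrightarrow> den (copy r) \<sigma> = den (copy r) \<sigma>'"
proof (induction n arbitrary: \<sigma> \<sigma>' rule: less_induct)
  case (less n)
  show ?case
  proof (cases "n = 0")
    case True
    show ?thesis
      by (rule copy_unfold [of \<sigma>, OF less.prems(2)])
        (use less.prems True r in \<open>simp add: copy_step_def read_index_def encode_nat_0 fun_eq_iff\<close>)
  next
    case False
    let ?e = "encode_nat (n div 2)"
    have e: "\<sigma> 0 = True # odd n # ?e @ w" using less.prems(1) False by (simp add: encode_nat_pos)
    have "den (copy_step r) \<sigma> = \<sigma>(0 := ?e @ w, r := odd n # True # \<sigma> r)"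
    proof (cases "odd n")
      case True
      then show ?thesis using less.prems(2) r e by (simp add: copy_step_def read_index_def fun_eq_iff)
    next
      case even: False
      then have "n div 2 \<noteq> 0" using False by auto
      then obtain v where "?e = True # v" by (simp add: encode_nat_pos)
      then show ?thesis using less.prems(2) r e even
        by (simp add: copy_step_def read_index_def fun_eq_iff)
    qed
    then have "den (copy r) \<sigma> = den (copy r) (\<sigma>(0 := ?e @ w, r := odd n # True # \<sigma> r))"
      by (rule copy_unfold [of \<sigma>, OF less.prems(2)])
    also have "\<dots> = den (copy r) \<sigma>'"
      by (rule less.IH [of "n div 2"])
        (use False less.prems(2,3) r in \<open>simp_all add: encode_nat_pos fun_eq_iff\<close>)
    finally show ?thesis .
  qed
qed

lemma copy_formula:
  assumes r: "r \<noteq> 0" "r \<noteq> 4" "r \<noteq> 5" and S: "S \<inter> {ONeg, OOr} = {}"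
  shows "operators \<phi> \<subseteq> S \<Longrightarrow> \<sigma> 0 = encode \<phi> @ w \<Longrightarrow> \<sigma> 4 = True # cs \<Longrightarrow>
    \<sigma>' = \<sigma>(0 := w, r := rev (encode \<phi>) @ \<sigma> r, 4 := cs) \<Longrightarrow> den (copy r) \<sigma> = den (copy r) \<sigma>'"
proof (induction \<phi> arbitrary: \<sigma> \<sigma>' w cs)
  case (Var i)
  have "den (copy r) \<sigma> = den (copy r) (\<sigma>(4 := False # cs, 0 := encode_nat i @ w, r := [False, False, False, False] @ \<sigma> r))"
    by (rule copy_token [of \<sigma> False False False False, OF _ Var.prems(3) r])
      (use Var.prems(1,2) r in \<open>simp_all add: fun_eq_iff allow_def\<close>)
  also have "\<dots> = den (copy r) \<sigma>'"
    by (rule copy_index [OF r, where n = i and w = w and cs = cs])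
      (use Var.prems(4) r in \<open>simp_all add: fun_eq_iff\<close>)
  finally show ?case .
next
  case (BarVar i)
  have "den (copy r) \<sigma> = den (copy r) (\<sigma>(4 := False # cs, 0 := encode_nat i @ w, r := [True, False, False, False] @ \<sigma> r))"
    by (rule copy_token [of \<sigma> False False False True, OF _ BarVar.prems(3) r])
      (use BarVar.prems(1,2) r in \<open>simp_all add: fun_eq_iff allow_def\<close>)
  also have "\<dots> = den (copy r) \<sigma>'"
    by (rule copy_index [OF r, where n = i and w = w and cs = cs])
      (use BarVar.prems(4) r in \<open>simp_all add: fun_eq_iff\<close>)
  finally show ?case .
next
  case (And \<phi> \<psi>)
  have "den (copy r) \<sigma> = den (copy r) (\<sigma>(4 := True # True # cs, 0 := encode \<phi> @ encode \<psi> @ w, r := [True, True, False, False] @ \<sigma> r))"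
    by (rule copy_token [of \<sigma> False False True True, OF _ And.prems(3) r])
      (use And.prems(1,2) r in \<open>simp_all add: fun_eq_iff allow_def\<close>)
  also have "\<dots> = den (copy r) (\<sigma>(4 := True # cs, 0 := encode \<psi> @ w,
      r := rev (encode \<phi>) @ [True, True, False, False] @ \<sigma> r))"
    by (rule And.IH(1) [where w = "encode \<psi> @ w" and cs = "True # cs"])
      (use r And.prems(1) in \<open>simp_all add: fun_eq_iff\<close>)
  also have "\<dots> = den (copy r) \<sigma>'"
    by (rule And.IH(2) [where w = w and cs = cs]) (use r And.prems(1,4) in \<open>simp_all add: fun_eq_iff\<close>)
  finally show ?case .
next
  case (Box \<phi>)
  have "den (copy r) \<sigma> = den (copy r) (\<sigma>(4 := True # cs, 0 := encode \<phi> @ w, r := [True, False, True, False] @ \<sigma> r))"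
    by (rule copy_token [of \<sigma> False True False True, OF _ Box.prems(3) r])
      (use Box.prems(1,2) r in \<open>simp_all add: fun_eq_iff allow_def\<close>)
  also have "\<dots> = den (copy r) \<sigma>'"
    by (rule Box.IH [where w = w and cs = cs]) (use Box.prems(1,4) r in \<open>simp_all add: fun_eq_iff\<close>)
  finally show ?case .
next
  case (Dia \<phi>)
  have "den (copy r) \<sigma> = den (copy r) (\<sigma>(4 := True # cs, 0 := encode \<phi> @ w, r := [False, True, True, False] @ \<sigma> r))"
    by (rule copy_token [of \<sigma> False True True False, OF _ Dia.prems(3) r])
      (use Dia.prems(1,2) r in \<open>simp_all add: fun_eq_iff allow_def\<close>)
  also have "\<dots> = den (copy r) \<sigma>'"
    by (rule Dia.IH [where w = w and cs = cs]) (use Dia.prems(1,4) r in \<open>simp_all add: fun_eq_iff\<close>)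
  finally show ?case .
next
  case Tru
  show ?case
    by (rule copy_token [of \<sigma> False True True True, OF _ Tru.prems(3) r]) (use Tru.prems(1,2,4) r in \<open>simp_all add: fun_eq_iff allow_def\<close>)
next
  case Fls
  show ?case
    by (rule copy_token [of \<sigma> True False False False, OF _ Fls.prems(3) r]) (use Fls.prems(1,2,4) r in \<open>simp_all add: fun_eq_iff allow_def\<close>)
qed (use S in auto)

section \<open>Soundness of the reader\<close>

definition item :: "bool \<Rightarrow> word \<Rightarrow> bool" where
  "item c w \<longleftrightarrow> (if c then \<exists>\<phi>\<in>formulas S. w = encode \<phi> else \<exists>n. w = encode_nat n)"

lemma encode_nat_hd: "encode_nat n = True # v \<Longrightarrow> n \<noteq> 0"
  by (cases "n = 0") (simp_all add: encode_nat_0)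

lemma item_True: "item True (encode \<phi>)" if "operators \<phi> \<subseteq> S" for \<phi>
  using that by (auto simp: item_def formulas_def)

lemma item_Var: "item False w \<Longrightarrow> item True ([False, False, False, False] @ w)"
  using item_True [of "Var _"] by (auto simp: item_def)

lemma item_BarVar: "OBar \<in> S \<Longrightarrow> item False w \<Longrightarrow> item True ([False, False, False, True] @ w)"
  using item_True [of "BarVar _"] by (auto simp: item_def)

lemma item_unary:
  assumes "item True w"
  shows "OBox \<in> S \<Longrightarrow> item True ([False, True, False, True] @ w)"
    "ODia \<in> S \<Longrightarrow> item True ([False, True, True, False] @ w)"
  using assms item_True [of "Box _"] item_True [of "Dia _"] by (auto simp: item_def formulas_def)

lemma item_And:
  assumes "item True v" "item True w" "OAnd \<in> S"
  shows "item True ([False, False, True, True] @ v @ w)"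
  using assms item_True [of "And _ _"] by (auto simp: item_def formulas_def)

lemma item_const:
  "OTrue \<in> S \<Longrightarrow> item True [False, True, True, True]"
  "OFalse \<in> S \<Longrightarrow> item True [True, False, False, False]"
  using item_True [of Tru] item_True [of Fls] by simp_all

lemma item_index:
  "item False [False]"
  "item False w \<Longrightarrow> item False (True # True # w)"
  "item False w \<Longrightarrow> w = True # v \<Longrightarrow> item False (True # False # w)"
proof -
  show "item False [False]" unfolding item_def using encode_nat_0 by metis
  show "item False (True # True # w)" if w: "item False w"
  proof -
    obtain n where "w = encode_nat n" using w by (auto simp: item_def)
    then have "True # True # w = encode_nat (2 * n + 1)" by (subst encode_nat_pos) simp_all
    then show ?thesis unfolding item_def by auto
  qed
  show "item False (True # False # w)" if w: "item False w" "w = True # v"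
  proof -
    obtain n where n: "w = encode_nat n" using w(1) by (auto simp: item_def)
    then have "n \<noteq> 0" using w(2) encode_nat_hd by metis
    then have "True # False # w = encode_nat (2 * n)" using n by (subst encode_nat_pos) simp_all
    then show ?thesis unfolding item_def by auto
  qed
qed

text \<open>\<open>X\<close> lists the operands that the token still has to read. In Polish notation
  words for them, written one after the other, complete the formula.\<close>

lemma expect_sound:
  assumes "den (expect a b c d) \<sigma> 5 = []"
  shows "\<exists>X. den (expect a b c d) \<sigma> 4 = X @ \<sigma> 4 \<and> (\<forall>ws. list_all2 item X ws \<longrightarrow> item True (a # b # c # d # concat ws))"
proof -
  have 1: "\<exists>w. ws = [w] \<and> item x w" if "list_all2 item [x] ws" for x ws
    using that by (auto simp: list_all2_Cons1)
  have 2: "\<exists>v w. ws = [v, w] \<and> item x v \<and> item y w" if "list_all2 item [x, y] ws" for x y ws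
    using that by (auto simp: list_all2_Cons1)
  have u: "item True (a # b # c # d # concat ws)"
    if "list_all2 item [x] ws" "\<And>w. item x w \<Longrightarrow> item True ([a, b, c, d] @ w)" for x ws a b c d
    using 1 [OF that(1)] that(2) by auto
  consider "\<not> a" "\<not> b" "\<not> c" "\<not> d" | "\<not> a" "\<not> b" "\<not> c" "d" "OBar \<in> S"
    | "\<not> a" "\<not> b" "c" "d" "OAnd \<in> S" | "\<not> a" "b" "\<not> c" "d" "OBox \<in> S"
    | "\<not> a" "b" "c" "\<not> d" "ODia \<in> S" | "\<not> a" "b" "c" "d" "OTrue \<in> S"
    | "a" "\<not> b" "\<not> c" "\<not> d" "OFalse \<in> S"
    using assms by (cases a; cases b; cases c; cases d) (auto simp: allow_def split: if_splits)
  then show ?thesis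
  proof cases
    case 1
    then show ?thesis by (intro exI [of _ "[False]"]) (auto intro!: u [of False] dest: item_Var)
  next
    case 2
    then show ?thesis by (intro exI [of _ "[False]"]) (auto intro!: u [of False] dest: item_BarVar simp: allow_def)
  next
    case 3
    have "item True (a # b # c # d # concat ws)" if "list_all2 item [True, True] ws" for ws
      using 2 [OF that] item_And 3 by auto
    then show ?thesis using 3 by (intro exI [of _ "[True, True]"]) (simp add: allow_def)
  next
    case 4
    then show ?thesis by (intro exI [of _ "[True]"]) (auto intro!: u [of True] dest: item_unary(1) simp: allow_def)
  next
    case 5
    then show ?thesis by (intro exI [of _ "[True]"]) (auto intro!: u [of True] dest: item_unary(2) simp: allow_def)
  next
    case 6
    then show ?thesis by (intro exI [of _ "[]"]) (auto simp: allow_def item_const)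
  next
    case 7
    then show ?thesis by (intro exI [of _ "[]"]) (auto simp: allow_def item_const)
  qed
qed

lemma expect_facts:
  "length (den (expect a b c d) \<sigma> 4) \<le> length (\<sigma> 4) + 2"
  "\<sigma> 5 \<noteq> [] \<Longrightarrow> den (expect a b c d) \<sigma> 5 \<noteq> []"
  "i \<noteq> 4 \<Longrightarrow> i \<noteq> 5 \<Longrightarrow> den (expect a b c d) \<sigma> i = \<sigma> i"
  "loop_free (expect a b c d)"
  by (cases a; cases b; cases c; cases d; simp add: allow_def)+

lemma word_cases4:
  "w = [] \<or> (\<exists>a. w = [a]) \<or> (\<exists>a b. w = [a, b]) \<or> (\<exists>a b c. w = [a, b, c]) \<or>
    (\<exists>a b c d v. w = a # b # c # d # (v :: word))"
  by (cases w; cases "tl w"; cases "tl (tl w)"; cases "tl (tl (tl w))") auto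

text \<open>The weights make every step decrease the measure, even one that pushes two items.\<close>

lemma copy_step_facts:
  assumes "\<sigma> 4 \<noteq> []" and r: "r \<noteq> 0" "r \<noteq> 4" "r \<noteq> 5"
  shows "3 * length (den (copy_step r) \<sigma> 0) + 2 * length (den (copy_step r) \<sigma> 4) < 3 * length (\<sigma> 0) + 2 * length (\<sigma> 4)
    \<and> length (den (copy_step r) \<sigma> 0) \<le> length (\<sigma> 0)
    \<and> (\<sigma> 5 \<noteq> [] \<longrightarrow> den (copy_step r) \<sigma> 5 \<noteq> [])
    \<and> (\<forall>i. i \<notin> {0, 4, 5, r} \<longrightarrow> den (copy_step r) \<sigma> i = \<sigma> i)"
proof -
  obtain c cs where c: "\<sigma> 4 = c # cs" using assms(1) by (cases "\<sigma> 4") auto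
  show ?thesis
  proof (cases c)
    case False
    show ?thesis
      using c False r by (cases "\<sigma> 0"; cases "tl (\<sigma> 0)")
        (auto simp: copy_step_def read_index_def)
  next
    case True
    from word_cases4 [of "\<sigma> 0"] show ?thesis
    proof (elim disjE exE)
      fix a b c' d v
      assume w: "\<sigma> 0 = a # b # c' # d # v"
      have "den (copy_step r) \<sigma> = den (expect a b c' d) (\<sigma>(4 := cs, 0 := v, r := d # c' # b # a # \<sigma> r))"
        using c True r w by (simp add: copy_step_def den_read_token)
      then show ?thesis
        using expect_facts(1-3) [where a = a and b = b and c = c' and d = d
            and \<sigma> = "\<sigma>(4 := cs, 0 := v, r := d # c' # b # a # \<sigma> r)"] c r w by simp
    qed (use c True r in \<open>simp_all add: copy_step_def read_token_def\<close>)
  qed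
qed

lemma copy_facts:
  assumes r: "r \<noteq> 0" "r \<noteq> 4" "r \<noteq> 5"
  shows "den (copy r) \<sigma> 4 = [] \<and> length (den (copy r) \<sigma> 0) \<le> length (\<sigma> 0) \<and>
    (\<sigma> 5 \<noteq> [] \<longrightarrow> den (copy r) \<sigma> 5 \<noteq> []) \<and> (\<forall>i. i \<notin> {0, 4, 5, r} \<longrightarrow> den (copy r) \<sigma> i = \<sigma> i)"
proof (induction "3 * length (\<sigma> 0) + 2 * length (\<sigma> 4)" arbitrary: \<sigma> rule: less_induct)
  case less
  show ?case
  proof (cases "\<sigma> 4 = []")
    case True
    then show ?thesis using den_copy [of r \<sigma>] by simp
  next
    case False
    let ?\<sigma>' = "den (copy_step r) \<sigma>"
    have eq: "den (copy r) \<sigma> = den (copy r) ?\<sigma>'" using den_copy [of r \<sigma>] False by (simp only: if_False)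
    note s = copy_step_facts [of \<sigma>, OF False r]
    have "3 * length (?\<sigma>' 0) + 2 * length (?\<sigma>' 4) < 3 * length (\<sigma> 0) + 2 * length (\<sigma> 4)" using s by blast
    from less(1) [OF this] s show ?thesis unfolding eq by auto
  qed
qed

text \<open>Error marks are never removed entirely, so a run that ends without one had none on the
  way. Each step accounts for the bits it reads, and the words found for the operands it pushed are
  joined to them.\<close>

lemma copy_sound:
  assumes r: "r \<noteq> 0" "r \<noteq> 4" "r \<noteq> 5"
  shows "den (copy r) \<sigma> 5 = [] \<Longrightarrow> \<exists>ws. \<sigma> 0 = concat ws @ den (copy r) \<sigma> 0 \<and> list_all2 item (\<sigma> 4) ws"
proof (induction "3 * length (\<sigma> 0) + 2 * length (\<sigma> 4)" arbitrary: \<sigma> rule: less_induct)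
  case less
  show ?case
  proof (cases "\<sigma> 4")
    case Nil
    then show ?thesis using den_copy [of r \<sigma>] by (intro exI [of _ "[]"]) simp
  next
    case (Cons c cs)
    then have ne: "\<sigma> 4 \<noteq> []" by simp
    define \<sigma>' where "\<sigma>' = den (copy_step r) \<sigma>"
    have eq: "den (copy r) \<sigma> = den (copy r) \<sigma>'"
      using den_copy [of r \<sigma>] ne unfolding \<sigma>'_def by (simp only: if_False)
    have ok: "\<sigma>' 5 = []" using copy_facts [OF r, of \<sigma>'] less.prems eq by auto
    have "3 * length (\<sigma>' 0) + 2 * length (\<sigma>' 4) < 3 * length (\<sigma> 0) + 2 * length (\<sigma> 4)"
      using copy_step_facts [of \<sigma>, OF ne r] unfolding \<sigma>'_def by blast
    from less.hyps [OF this] less.prems obtain ws where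
      ws: "\<sigma>' 0 = concat ws @ den (copy r) \<sigma> 0" "list_all2 item (\<sigma>' 4) ws" unfolding eq by blast
    show ?thesis
    proof (cases c)
      case True
      from word_cases4 [of "\<sigma> 0"] show ?thesis
      proof (elim disjE exE)
        fix a b c' d v
        assume w: "\<sigma> 0 = a # b # c' # d # v"
        let ?\<sigma> = "\<sigma>(4 := cs, 0 := v, r := d # c' # b # a # \<sigma> r)"
        have \<sigma>': "\<sigma>' = den (expect a b c' d) ?\<sigma>"
          unfolding \<sigma>'_def using Cons True r w by (simp add: copy_step_def den_read_token)
        then obtain X where X: "\<sigma>' 4 = X @ cs"
          "\<And>ws. list_all2 item X ws \<Longrightarrow> item True (a # b # c' # d # concat ws)"
          using expect_sound [of a b c' d ?\<sigma>] ok r by auto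
        obtain ws1 ws2 where ws12: "ws = ws1 @ ws2" "list_all2 item X ws1" "list_all2 item cs ws2"
          using ws(2) unfolding X(1) by (auto simp: list_all2_append1)
        have "\<sigma>' 0 = v" unfolding \<sigma>' using expect_facts(3) [of 0 a b c' d ?\<sigma>] r by simp
        then have "\<sigma> 0 = concat ((a # b # c' # d # concat ws1) # ws2) @ den (copy r) \<sigma> 0"
          using w ws(1) ws12(1) by simp
        moreover have "list_all2 item (\<sigma> 4) ((a # b # c' # d # concat ws1) # ws2)"
          using Cons True X(2) [OF ws12(2)] ws12(3) by simp
        ultimately show ?thesis by blast
      qed (use ok Cons True r in \<open>simp_all add: \<sigma>'_def copy_step_def read_token_def\<close>)
    next
      case False
      consider v where "\<sigma> 0 = False # v" | v where "\<sigma> 0 = True # True # v" | v where "\<sigma> 0 = True # False # True # v"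
        using ok Cons False r by (cases "\<sigma> 0"; cases "tl (\<sigma> 0)"; cases "tl (tl (\<sigma> 0))")
          (auto simp: \<sigma>'_def copy_step_def read_index_def split: if_splits)
      then show ?thesis
      proof cases
        case (1 v)
        have "\<sigma>' 0 = v" "\<sigma>' 4 = cs"
          using 1 Cons False r by (simp_all add: \<sigma>'_def copy_step_def read_index_def)
        then have "\<sigma> 0 = concat ([False] # ws) @ den (copy r) \<sigma> 0" "list_all2 item (\<sigma> 4) ([False] # ws)"
          using ws 1 Cons False item_index(1) by simp_all
        then show ?thesis by blast
      next
        case (2 v)
        have "\<sigma>' 0 = v" "\<sigma>' 4 = False # cs"
          using 2 Cons False r by (simp_all add: \<sigma>'_def copy_step_def read_index_def)
        then obtain w ws' where w: "ws = w # ws'" "item False w" "list_all2 item cs ws'"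
          using ws(2) by (auto simp: list_all2_Cons1)
        then have "\<sigma> 0 = concat ((True # True # w) # ws') @ den (copy r) \<sigma> 0"
          "list_all2 item (\<sigma> 4) ((True # True # w) # ws')"
          using ws(1) 2 Cons False item_index(2) \<open>\<sigma>' 0 = v\<close> by simp_all
        then show ?thesis by blast
      next
        case (3 v)
        have s: "\<sigma>' 0 = True # v" "\<sigma>' 4 = False # cs"
          using 3 Cons False r by (simp_all add: \<sigma>'_def copy_step_def read_index_def)
        then obtain w ws' where w: "ws = w # ws'" "item False w" "list_all2 item cs ws'"
          using ws(2) by (auto simp: list_all2_Cons1)
        then obtain n where "w = encode_nat n" by (auto simp: item_def)
        \<comment> \<open>The reader has looked ahead to the marker \<open>True\<close>. As the word
          of the remaining index is non-empty, that marker is its first symbol; so this index is not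
          0, and the digit 0 before it is legitimate.\<close>
        then have "w \<noteq> []" by (cases "n = 0") (simp_all add: encode_nat_0 encode_nat_pos)
        then obtain v' where v': "w = True # v'" using s(1) ws(1) w(1) by (cases w) auto
        have "item False (True # False # w)" using item_index(3) [OF w(2) v'] .
        then have "\<sigma> 0 = concat ((True # False # w) # ws') @ den (copy r) \<sigma> 0"
          "list_all2 item (\<sigma> 4) ((True # False # w) # ws')"
          using ws(1) 3 Cons False w s(1) by simp_all
        then show ?thesis by blast
      qed
    qed
  qed
qed

lemma polytime_on_read_bit:
  assumes "\<And>b. polytime_on R (\<lambda>_. True) (k b)"
  shows "polytime_on R D (read_bit r k)"
proof (rule polytime_on_True)
  have "polytime_on R D (Pop 0 ;; Push r b ;; k b)" for b D
    by (intro polytime_on_Seq [where D' = "\<lambda>_. True"] polytime_on_Pop polytime_on_Push assms) simp_all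
  then show "polytime_on R (\<lambda>_. True) (read_bit r k)"
    unfolding read_bit_def by (intro polytime_on_Test polytime_on_Push)
qed

lemma loop_free_copy_step: "loop_free (copy_step r)"
  by (simp add: copy_step_def read_index_def read_token_def read_bit_def expect_facts allow_def)

lemma polytime_on_copy:
  assumes r: "r \<noteq> 0" "r \<noteq> 4" "r \<noteq> 5"
  shows "polytime_on {0, 4} D (copy r)"
proof (rule polytime_on_True, unfold copy_def,
    rule polytime_on_Loop [where \<Phi> = "\<lambda>\<sigma>. 3 * length (\<sigma> 0) + 2 * length (\<sigma> 4)" and b = "\<lambda>n. 3 * n + 2 * n"])
  show "polytime_on {0, 4} (\<lambda>_. True) (copy_step r)"
    by (rule polytime_on_loop_free [OF loop_free_copy_step])
  fix \<sigma> :: store and i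
  assume "peek (\<sigma> 4) \<in> - {None}"
  then have "\<sigma> 4 \<noteq> []" by auto
  note s = copy_step_facts [of \<sigma>, OF this r]
  show "True \<and> 3 * length (den (copy_step r) \<sigma> 0) + 2 * length (den (copy_step r) \<sigma> 4) < 3 * length (\<sigma> 0) + 2 * length (\<sigma> 4)"
    using s by blast
  show "i \<in> {0, 4} \<Longrightarrow> length (den (copy_step r) \<sigma> i) \<le> max (length (\<sigma> i)) (3 * length (\<sigma> 0) + 2 * length (\<sigma> 4))"
    using s by auto
next
  show "poly_bounded (\<lambda>n. 3 * n + 2 * n)"
    by (intro poly_bounded_add poly_bounded_mult poly_bounded_const poly_bounded_id)
  show "3 * length (\<sigma> 0) + 2 * length (\<sigma> 4) \<le> 3 * n + 2 * n" if "\<forall>r\<in>{0, 4}. length (\<sigma> r) \<le> n" for n and \<sigma> :: store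
    using that by auto
qed

lemma copy_valid_iff:
  assumes S: "S \<inter> {ONeg, OOr} = {}"
    and \<sigma>: "\<sigma> 0 = x" "\<sigma> 4 = [True]" "\<sigma> 5 = []" and r: "r \<noteq> 0" "r \<noteq> 4" "r \<noteq> 5"
  shows "den (copy r) \<sigma> 5 = [] \<and> den (copy r) \<sigma> 0 = [] \<longleftrightarrow> x \<in> encode ` formulas S"
proof
  assume "den (copy r) \<sigma> 5 = [] \<and> den (copy r) \<sigma> 0 = []"
  then obtain ws where "x = concat ws" "list_all2 item [True] ws"
    using copy_sound [OF r, of \<sigma>] \<sigma> by auto
  then show "x \<in> encode ` formulas S" by (auto simp: list_all2_Cons1 item_def)
next
  assume "x \<in> encode ` formulas S"
  then obtain \<phi> where \<phi>: "x = encode \<phi>" "operators \<phi> \<subseteq> S" by (auto simp: formulas_def)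
  have "den (copy r) \<sigma> = den (copy r) (\<sigma>(0 := [], r := rev (encode \<phi>) @ \<sigma> r, 4 := []))"
    by (rule copy_formula [OF r S \<phi>(2)]) (use \<sigma> \<phi> in simp_all)
  then show "den (copy r) \<sigma> 5 = [] \<and> den (copy r) \<sigma> 0 = []"
    using \<sigma> r den_copy [of r "\<sigma>(0 := [], r := rev (encode \<phi>) @ \<sigma> r, 4 := [])"] by simp
qed

end

section \<open>Membership in coNP\<close>

text \<open>\<open>flat\<close> as a list: the certificate is read along the conjuncts, so their
  order and multiplicity matter.\<close>

fun atoms :: "fm \<Rightarrow> fm list" where
  "atoms (And \<phi> \<psi>) = atoms \<phi> @ atoms \<psi>"
| "atoms \<phi> = [\<phi>]"

definition all_atoms :: "fm list \<Rightarrow> fm list" where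
  "all_atoms \<phi>s = concat (map atoms \<phi>s)"

lemma set_atoms: "set (atoms \<phi>) = flat \<phi>"
  by (induction \<phi> rule: atoms.induct) auto

lemma set_all_atoms: "set (all_atoms \<phi>s) = conjuncts (set \<phi>s)"
  by (simp add: all_atoms_def conjuncts_def set_atoms)

text \<open>
  A round goes through the conjuncts at a world. It collects the formulas that hold at the successor
  selected by the certificate, which has one bit for each diamond and each literal: it may select one
  diamond, one variable and one negated variable.
\<close>

type_synonym round_state = "word \<times> fm list \<times> bool \<times> nat option \<times> nat option"

definition chosen :: "word \<Rightarrow> bool" where
  "chosen u \<longleftrightarrow> peek u = Some True"

fun atom_step :: "fm \<Rightarrow> round_state \<Rightarrow> round_state" where
  "atom_step (Box \<psi>) (u, ns, ch, v, w) = (u, \<psi> # ns, ch, v, w)"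
| "atom_step (Dia \<psi>) (u, ns, ch, v, w) =
     (tl u, if \<not> ch \<and> chosen u then \<psi> # ns else ns, ch \<or> chosen u, v, w)"
| "atom_step (Var i) (u, ns, ch, v, w) = (tl u, ns, ch, if v = None \<and> chosen u then Some i else v, w)"
| "atom_step (BarVar i) (u, ns, ch, v, w) = (tl u, ns, ch, v, if w = None \<and> chosen u then Some i else w)"
| "atom_step _ s = s"

abbreviation round_result :: "word \<Rightarrow> fm list \<Rightarrow> round_state" where
  "round_result u \<phi>s \<equiv> fold atom_step (all_atoms \<phi>s) (u, [], False, None, None)"

text \<open>The formulas for the next world are collected in reverse, as on the stack of the
  program, hence \<open>rev ns\<close>.\<close>

inductive accepting :: "word \<Rightarrow> fm list \<Rightarrow> bool" where
  stop: "round_result u \<phi>s = (u', ns, ch, v, w) \<Longrightarrow> Fls \<in> set (all_atoms \<phi>s) \<or> (v \<noteq> None \<and> v = w)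
    \<Longrightarrow> accepting u \<phi>s"
| continue: "round_result u \<phi>s = (u', ns, True, v, w) \<Longrightarrow> accepting u' (rev ns) \<Longrightarrow> accepting u \<phi>s"

lemma fold_atom_step_sound:
  "fold atom_step as (u, [], False, None, None) = (u', ns, ch, v, w) \<Longrightarrow>
    (\<forall>i. v = Some i \<longrightarrow> Var i \<in> set as) \<and> (\<forall>i. w = Some i \<longrightarrow> BarVar i \<in> set as) \<and>
    (if ch then \<exists>\<chi>. Dia \<chi> \<in> set as \<and> set ns = insert \<chi> {\<psi>. Box \<psi> \<in> set as}
     else set ns = {\<psi>. Box \<psi> \<in> set as})"
proof (induction as arbitrary: u' ns ch v w rule: rev_induct)
  case (snoc a as)
  obtain u1 ns1 ch1 v1 w1 where s: "fold atom_step as (u, [], False, None, None) = (u1, ns1, ch1, v1, w1)"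
    by (metis prod_cases5)
  note IH = snoc.IH [OF s]
  have step: "atom_step a (u1, ns1, ch1, v1, w1) = (u', ns, ch, v, w)" using snoc.prems s by simp
  show ?case
  proof (cases "\<exists>\<chi>. a = Dia \<chi>")
    case True
    then obtain \<chi> where a: "a = Dia \<chi>" by blast
    show ?thesis
    proof (cases ch1)
      case True
      then show ?thesis using IH step a by auto
    next
      case False
      then have *: "ns = (if chosen u1 then \<chi> # ns1 else ns1)" "ch = chosen u1" "v = v1" "w = w1"
        using step a False by auto
      have "set ns1 = {\<psi>. Box \<psi> \<in> set as}" using IH False by simp
      then show ?thesis using IH * a by (cases "chosen u1") auto
    qed
  next
    case False
    then show ?thesis using IH step by (cases a) (auto split: if_splits)
  qed
qed simp

lemma accepting_sound: "accepting u \<phi>s \<Longrightarrow> \<exists>\<Delta>. dia_step\<^sup>*\<^sup>* (set \<phi>s) \<Delta> \<and> clash \<Delta>"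
proof (induction rule: accepting.induct)
  case (stop u \<phi>s u' ns ch v w)
  note s = fold_atom_step_sound [OF stop(1)]
  have "clash (set \<phi>s)"
    using stop(2) s unfolding clash_def set_all_atoms by auto
  then show ?case by blast
next
  case (continue u \<phi>s u' ns v w)
  obtain \<chi> where "Dia \<chi> \<in> set (all_atoms \<phi>s)" "set ns = insert \<chi> {\<psi>. Box \<psi> \<in> set (all_atoms \<phi>s)}"
    using fold_atom_step_sound [OF continue(1)] by auto
  then have "dia_step (set \<phi>s) (set (rev ns))"
    unfolding dia_step_def set_all_atoms by auto
  then show ?case using continue.IH by (meson converse_rtranclp_into_rtranclp)
qed

definition guesses :: "fm \<Rightarrow> bool" where
  "guesses a \<longleftrightarrow> (\<exists>\<psi> i. a = Dia \<psi> \<or> a = Var i \<or> a = BarVar i)"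

lemma guesses_simps [simp]: "guesses (Dia \<psi>)" "guesses (Var i)" "guesses (BarVar i)" "\<not> guesses (Box \<psi>)"
  "\<not> guesses (And \<phi> \<psi>)" "\<not> guesses (Or \<phi> \<psi>)" "\<not> guesses (Neg \<phi>)" "\<not> guesses Tru" "\<not> guesses Fls"
  by (auto simp: guesses_def)

lemma chosen_Cons [simp]: "chosen (b # u) = b"
  by (simp add: chosen_def)

text \<open>The certificate has its bit set at every occurrence of \<open>Dia \<chi>\<close>, and
  \<open>ch\<close> lets only the first one count. Exactly these bits are consumed, which leaves
  \<open>rest\<close> for the later rounds.\<close>

lemma fold_choose_dia:
  "\<exists>ns' v' w'. fold atom_step as (map (\<lambda>a. a = Dia \<chi>) (filter guesses as) @ rest, ns, ch, v, w) =
      (rest, ns', ch \<or> Dia \<chi> \<in> set as, v', w') \<and>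
    set ns' = set ns \<union> {\<psi>. Box \<psi> \<in> set as} \<union> (if \<not> ch \<and> Dia \<chi> \<in> set as then {\<chi>} else {})"
proof (induction as arbitrary: ns ch v w)
  case (Cons a as)
  obtain u1 ns1 ch1 v1 w1 where s0: "atom_step a (map (\<lambda>a. a = Dia \<chi>) (filter guesses (a # as)) @ rest, ns, ch, v, w) =
      (u1, ns1, ch1, v1, w1)"
    by (rule prod_cases5)
  have u1: "u1 = map (\<lambda>a. a = Dia \<chi>) (filter guesses as) @ rest" and n: "ch1 = (ch \<or> a = Dia \<chi>)"
      "set ns1 = set ns \<union> {\<psi>. a = Box \<psi>} \<union> (if \<not> ch \<and> a = Dia \<chi> then {\<chi>} else {})"
    using s0 by (cases a; auto split: if_splits)+
  note s = s0 [unfolded u1]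
  obtain ns' v' w' where IH: "fold atom_step as (map (\<lambda>a. a = Dia \<chi>) (filter guesses as) @ rest, ns1, ch1, v1, w1) =
      (rest, ns', ch1 \<or> Dia \<chi> \<in> set as, v', w')"
    "set ns' = set ns1 \<union> {\<psi>. Box \<psi> \<in> set as} \<union> (if \<not> ch1 \<and> Dia \<chi> \<in> set as then {\<chi>} else {})"
    using Cons.IH by blast
  have "fold atom_step (a # as) (map (\<lambda>a. a = Dia \<chi>) (filter guesses (a # as)) @ rest, ns, ch, v, w) =
      (rest, ns', ch1 \<or> Dia \<chi> \<in> set as, v', w')"
    unfolding fold_simps s by (rule IH(1))
  moreover have "(ch1 \<or> Dia \<chi> \<in> set as) = (ch \<or> Dia \<chi> \<in> set (a # as))" unfolding n(1) by auto
  ultimately have "fold atom_step (a # as) (map (\<lambda>a. a = Dia \<chi>) (filter guesses (a # as)) @ rest, ns, ch, v, w) =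
      (rest, ns', ch \<or> Dia \<chi> \<in> set (a # as), v', w')" by (simp only:)
  moreover have "set ns' = set ns \<union> {\<psi>. Box \<psi> \<in> set (a # as)} \<union> (if \<not> ch \<and> Dia \<chi> \<in> set (a # as) then {\<chi>} else {})"
    unfolding IH(2) n by auto
  ultimately show ?case by blast
qed simp

lemma fold_choose_literals:
  "\<exists>ns' ch'. fold atom_step as (map (\<lambda>a. a = Var i \<or> a = BarVar i) (filter guesses as) @ rest, ns, ch, v, w) =
    (rest, ns', ch', if v = None \<and> Var i \<in> set as then Some i else v,
      if w = None \<and> BarVar i \<in> set as then Some i else w)"
proof (induction as arbitrary: ns ch v w)
  case (Cons a as)
  let ?u = "\<lambda>as. map (\<lambda>a. a = Var i \<or> a = BarVar i) (filter guesses as) @ rest"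
  obtain u1 ns1 ch1 v1 w1 where s0: "atom_step a (?u (a # as), ns, ch, v, w) = (u1, ns1, ch1, v1, w1)"
    by (rule prod_cases5 [of "atom_step a (?u (a # as), ns, ch, v, w)"])
  have "u1 = ?u as \<and> v1 = (if v = None \<and> a = Var i then Some i else v) \<and>
      w1 = (if w = None \<and> a = BarVar i then Some i else w)"
    using s0 by (cases a) (auto split: if_splits)
  then have u1: "u1 = ?u as" and v1: "v1 = (if v = None \<and> a = Var i then Some i else v)"
    and w1: "w1 = (if w = None \<and> a = BarVar i then Some i else w)" by simp_all
  note s = s0 [unfolded u1]
  obtain ns' ch' where IH: "fold atom_step as (?u as, ns1, ch1, v1, w1) =
    (rest, ns', ch', if v1 = None \<and> Var i \<in> set as then Some i else v1,
      if w1 = None \<and> BarVar i \<in> set as then Some i else w1)"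
    using Cons.IH [of ns1 ch1 v1 w1] by (elim exE) (rule that)
  have "(if v1 = None \<and> Var i \<in> set as then Some i else v1) =
      (if v = None \<and> Var i \<in> set (a # as) then Some i else v)"
    unfolding v1 by (cases v) auto
  moreover have "(if w1 = None \<and> BarVar i \<in> set as then Some i else w1) =
      (if w = None \<and> BarVar i \<in> set (a # as) then Some i else w)"
    unfolding w1 by (cases w) auto
  ultimately have "fold atom_step (a # as) (?u (a # as), ns, ch, v, w) = (rest, ns', ch',
      if v = None \<and> Var i \<in> set (a # as) then Some i else v,
      if w = None \<and> BarVar i \<in> set (a # as) then Some i else w)"
    using IH by (simp only: fold_simps s)
  then show ?case by blast
qed simp

definition total_len :: "fm list \<Rightarrow> nat" where
  "total_len \<phi>s = (\<Sum>\<phi>\<leftarrow>\<phi>s. length (encode \<phi>))"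

lemma total_len_simps [simp]: "total_len [] = 0" "total_len (\<phi> # \<phi>s) = length (encode \<phi>) + total_len \<phi>s"
  "total_len (\<phi>s @ \<psi>s) = total_len \<phi>s + total_len \<psi>s" "total_len (rev \<phi>s) = total_len \<phi>s"
  by (simp_all add: total_len_def rev_map [symmetric] sum_list_rev)

lemma encode_nonempty: "0 < length (encode \<phi>)"
  by (cases \<phi>) auto

lemma total_atoms: "total_len (atoms \<phi>) \<le> length (encode \<phi>)"
  by (induction \<phi> rule: atoms.induct) auto

lemma total_all_atoms: "total_len (all_atoms \<phi>s) \<le> total_len \<phi>s"
  unfolding all_atoms_def by (induction \<phi>s) (auto intro: add_mono total_atoms)

lemma length_le_total: "length \<phi>s \<le> total_len \<phi>s"
proof (induction \<phi>s)
  case (Cons \<phi> \<phi>s)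
  then show ?case unfolding total_len_def list.map sum_list.Cons list.size
    using encode_nonempty [of \<phi>] by linarith
qed simp

text \<open>A selected diamond loses its own token, which pays for \<open>of_bool ch'\<close>. So a
  round that moves to a successor makes the total length strictly smaller; this bounds both the
  certificate and the running time.\<close>

lemma fold_atom_step_total:
  "fold atom_step as (u, ns, ch, v, w) = (u', ns', ch', v', w') \<Longrightarrow>
    total_len ns' + of_bool ch' \<le> total_len ns + of_bool ch + total_len as \<and> length u' \<le> length u \<and>
    (\<forall>\<phi>\<in>set ns'. \<phi> \<in> set ns \<or> (\<exists>a\<in>set as. operators \<phi> \<subseteq> operators a))"
proof (induction as arbitrary: u ns ch v w)
  case (Cons a as)
  obtain u1 ns1 ch1 v1 w1 where s: "atom_step a (u, ns, ch, v, w) = (u1, ns1, ch1, v1, w1)"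
    by (metis prod_cases5)
  have IH: "total_len ns' + of_bool ch' \<le> total_len ns1 + of_bool ch1 + total_len as \<and> length u' \<le> length u1 \<and>
    (\<forall>\<phi>\<in>set ns'. \<phi> \<in> set ns1 \<or> (\<exists>a\<in>set as. operators \<phi> \<subseteq> operators a))"
    using Cons.prems unfolding fold_simps s by (rule Cons.IH)
  have "total_len ns1 + of_bool ch1 \<le> total_len ns + of_bool ch + length (encode a) \<and> length u1 \<le> length u"
    using s encode_nonempty [of a] by (cases a) (auto split: if_splits)
  moreover have "\<phi> \<in> set ns \<or> operators \<phi> \<subseteq> operators a" if "\<phi> \<in> set ns1" for \<phi>
    using s that by (cases a) (auto split: if_splits)
  ultimately show ?case using IH by fastforce
qed simp

lemma operators_atoms: "a \<in> set (atoms \<phi>) \<Longrightarrow> operators a \<subseteq> operators \<phi>"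
  by (induction \<phi> rule: atoms.induct) auto

lemma round_result_bounds:
  assumes "round_result u \<phi>s = (u', ns, ch, v, w)"
  shows "total_len ns + of_bool ch \<le> total_len \<phi>s" "length u' \<le> length u"
    "\<forall>\<phi>\<in>set \<phi>s. operators \<phi> \<subseteq> S \<Longrightarrow> \<forall>\<phi>\<in>set ns. operators \<phi> \<subseteq> S"
proof -
  note f = fold_atom_step_total [OF assms]
  show "total_len ns + of_bool ch \<le> total_len \<phi>s" using f total_all_atoms [of \<phi>s] by simp
  show "length u' \<le> length u" using f by simp
  assume "\<forall>\<phi>\<in>set \<phi>s. operators \<phi> \<subseteq> S"
  then have "operators a \<subseteq> S" if "a \<in> set (all_atoms \<phi>s)" for a
    using that operators_atoms unfolding all_atoms_def by fastforce
  then show "\<forall>\<phi>\<in>set ns. operators \<phi> \<subseteq> S" using f by fastforce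
qed

text \<open>A round reads at most one bit per conjunct, and moving on lowers the total length, so
  the number of rounds is also bounded by the total length; hence the square.\<close>

lemma accepting_complete:
  assumes "dia_step\<^sup>*\<^sup>* \<Gamma> \<Delta>" "clash \<Delta>"
  shows "set \<phi>s = \<Gamma> \<Longrightarrow> \<exists>u. length u \<le> total_len \<phi>s * total_len \<phi>s \<and> accepting u \<phi>s"
  using assms(1)
proof (induction arbitrary: \<phi>s rule: converse_rtranclp_induct)
  case base
  have a: "set (all_atoms \<phi>s) = conjuncts \<Delta>" using base by (simp add: set_all_atoms)
  have len: "length (map f (filter guesses (all_atoms \<phi>s))) \<le> total_len \<phi>s * total_len \<phi>s" for f :: "fm \<Rightarrow> bool"
  proof -
    have "length (map f (filter guesses (all_atoms \<phi>s))) \<le> length (all_atoms \<phi>s)" by simp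
    also have "\<dots> \<le> total_len \<phi>s" using length_le_total total_all_atoms order_trans by blast
    also have "\<dots> \<le> total_len \<phi>s * total_len \<phi>s" by simp
    finally show ?thesis .
  qed
  consider "Fls \<in> conjuncts \<Delta>" | i where "Var i \<in> conjuncts \<Delta>" "BarVar i \<in> conjuncts \<Delta>"
    using assms(2) unfolding clash_def by blast
  then show ?case
  proof cases
    case 1
    obtain u' ns ch v w where r: "round_result [] \<phi>s = (u', ns, ch, v, w)" by (rule prod_cases5)
    have "accepting [] \<phi>s" by (rule stop [OF r]) (use 1 a in simp)
    then show ?thesis by (intro exI [of _ "[]"]) simp
  next
    case (2 i)
    let ?u = "map (\<lambda>a. a = Var i \<or> a = BarVar i) (filter guesses (all_atoms \<phi>s))"
    obtain ns ch where r: "round_result ?u \<phi>s = ([], ns, ch, Some i, Some i)"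
      using fold_choose_literals [of "all_atoms \<phi>s" i "[]" "[]" False None None] 2 a by auto
    have "accepting ?u \<phi>s" by (rule stop [OF r]) simp
    then show ?thesis using len by blast
  qed
next
  case (step \<Gamma> \<Gamma>')
  obtain \<chi> where \<chi>: "Dia \<chi> \<in> conjuncts \<Gamma>" "\<Gamma>' = insert \<chi> {\<psi>. Box \<psi> \<in> conjuncts \<Gamma>}"
    using step.hyps(1) by (auto simp: dia_step_def)
  have a: "set (all_atoms \<phi>s) = conjuncts \<Gamma>" using step.prems by (simp add: set_all_atoms)
  let ?u = "map (\<lambda>a. a = Dia \<chi>) (filter guesses (all_atoms \<phi>s))"
  have r: "\<exists>ns v w. round_result (?u @ rest) \<phi>s = (rest, ns, True, v, w) \<and> set ns = \<Gamma>'" for rest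
    using fold_choose_dia [of "all_atoms \<phi>s" \<chi> rest "[]" False None None] \<chi> a by auto
  obtain ns0 v0 w0 where r0: "round_result (?u @ []) \<phi>s = ([], ns0, True, v0, w0)" "set ns0 = \<Gamma>'"
    using r [of "[]"] by blast
  \<comment> \<open>The certificate for the later rounds comes from the induction hypothesis at
    \<open>ns0\<close>, so the formulas passed on must not depend on what follows the bits of this
    round.\<close>
  have ns_eq: "fst (snd (round_result (?u @ rest) \<phi>s)) = ns0" for rest
  proof -
    have "fst (snd (fold atom_step as (map (\<lambda>a. a = Dia \<chi>) (filter guesses as) @ rest, ns, ch, v, w))) =
        fst (snd (fold atom_step as (map (\<lambda>a. a = Dia \<chi>) (filter guesses as) @ rest', ns, ch, v, w)))"
      for as rest rest' ns ch v w
    proof (induction as arbitrary: ns ch v w)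
      case (Cons a as)
      then show ?case by (cases a) simp_all
    qed simp
    from this [of "all_atoms \<phi>s" rest "[]" False None None "[]"] show ?thesis
      using r0(1) by simp
  qed
  obtain u where u: "length u \<le> total_len (rev ns0) * total_len (rev ns0)" "accepting u (rev ns0)"
    using step.IH [of "rev ns0"] r0(2) by auto
  obtain ns v w where ru: "round_result (?u @ u) \<phi>s = (u, ns, True, v, w)" using r [of u] by blast
  have "ns = ns0" using ns_eq [of u] unfolding ru by simp
  then have "accepting (?u @ u) \<phi>s" using u(2) by (intro continue [OF ru]) simp
  moreover have "length (?u @ u) \<le> total_len \<phi>s * total_len \<phi>s"
  proof -
    have "length ?u \<le> length (all_atoms \<phi>s)" by simp
    also have "\<dots> \<le> total_len \<phi>s" using length_le_total total_all_atoms order_trans by blast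
    finally have 1: "length ?u \<le> total_len \<phi>s" .
    have 2: "total_len ns0 + 1 \<le> total_len \<phi>s" using round_result_bounds(1) [OF r0(1)] by simp
    then obtain k where k: "total_len \<phi>s = total_len ns0 + 1 + k" using le_Suc_ex by blast
    have "n * n + (n + 1 + k) \<le> (n + 1 + k) * (n + 1 + k)" for n :: nat by (simp add: algebra_simps)
    then have "total_len ns0 * total_len ns0 + total_len \<phi>s \<le> total_len \<phi>s * total_len \<phi>s" unfolding k .
    then show ?thesis using 1 u(1) by simp
  qed
  ultimately show ?case by blast
qed

lemma unsat_iff_accepting:
  assumes "operators \<phi> \<inter> {ONeg, OOr} = {}"
  shows "\<not> satisfiable \<phi> \<longleftrightarrow> (\<exists>u. length u \<le> length (encode \<phi>) * length (encode \<phi>) \<and> accepting u [\<phi>])"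
proof -
  have "\<exists>u. length u \<le> length (encode \<phi>) * length (encode \<phi>) \<and> accepting u [\<phi>]"
    if "dia_step\<^sup>*\<^sup>* {\<phi>} \<Delta>" "clash \<Delta>" for \<Delta>
    using accepting_complete [OF that, of "[\<phi>]"] by simp
  moreover have "\<exists>\<Delta>. dia_step\<^sup>*\<^sup>* {\<phi>} \<Delta> \<and> clash \<Delta>" if "accepting u [\<phi>]" for u
    using accepting_sound [OF that] by simp
  ultimately show ?thesis unfolding unsat_iff_clash_reachable [OF assms] by blast
qed

section \<open>The program checking certificates\<close>

text \<open>
  Registers, besides those of \<open>copy\<close>: 1 certificate, 2 formulas for the next round (reversed), 3 waste,
  6 whether a diamond has been selected, 7 and 8 the selected literals, 9 non-empty after acceptance,
  10 scratch, 11 output.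
\<close>

definition word_of_index :: "nat option \<Rightarrow> word" where
  "word_of_index v = (case v of None \<Rightarrow> [] | Some i \<Rightarrow> rev (encode_nat i))"

lemma encode_nat_nonempty: "encode_nat n \<noteq> []"
  by (cases "n = 0") (simp_all add: encode_nat_0 encode_nat_pos)

lemma word_of_index_inj: "word_of_index v = word_of_index w \<longleftrightarrow> v = w"
  using encode_nat_prefix_free [of _ "[]" _ "[]"] encode_nat_nonempty
  by (auto simp: word_of_index_def split: option.splits)

lemma word_of_index_Nil [simp]: "word_of_index v = [] \<longleftrightarrow> v = None"
  using encode_nat_nonempty by (simp add: word_of_index_def split: option.splits)

lemma word_of_index_simps [simp]: "word_of_index None = []" "word_of_index (Some i) = rev (encode_nat i)"
  by (simp_all add: word_of_index_def)

definition encode_list :: "fm list \<Rightarrow> word" where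
  "encode_list \<phi>s = concat (map encode \<phi>s)"

lemma encode_list_simps [simp]: "encode_list [] = []" "encode_list (\<phi> # \<phi>s) = encode \<phi> @ encode_list \<phi>s"
  "encode_list (\<phi>s @ \<psi>s) = encode_list \<phi>s @ encode_list \<psi>s"
  by (simp_all add: encode_list_def)

lemma length_encode_list: "length (encode_list \<phi>s) = total_len \<phi>s"
  by (induction \<phi>s) simp_all

text \<open>Register 2 receives the encodings in the order of collection, each of them reversed;
  read backwards it spells the formulas from first to last.\<close>

definition represents_state :: "store \<Rightarrow> round_state \<Rightarrow> bool \<Rightarrow> bool" where
  "represents_state \<sigma> s f \<longleftrightarrow> (case s of (u, ns, ch, v, w) \<Rightarrow>
     \<sigma> 1 = u \<and> rev (\<sigma> 2) = encode_list (rev ns) \<and> \<sigma> 4 = [] \<and> \<sigma> 6 = (if ch then [True] else []) \<and>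
     \<sigma> 7 = word_of_index v \<and> \<sigma> 8 = word_of_index w \<and> (\<sigma> 9 \<noteq> [] \<longleftrightarrow> f) \<and> \<sigma> 10 = [] \<and> \<sigma> 11 = [])"

definition clear :: "nat \<Rightarrow> prog" where
  "clear r = Loop r (- {None}) (Pop r)"

lemma den_clear: "den (clear r) \<sigma> = \<sigma>(r := [])"
proof (induction "\<sigma> r" arbitrary: \<sigma>)
  case Nil
  then have "\<sigma> r = []" by simp
  then show ?case unfolding clear_def by (subst den_Loop) (simp add: fun_eq_iff)
next
  case (Cons b w)
  then have r: "\<sigma> r = b # w" by simp
  have "den (clear r) \<sigma> = den (clear r) (\<sigma>(r := w))"
    unfolding clear_def by (subst den_Loop) (use r in simp)
  also have "\<dots> = \<sigma>(r := [])" by (subst Cons.hyps(1)) simp_all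
  finally show ?case .
qed

lemma polytime_on_pop_loop:
  assumes "loop_free P" "\<And>\<sigma>. \<sigma> r \<noteq> [] \<Longrightarrow> den P \<sigma> r = tl (\<sigma> r)"
  shows "polytime_on {r} D (Loop r (- {None}) P)"
proof (rule polytime_on_True, rule polytime_on_Loop [where \<Phi> = "\<lambda>\<sigma>. length (\<sigma> r)" and b = "\<lambda>n. n"])
  fix \<sigma> :: store and i
  assume "peek (\<sigma> r) \<in> - {None}"
  then have "\<sigma> r \<noteq> []" by auto
  with assms(2) [of \<sigma>] show "True \<and> length (den P \<sigma> r) < length (\<sigma> r)"
    and "i \<in> {r} \<Longrightarrow> length (den P \<sigma> i) \<le> max (length (\<sigma> i)) (length (\<sigma> r))"
    by auto
qed (simp_all add: polytime_on_loop_free assms(1) poly_bounded_id)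

definition compare_step :: prog where
  "compare_step = Test 7 {Some True} (Test 8 {Some True} Skip (Push 10 True))
     (Test 8 {Some False} Skip (Push 10 True)) ;; Pop 7 ;; Pop 8"

definition compare_loop :: prog where "compare_loop = Loop 7 (- {None}) compare_step"

definition excess_loop :: prog where "excess_loop = Loop 8 (- {None}) (Pop 8 ;; Push 10 True)"

lemma den_compare_step:
  assumes "\<sigma> 7 = b # x"
  shows "den compare_step \<sigma> = \<sigma>(7 := x, 8 := tl (\<sigma> 8), 10 := if peek (\<sigma> 8) = Some b then \<sigma> 10 else True # \<sigma> 10)"
  using assms by (cases b; cases "\<sigma> 8") (auto simp: compare_step_def fun_eq_iff)

lemma den_compare_loop:
  "\<exists>p q. den compare_loop \<sigma> = \<sigma>(7 := [], 8 := p, 10 := q) \<and> (p = [] \<and> q = [] \<longleftrightarrow> \<sigma> 10 = [] \<and> \<sigma> 7 = \<sigma> 8)"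
proof (induction "\<sigma> 7" arbitrary: \<sigma>)
  case Nil
  then have "\<sigma> 7 = []" by simp
  then have "den compare_loop \<sigma> = \<sigma>(7 := [], 8 := \<sigma> 8, 10 := \<sigma> 10)"
    unfolding compare_loop_def by (subst den_Loop) (simp add: fun_eq_iff)
  with \<open>\<sigma> 7 = []\<close> show ?case by (intro exI [of _ "\<sigma> 8"] exI [of _ "\<sigma> 10"]) auto
next
  case (Cons b x)
  then have 7: "\<sigma> 7 = b # x" by simp
  define \<sigma>' where "\<sigma>' = \<sigma>(7 := x, 8 := tl (\<sigma> 8), 10 := if peek (\<sigma> 8) = Some b then \<sigma> 10 else True # \<sigma> 10)"
  have "den compare_loop \<sigma> = den compare_loop \<sigma>'"
    unfolding compare_loop_def \<sigma>'_def den_compare_step [of \<sigma>, OF 7, symmetric] by (subst den_Loop) (use 7 in simp)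
  moreover obtain p q where pq: "den compare_loop \<sigma>' = \<sigma>'(7 := [], 8 := p, 10 := q)"
    "p = [] \<and> q = [] \<longleftrightarrow> \<sigma>' 10 = [] \<and> \<sigma>' 7 = \<sigma>' 8"
    using Cons.hyps(1) [of \<sigma>'] by (auto simp: \<sigma>'_def)
  moreover have "\<sigma>'(7 := [], 8 := p, 10 := q) = \<sigma>(7 := [], 8 := p, 10 := q)"
    by (simp add: \<sigma>'_def fun_eq_iff)
  moreover have "\<sigma>' 10 = [] \<and> \<sigma>' 7 = \<sigma>' 8 \<longleftrightarrow> \<sigma> 10 = [] \<and> \<sigma> 7 = \<sigma> 8"
    using 7 by (cases "\<sigma> 8") (auto simp: \<sigma>'_def)
  ultimately show ?case by (intro exI [of _ p] exI [of _ q]) simp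
qed

lemma den_excess_loop:
  "\<exists>q. den excess_loop \<sigma> = \<sigma>(8 := [], 10 := q) \<and> (q = [] \<longleftrightarrow> \<sigma> 10 = [] \<and> \<sigma> 8 = [])"
proof (induction "\<sigma> 8" arbitrary: \<sigma>)
  case Nil
  then have "\<sigma> 8 = []" by simp
  then have "den excess_loop \<sigma> = \<sigma>(8 := [], 10 := \<sigma> 10)"
    unfolding excess_loop_def by (subst den_Loop) (simp add: fun_eq_iff)
  with \<open>\<sigma> 8 = []\<close> show ?case by (intro exI [of _ "\<sigma> 10"]) auto
next
  case (Cons b x)
  then have 8: "\<sigma> 8 = b # x" by simp
  define \<sigma>' where "\<sigma>' = \<sigma>(8 := x, 10 := True # \<sigma> 10)"
  have "den excess_loop \<sigma> = den excess_loop \<sigma>'"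
    unfolding excess_loop_def \<sigma>'_def by (subst den_Loop) (use 8 in simp)
  moreover obtain q where q: "den excess_loop \<sigma>' = \<sigma>'(8 := [], 10 := q)" "q = [] \<longleftrightarrow> \<sigma>' 10 = [] \<and> \<sigma>' 8 = []"
    using Cons.hyps(1) [of \<sigma>'] by (auto simp: \<sigma>'_def)
  moreover have "\<sigma>'(8 := [], 10 := q) = \<sigma>(8 := [], 10 := q)" by (simp add: \<sigma>'_def fun_eq_iff)
  moreover have "\<sigma>' 10 \<noteq> []" by (simp add: \<sigma>'_def)
  ultimately show ?case using 8 by (intro exI [of _ q]) simp
qed

text \<open>Register 10 records every mismatch, including symbols of register 8 beyond the end of
  register 7. If register 7 is empty, no variable was selected and no clash is concluded.\<close>

definition check :: prog where
  "check = Test 7 {None} (clear 8) (compare_loop ;; excess_loop ;; Test 10 {None} (Push 9 True) (clear 10))"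

lemma den_check:
  assumes "\<sigma> 10 = []"
  shows "\<exists>a. den check \<sigma> = \<sigma>(7 := [], 8 := [], 10 := [], 9 := a) \<and>
    (a \<noteq> [] \<longleftrightarrow> \<sigma> 9 \<noteq> [] \<or> (\<sigma> 7 \<noteq> [] \<and> \<sigma> 7 = \<sigma> 8))"
proof (cases "\<sigma> 7 = []")
  case True
  then show ?thesis using assms
    by (intro exI [of _ "\<sigma> 9"]) (simp add: check_def den_clear fun_eq_iff)
next
  case False
  obtain p q where pq: "den compare_loop \<sigma> = \<sigma>(7 := [], 8 := p, 10 := q)"
    "p = [] \<and> q = [] \<longleftrightarrow> \<sigma> 10 = [] \<and> \<sigma> 7 = \<sigma> 8" using den_compare_loop [of \<sigma>] by blast
  obtain q' where q': "den excess_loop (\<sigma>(7 := [], 8 := p, 10 := q)) = \<sigma>(7 := [], 8 := p, 10 := q, 8 := [], 10 := q')"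
    "q' = [] \<longleftrightarrow> q = [] \<and> p = []"
    using den_excess_loop [of "\<sigma>(7 := [], 8 := p, 10 := q)"] by auto
  have eq: "den check \<sigma> = den (Test 10 {None} (Push 9 True) (clear 10)) (\<sigma>(7 := [], 8 := p, 10 := q, 8 := [], 10 := q'))"
    using False by (simp add: check_def pq(1) q'(1) del: fun_upd_apply)
  show ?thesis
  proof (cases "q' = []")
    case True
    then show ?thesis using pq(2) q'(2) assms False unfolding eq
      by (intro exI [of _ "True # \<sigma> 9"]) (simp add: fun_eq_iff)
  next
    case False
    then show ?thesis using pq(2) q'(2) assms unfolding eq
      by (intro exI [of _ "\<sigma> 9"]) (auto simp: fun_eq_iff den_clear)
  qed
qed

lemma polytime_on_check: "polytime_on {7, 8, 10} D check"
proof (rule polytime_on_True)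
  have c: "polytime_on {7, 8, 10} D (clear r)" if "r \<in> {7, 8, 10}" for r D
    unfolding clear_def by (rule polytime_on_weaken [OF polytime_on_pop_loop]) (use that in auto)
  have 1: "polytime_on {7, 8, 10} D compare_loop" for D
    unfolding compare_loop_def
  proof (rule polytime_on_weaken [OF polytime_on_pop_loop])
    show "den compare_step \<sigma> 7 = tl (\<sigma> 7)" if "\<sigma> 7 \<noteq> []" for \<sigma>
      using that by (cases "\<sigma> 7") (simp_all add: den_compare_step)
  qed (auto simp: compare_step_def)
  have 2: "polytime_on {7, 8, 10} D excess_loop" for D
    unfolding excess_loop_def by (rule polytime_on_weaken [OF polytime_on_pop_loop]) auto
  show "polytime_on {7, 8, 10} (\<lambda>_. True) check"
    unfolding check_def
    by (intro polytime_on_Test polytime_on_Seq [where D' = "\<lambda>_. True"] c 1 2 polytime_on_Push) simp_all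
qed

context
  fixes S :: "operator set"
  assumes S: "S \<inter> {ONeg, OOr} = {}"
begin

definition take_item :: "bool \<Rightarrow> nat \<Rightarrow> prog" where
  "take_item c r = Push 4 c ;; copy S r"

lemma den_take_item:
  assumes r: "r \<noteq> 0" "r \<noteq> 4" "r \<noteq> 5" and \<sigma>: "\<sigma> 4 = []"
  shows "operators \<phi> \<subseteq> S \<Longrightarrow> \<sigma> 0 = encode \<phi> @ w \<Longrightarrow>
      den (take_item True r) \<sigma> = \<sigma>(0 := w, r := rev (encode \<phi>) @ \<sigma> r)"
    and "\<sigma> 0 = encode_nat n @ w \<Longrightarrow> den (take_item False r) \<sigma> = \<sigma>(0 := w, r := rev (encode_nat n) @ \<sigma> r)"
proof -
  assume \<phi>: "operators \<phi> \<subseteq> S" "\<sigma> 0 = encode \<phi> @ w"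
  let ?\<sigma> = "\<sigma>(0 := w, r := rev (encode \<phi>) @ \<sigma> r)"
  have "den (take_item True r) \<sigma> = den (copy S r) ?\<sigma>"
    unfolding take_item_def den.simps(4)
    by (rule copy_formula [OF r S \<phi>(1), where w = w and cs = "[]"]) (use r \<sigma> \<phi>(2) in \<open>simp_all add: fun_eq_iff\<close>)
  then show "den (take_item True r) \<sigma> = ?\<sigma>" using den_copy [of S r ?\<sigma>] r \<sigma> by simp
next
  assume n: "\<sigma> 0 = encode_nat n @ w"
  let ?\<sigma> = "\<sigma>(0 := w, r := rev (encode_nat n) @ \<sigma> r)"
  have "den (take_item False r) \<sigma> = den (copy S r) ?\<sigma>"
    unfolding take_item_def den.simps(4)
    by (rule copy_index [OF r, where n = n and w = w and cs = "[]"]) (use r \<sigma> n in \<open>simp_all add: fun_eq_iff\<close>)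
  then show "den (take_item False r) \<sigma> = ?\<sigma>" using den_copy [of S r ?\<sigma>] r \<sigma> by simp
qed

text \<open>An index that is not selected goes to the waste register 3, since the text has to be
  consumed in any case.\<close>

definition literal :: "nat \<Rightarrow> prog" where
  "literal r = Test 1 {Some True} (Test r {None} (take_item False r) (take_item False 3)) (take_item False 3) ;; Pop 1"

definition diamond :: prog where
  "diamond = Test 1 {Some True} (Test 6 {None} (Push 6 True ;; take_item True 2) (take_item True 3))
     (take_item True 3) ;; Pop 1"

text \<open>Conjunctions are flattened by skipping their token: in Polish notation the conjuncts
  then follow one after the other.\<close>

fun handle :: "bool \<Rightarrow> bool \<Rightarrow> bool \<Rightarrow> bool \<Rightarrow> prog" where
  "handle False False False False = literal 7"
| "handle False False False True = literal 8"
| "handle False True False True = take_item True 2"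
| "handle False True True False = diamond"
| "handle True False False False = Push 9 True"
| "handle _ _ _ _ = Skip"

definition round_step :: prog where "round_step = read_token 3 handle"

definition round_loop :: prog where "round_loop = Loop 0 (- {None}) round_step"

lemma round_loop_token:
  assumes "\<sigma> 0 = a # b # c # d # w"
  shows "den round_loop \<sigma> = den round_loop (den (handle a b c d) (\<sigma>(0 := w, 3 := d # c # b # a # \<sigma> 3)))"
proof -
  have "den round_step \<sigma> = den (handle a b c d) (\<sigma>(0 := w, 3 := d # c # b # a # \<sigma> 3))"
    using assms by (simp add: round_step_def den_read_token)
  then show ?thesis unfolding round_loop_def by (subst den_Loop) (use assms in simp)
qed

lemma den_literal:
  assumes "\<sigma> 0 = encode_nat i @ w" "\<sigma> 4 = []" "r \<in> {7, 8}"
  shows "\<exists>z. den (literal r) \<sigma> = \<sigma>(0 := w, 3 := z, 1 := tl (\<sigma> 1),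
    r := if \<sigma> r = [] \<and> chosen (\<sigma> 1) then rev (encode_nat i) else \<sigma> r)"
proof (cases "\<sigma> r = [] \<and> chosen (\<sigma> 1)")
  case True
  then have "den (literal r) \<sigma> = \<sigma>(0 := w, 3 := \<sigma> 3, 1 := tl (\<sigma> 1), r := rev (encode_nat i))"
    using assms by (auto simp: literal_def chosen_def den_take_item(2) [where n = i and w = w] fun_eq_iff)
  with True show ?thesis by (intro exI [of _ "\<sigma> 3"]) simp
next
  case False
  then have "den (literal r) \<sigma> = \<sigma>(0 := w, 3 := rev (encode_nat i) @ \<sigma> 3, 1 := tl (\<sigma> 1), r := \<sigma> r)"
    using assms by (auto simp: literal_def chosen_def den_take_item(2) [where n = i and w = w] fun_eq_iff)
  with False show ?thesis by (intro exI [of _ "rev (encode_nat i) @ \<sigma> 3"]) (simp only: if_False)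
qed

lemma den_diamond:
  assumes "\<sigma> 0 = encode \<phi> @ w" "\<sigma> 4 = []" "operators \<phi> \<subseteq> S"
  shows "\<exists>z. den diamond \<sigma> = \<sigma>(0 := w, 3 := z, 1 := tl (\<sigma> 1),
    6 := if \<sigma> 6 = [] \<and> chosen (\<sigma> 1) then [True] else \<sigma> 6,
    2 := if \<sigma> 6 = [] \<and> chosen (\<sigma> 1) then rev (encode \<phi>) @ \<sigma> 2 else \<sigma> 2)"
proof (cases "\<sigma> 6 = [] \<and> chosen (\<sigma> 1)")
  case True
  then have "den diamond \<sigma> = \<sigma>(0 := w, 3 := \<sigma> 3, 1 := tl (\<sigma> 1), 6 := [True], 2 := rev (encode \<phi>) @ \<sigma> 2)"
    using assms by (auto simp: diamond_def chosen_def den_take_item(1) [where \<phi> = \<phi> and w = w] fun_eq_iff)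
  with True show ?thesis by (intro exI [of _ "\<sigma> 3"]) simp
next
  case False
  then have "den diamond \<sigma> = \<sigma>(0 := w, 3 := rev (encode \<phi>) @ \<sigma> 3, 1 := tl (\<sigma> 1), 6 := \<sigma> 6, 2 := \<sigma> 2)"
    using assms by (auto simp: diamond_def chosen_def den_take_item(1) [where \<phi> = \<phi> and w = w] fun_eq_iff)
  with False show ?thesis by (intro exI [of _ "rev (encode \<phi>) @ \<sigma> 3"]) (simp only: if_False)
qed

lemma round_loop_formula:
  "operators \<phi> \<subseteq> S \<Longrightarrow> \<sigma> 0 = encode \<phi> @ w \<Longrightarrow> represents_state \<sigma> s f \<Longrightarrow>
    \<exists>\<sigma>'. den round_loop \<sigma> = den round_loop \<sigma>' \<and> \<sigma>' 0 = w \<and>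
      represents_state \<sigma>' (fold atom_step (atoms \<phi>) s) (f \<or> Fls \<in> set (atoms \<phi>))"
proof (induction \<phi> arbitrary: \<sigma> w s f)
  case (Var i)
  obtain u ns ch v w' where s: "s = (u, ns, ch, v, w')" by (rule prod_cases5)
  let ?\<sigma> = "\<sigma>(0 := encode_nat i @ w, 3 := [False, False, False, False] @ \<sigma> 3)"
  note r = Var.prems(3) [unfolded represents_state_def s prod.case]
  have l: "den round_loop \<sigma> = den round_loop (den (literal 7) ?\<sigma>)"
    using round_loop_token [of \<sigma> False False False False "encode_nat i @ w"] Var.prems(2) by simp
  have "\<exists>z. den (literal 7) ?\<sigma> = ?\<sigma>(0 := w, 3 := z, 1 := tl (?\<sigma> 1),
    7 := if ?\<sigma> 7 = [] \<and> chosen (?\<sigma> 1) then rev (encode_nat i) else ?\<sigma> 7)"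
    by (rule den_literal) (use r in simp_all)
  then obtain z where z: "den (literal 7) ?\<sigma> = ?\<sigma>(0 := w, 3 := z, 1 := tl (?\<sigma> 1),
    7 := if ?\<sigma> 7 = [] \<and> chosen (?\<sigma> 1) then rev (encode_nat i) else ?\<sigma> 7)" by (elim exE)
  show ?case
    by (intro exI [of _ "den (literal 7) ?\<sigma>"] conjI l)
      (unfold z, use r in \<open>auto simp: represents_state_def s\<close>)
next
  case (BarVar i)
  obtain u ns ch v w' where s: "s = (u, ns, ch, v, w')" by (rule prod_cases5)
  let ?\<sigma> = "\<sigma>(0 := encode_nat i @ w, 3 := [True, False, False, False] @ \<sigma> 3)"
  note r = BarVar.prems(3) [unfolded represents_state_def s prod.case]
  have l: "den round_loop \<sigma> = den round_loop (den (literal 8) ?\<sigma>)"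
    using round_loop_token [of \<sigma> False False False True "encode_nat i @ w"] BarVar.prems(2) by simp
  have "\<exists>z. den (literal 8) ?\<sigma> = ?\<sigma>(0 := w, 3 := z, 1 := tl (?\<sigma> 1),
    8 := if ?\<sigma> 8 = [] \<and> chosen (?\<sigma> 1) then rev (encode_nat i) else ?\<sigma> 8)"
    by (rule den_literal) (use r in simp_all)
  then obtain z where z: "den (literal 8) ?\<sigma> = ?\<sigma>(0 := w, 3 := z, 1 := tl (?\<sigma> 1),
    8 := if ?\<sigma> 8 = [] \<and> chosen (?\<sigma> 1) then rev (encode_nat i) else ?\<sigma> 8)" by (elim exE)
  show ?case
    by (intro exI [of _ "den (literal 8) ?\<sigma>"] conjI l)
      (unfold z, use r in \<open>auto simp: represents_state_def s\<close>)
next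
  case (And \<phi> \<psi>)
  let ?\<sigma> = "\<sigma>(0 := encode \<phi> @ encode \<psi> @ w, 3 := [True, True, False, False] @ \<sigma> 3)"
  have l: "den round_loop \<sigma> = den round_loop ?\<sigma>"
    using round_loop_token [of \<sigma> False False True True "encode \<phi> @ encode \<psi> @ w"] And.prems(2) by simp
  have ops: "operators \<phi> \<subseteq> S" "operators \<psi> \<subseteq> S" using And.prems(1) by simp_all
  have 0: "?\<sigma> 0 = encode \<phi> @ encode \<psi> @ w" by simp
  have "represents_state ?\<sigma> s f" using And.prems(3) by (cases s) (simp add: represents_state_def)
  from And.IH(1) [OF ops(1) 0 this] obtain \<sigma>1 where \<sigma>1:
    "den round_loop ?\<sigma> = den round_loop \<sigma>1" "\<sigma>1 0 = encode \<psi> @ w"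
    "represents_state \<sigma>1 (fold atom_step (atoms \<phi>) s) (f \<or> Fls \<in> set (atoms \<phi>))" by blast
  from And.IH(2) [OF ops(2) \<sigma>1(2,3)] obtain \<sigma>2 where
    "den round_loop \<sigma>1 = den round_loop \<sigma>2" "\<sigma>2 0 = w"
    "represents_state \<sigma>2 (fold atom_step (atoms \<psi>) (fold atom_step (atoms \<phi>) s))
      ((f \<or> Fls \<in> set (atoms \<phi>)) \<or> Fls \<in> set (atoms \<psi>))" by blast
  then show ?case using l \<sigma>1(1) by (intro exI [of _ \<sigma>2]) (simp add: disj_assoc)
next
  case (Box \<phi>)
  obtain u ns ch v w' where s: "s = (u, ns, ch, v, w')" by (rule prod_cases5)
  let ?\<sigma> = "\<sigma>(0 := encode \<phi> @ w, 3 := [True, False, True, False] @ \<sigma> 3)"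
  note r = Box.prems(3) [unfolded represents_state_def s prod.case]
  have l: "den round_loop \<sigma> = den round_loop (den (take_item True 2) ?\<sigma>)"
    using round_loop_token [of \<sigma> False True False True "encode \<phi> @ w"] Box.prems(2) by simp
  have z: "den (take_item True 2) ?\<sigma> = ?\<sigma>(0 := w, 2 := rev (encode \<phi>) @ ?\<sigma> 2)"
    by (rule den_take_item(1)) (use r Box.prems(1) in simp_all)
  show ?case
    by (intro exI [of _ "den (take_item True 2) ?\<sigma>"] conjI l)
      (unfold z, use r in \<open>auto simp: represents_state_def s\<close>)
next
  case (Dia \<phi>)
  obtain u ns ch v w' where s: "s = (u, ns, ch, v, w')" by (rule prod_cases5)
  let ?\<sigma> = "\<sigma>(0 := encode \<phi> @ w, 3 := [False, True, True, False] @ \<sigma> 3)"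
  note r = Dia.prems(3) [unfolded represents_state_def s prod.case]
  have l: "den round_loop \<sigma> = den round_loop (den diamond ?\<sigma>)"
    using round_loop_token [of \<sigma> False True True False "encode \<phi> @ w"] Dia.prems(2) by simp
  have "\<exists>z. den diamond ?\<sigma> = ?\<sigma>(0 := w, 3 := z, 1 := tl (?\<sigma> 1),
    6 := if ?\<sigma> 6 = [] \<and> chosen (?\<sigma> 1) then [True] else ?\<sigma> 6,
    2 := if ?\<sigma> 6 = [] \<and> chosen (?\<sigma> 1) then rev (encode \<phi>) @ ?\<sigma> 2 else ?\<sigma> 2)"
    by (rule den_diamond) (use r Dia.prems(1) in simp_all)
  then obtain z where z: "den diamond ?\<sigma> = ?\<sigma>(0 := w, 3 := z, 1 := tl (?\<sigma> 1),
    6 := if ?\<sigma> 6 = [] \<and> chosen (?\<sigma> 1) then [True] else ?\<sigma> 6,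
    2 := if ?\<sigma> 6 = [] \<and> chosen (?\<sigma> 1) then rev (encode \<phi>) @ ?\<sigma> 2 else ?\<sigma> 2)" by (elim exE)
  show ?case
    by (intro exI [of _ "den diamond ?\<sigma>"] conjI l)
      (unfold z, use r in \<open>auto simp: represents_state_def s\<close>)
next
  case Tru
  define \<tau> where "\<tau> = \<sigma>(0 := w, 3 := [True, True, True, False] @ \<sigma> 3)"
  have "den round_loop \<sigma> = den round_loop \<tau>"
    using round_loop_token [of \<sigma> False True True True w] Tru.prems(2) by (simp add: \<tau>_def)
  moreover have "represents_state \<tau> s f"
    using Tru.prems(3) by (cases s) (simp add: represents_state_def \<tau>_def)
  moreover have "\<tau> 0 = w" by (simp add: \<tau>_def)
  ultimately show ?case by (intro exI [of _ \<tau>]) simp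
next
  case Fls
  define \<tau> where "\<tau> = \<sigma>(0 := w, 3 := [False, False, False, True] @ \<sigma> 3, 9 := True # \<sigma> 9)"
  have "den round_loop \<sigma> = den round_loop \<tau>"
    using round_loop_token [of \<sigma> True False False False w] Fls.prems(2) by (simp add: \<tau>_def)
  moreover have "represents_state \<tau> s True"
    using Fls.prems(3) by (cases s) (simp add: represents_state_def \<tau>_def)
  moreover have "\<tau> 0 = w" by (simp add: \<tau>_def)
  ultimately show ?case by (intro exI [of _ \<tau>]) simp
qed (use S in auto)

lemma den_round_loop:
  "\<forall>\<phi>\<in>set \<phi>s. operators \<phi> \<subseteq> S \<Longrightarrow> \<sigma> 0 = encode_list \<phi>s \<Longrightarrow> represents_state \<sigma> s f \<Longrightarrow>
    den round_loop \<sigma> 0 = [] \<and>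
    represents_state (den round_loop \<sigma>) (fold atom_step (all_atoms \<phi>s) s) (f \<or> Fls \<in> set (all_atoms \<phi>s))"
proof (induction \<phi>s arbitrary: \<sigma> s f)
  case Nil
  then have "den round_loop \<sigma> = \<sigma>" unfolding round_loop_def by (subst den_Loop) simp
  with Nil show ?case by (simp add: all_atoms_def)
next
  case (Cons \<phi> \<phi>s)
  have "operators \<phi> \<subseteq> S" "\<sigma> 0 = encode \<phi> @ encode_list \<phi>s" using Cons.prems(1,2) by simp_all
  from round_loop_formula [OF this Cons.prems(3)] obtain \<sigma>' where
    \<sigma>': "den round_loop \<sigma> = den round_loop \<sigma>'" "\<sigma>' 0 = encode_list \<phi>s"
    "represents_state \<sigma>' (fold atom_step (atoms \<phi>) s) (f \<or> Fls \<in> set (atoms \<phi>))" by blast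
  have "\<forall>\<phi>\<in>set \<phi>s. operators \<phi> \<subseteq> S" using Cons.prems(1) by simp
  from Cons.IH [OF this \<sigma>'(2,3)] show ?case
    unfolding \<sigma>'(1) by (simp add: all_atoms_def disj_assoc)
qed

definition world_step :: prog where
  "world_step = Pop 6 ;; move 2 0 ;; round_loop ;; check"

definition world_loop :: prog where "world_loop = Loop 6 (- {None}) world_step"

definition at_world :: "store \<Rightarrow> word \<Rightarrow> fm list \<Rightarrow> bool \<Rightarrow> bool \<Rightarrow> bool" where
  "at_world \<sigma> u ns ch f \<longleftrightarrow> represents_state \<sigma> (u, ns, ch, None, None) f \<and> \<sigma> 0 = [] \<and>
     (\<forall>\<phi>\<in>set ns. operators \<phi> \<subseteq> S)"

lemma den_world_step:
  assumes "at_world \<sigma> u ns True f" "round_result u (rev ns) = (u', ns', ch, v, w)"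
  shows "at_world (den world_step \<sigma>) u' ns' ch
    (f \<or> Fls \<in> set (all_atoms (rev ns)) \<or> (v \<noteq> None \<and> v = w))"
proof -
  note r = assms(1) [unfolded at_world_def represents_state_def prod.case]
  define \<sigma>1 where "\<sigma>1 = \<sigma>(6 := [], 2 := [], 0 := encode_list (rev ns))"
  have 1: "den (Pop 6 ;; move 2 0) \<sigma> = \<sigma>1"
    using r by (simp add: \<sigma>1_def den_move fun_eq_iff)
  have "represents_state \<sigma>1 (u, [], False, None, None) f" "\<sigma>1 0 = encode_list (rev ns)"
    using r by (simp_all add: \<sigma>1_def represents_state_def)
  moreover have ops: "\<forall>\<phi>\<in>set (rev ns). operators \<phi> \<subseteq> S" using r by simp
  ultimately have 2: "den round_loop \<sigma>1 0 = []"
    "represents_state (den round_loop \<sigma>1) (u', ns', ch, v, w) (f \<or> Fls \<in> set (all_atoms (rev ns)))"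
    using den_round_loop [OF ops, of \<sigma>1 "(u, [], False, None, None)" f] assms(2) by simp_all
  note r2 = 2(2) [unfolded represents_state_def prod.case]
  obtain a where a: "den check (den round_loop \<sigma>1) = (den round_loop \<sigma>1)(7 := [], 8 := [], 10 := [], 9 := a)"
    "a \<noteq> [] \<longleftrightarrow> den round_loop \<sigma>1 9 \<noteq> [] \<or> (den round_loop \<sigma>1 7 \<noteq> [] \<and> den round_loop \<sigma>1 7 = den round_loop \<sigma>1 8)"
    using den_check [of "den round_loop \<sigma>1"] r2 by blast
  have "den world_step \<sigma> = (den round_loop \<sigma>1)(7 := [], 8 := [], 10 := [], 9 := a)"
    using 1 a(1) unfolding world_step_def den.simps(4) by simp
  moreover have "a \<noteq> [] \<longleftrightarrow> f \<or> Fls \<in> set (all_atoms (rev ns)) \<or> (v \<noteq> None \<and> v = w)"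
    unfolding a(2) using r2 by (simp add: word_of_index_inj)
  moreover have "\<forall>\<phi>\<in>set ns'. operators \<phi> \<subseteq> S" by (rule round_result_bounds(3) [OF assms(2) ops])
  ultimately show ?thesis using 2(1) r2 unfolding at_world_def represents_state_def by simp
qed

lemma accepting_unfold:
  assumes "round_result u \<phi>s = (u', ns, ch, v, w)"
  shows "accepting u \<phi>s \<longleftrightarrow> Fls \<in> set (all_atoms \<phi>s) \<or> (v \<noteq> None \<and> v = w) \<or> (ch \<and> accepting u' (rev ns))"
  using assms by (subst accepting.simps) auto

text \<open>\<open>f\<close> accumulates acceptance over the rounds: the program does not stop at a
  clash but goes on as long as the certificate selects diamonds. The total length shrinks with each
  selected diamond.\<close>

lemma den_world_loop:
  "at_world \<sigma> u ns True f \<Longrightarrow>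
    (den world_loop \<sigma> 9 \<noteq> [] \<longleftrightarrow> f \<or> accepting u (rev ns)) \<and> den world_loop \<sigma> 11 = []"
proof (induction "total_len ns" arbitrary: \<sigma> u ns f rule: less_induct)
  case less
  obtain u' ns' ch v w where r: "round_result u (rev ns) = (u', ns', ch, v, w)" by (rule prod_cases5)
  define f' where "f' \<longleftrightarrow> f \<or> Fls \<in> set (all_atoms (rev ns)) \<or> (v \<noteq> None \<and> v = w)"
  have next_world: "at_world (den world_step \<sigma>) u' ns' ch f'"
    unfolding f'_def by (rule den_world_step [OF less.prems r])
  have "\<sigma> 6 = [True]" using less.prems by (simp add: at_world_def represents_state_def)
  then have l: "den world_loop \<sigma> = den world_loop (den world_step \<sigma>)"
    unfolding world_loop_def by (subst den_Loop) simp
  have acc: "f \<or> accepting u (rev ns) \<longleftrightarrow> f' \<or> (ch \<and> accepting u' (rev ns'))"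
    unfolding accepting_unfold [OF r] f'_def by blast
  show ?case
  proof (cases ch)
    case True
    then have "total_len ns' < total_len ns" using round_result_bounds(1) [OF r] by simp
    from less.hyps [OF this] next_world True show ?thesis unfolding l acc by simp
  next
    case False
    have "den world_step \<sigma> 6 = []" using next_world False by (simp add: at_world_def represents_state_def)
    then have "den world_loop (den world_step \<sigma>) = den world_step \<sigma>"
      unfolding world_loop_def by (subst den_Loop) simp
    then show ?thesis unfolding l acc using next_world False
      by (simp add: at_world_def represents_state_def)
  qed
qed

section \<open>Running time of the certificate checker\<close>

lemma polytime_on_take_item:
  "r \<notin> {0, 4, 5} \<Longrightarrow> polytime_on {0, 1, 4} D (take_item c r)"
  unfolding take_item_def
  by (intro polytime_on_Seq [where D' = "\<lambda>_. True"] polytime_on_Push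
      polytime_on_weaken [OF polytime_on_copy [where D = "\<lambda>_. True"]]) auto

lemma polytime_on_handle: "polytime_on {0, 1, 4} D (handle a b c d)"
proof (rule polytime_on_True)
  have lit: "polytime_on {0, 1, 4} (\<lambda>_. True) (literal r)" if "r \<in> {7, 8}" for r
    unfolding literal_def
    by (intro polytime_on_Seq [where D' = "\<lambda>_. True"] polytime_on_Test polytime_on_take_item polytime_on_Pop)
      (use that in auto)
  have dia: "polytime_on {0, 1, 4} (\<lambda>_. True) diamond"
    unfolding diamond_def
    by (intro polytime_on_Seq [where D' = "\<lambda>_. True"] polytime_on_Test polytime_on_take_item polytime_on_Pop
        polytime_on_Push) simp_all
  show "polytime_on {0, 1, 4} (\<lambda>_. True) (handle a b c d)"
    using lit dia
    by (cases a; cases b; cases c; cases d)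
      (simp_all add: polytime_on_take_item [unfolded One_nat_def] polytime_on_Skip polytime_on_Push)
qed

lemma take_item_facts:
  assumes "r \<notin> {0, 4, 5}"
  shows "length (den (take_item c r) \<sigma> 0) \<le> length (\<sigma> 0) \<and> den (take_item c r) \<sigma> 4 = [] \<and>
    (r \<noteq> 1 \<longrightarrow> den (take_item c r) \<sigma> 1 = \<sigma> 1)"
  using copy_facts [of r S "\<sigma>(4 := c # \<sigma> 4)"] assms by (simp add: take_item_def)

lemma handle_facts:
  "length (den (handle a b c d) \<sigma> 0) \<le> length (\<sigma> 0) \<and> length (den (handle a b c d) \<sigma> 4) \<le> length (\<sigma> 4) \<and>
   length (den (handle a b c d) \<sigma> 1) \<le> length (\<sigma> 1)"
proof -
  have lit: "length (den (literal r) \<sigma> 0) \<le> length (\<sigma> 0) \<and> length (den (literal r) \<sigma> 4) \<le> length (\<sigma> 4) \<and>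
    length (den (literal r) \<sigma> 1) \<le> length (\<sigma> 1)" if "r \<in> {7, 8}" for r
    using that take_item_facts [of r False \<sigma>] take_item_facts [of 3 False \<sigma>] by (auto simp: literal_def)
  have dia: "length (den diamond \<sigma> 0) \<le> length (\<sigma> 0) \<and> length (den diamond \<sigma> 4) \<le> length (\<sigma> 4) \<and>
    length (den diamond \<sigma> 1) \<le> length (\<sigma> 1)"
    using take_item_facts [of 2 True "\<sigma>(6 := [True])"] take_item_facts [of 3 True \<sigma>]
    by (simp add: diamond_def)
  show ?thesis
    using lit [of 7] lit [of 8] dia take_item_facts [of 2 True \<sigma>]
    by (cases a; cases b; cases c; cases d) simp_all
qed

lemma round_step_facts:
  assumes "\<sigma> 0 \<noteq> []"
  shows "length (den round_step \<sigma> 0) < length (\<sigma> 0) \<and> length (den round_step \<sigma> 4) \<le> length (\<sigma> 4) \<and>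
    length (den round_step \<sigma> 1) \<le> length (\<sigma> 1)"
  using word_cases4 [of "\<sigma> 0"]
proof (elim disjE exE)
  fix a b c d v
  assume w: "\<sigma> 0 = a # b # c # d # v"
  then have "den round_step \<sigma> = den (handle a b c d) (\<sigma>(0 := v, 3 := d # c # b # a # \<sigma> 3))"
    by (simp add: round_step_def den_read_token)
  then show ?thesis using handle_facts [of a b c d "\<sigma>(0 := v, 3 := d # c # b # a # \<sigma> 3)"] w by simp
qed (use assms in \<open>simp_all add: round_step_def read_token_def\<close>)

lemma polytime_on_round_loop: "polytime_on {0, 1, 4} D round_loop"
proof (rule polytime_on_True, unfold round_loop_def,
    rule polytime_on_Loop [where \<Phi> = "\<lambda>\<sigma>. length (\<sigma> 0)" and b = "\<lambda>n. n"])
  show "polytime_on {0, 1, 4} (\<lambda>_. True) round_step"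
    unfolding round_step_def read_token_def by (intro polytime_on_read_bit polytime_on_handle)
  fix \<sigma> :: store and i
  assume "peek (\<sigma> 0) \<in> - {None}"
  then have "\<sigma> 0 \<noteq> []" by auto
  note s = round_step_facts [of \<sigma>, OF this]
  show "True \<and> length (den round_step \<sigma> 0) < length (\<sigma> 0)" using s by blast
  show "i \<in> {0, 1, 4} \<Longrightarrow> length (den round_step \<sigma> i) \<le> max (length (\<sigma> i)) (length (\<sigma> 0))" using s by auto
qed (simp_all add: poly_bounded_id)

lemma polytime_on_world_loop: "polytime_on UNIV (\<lambda>\<sigma>. \<exists>u ns ch f. at_world \<sigma> u ns ch f) world_loop"
proof (rule polytime_on_weaken [where R = "{0, 1, 2, 4, 6, 7, 8, 10}"])
  let ?R = "{0, 1, 2, 4, 6, 7, 8, 10}" and ?D = "\<lambda>\<sigma>. \<exists>u ns ch f. at_world \<sigma> u ns ch f"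
  show "polytime_on ?R ?D world_loop"
    unfolding world_loop_def
  \<comment> \<open>On stores at a world this measure is \<open>total_len ns + of_bool ch\<close>,
    which drops with every round by \<open>round_result_bounds\<close>.\<close>
  proof (rule polytime_on_Loop [where \<Phi> = "\<lambda>\<sigma>. length (\<sigma> 2) + length (\<sigma> 6)" and b = "\<lambda>n. n + n"])
    have m: "polytime_on ?R D (move 2 0)" for D
      by (rule polytime_on_weaken [OF polytime_on_move]) auto
    have r: "polytime_on ?R D round_loop" for D
      by (rule polytime_on_weaken [OF polytime_on_round_loop]) auto
    have c: "polytime_on ?R D check" for D
      by (rule polytime_on_weaken [OF polytime_on_check]) auto
    show "polytime_on ?R ?D world_step"
      unfolding world_step_def
      by (intro polytime_on_Seq [where D' = "\<lambda>_. True"] polytime_on_Pop m r c) simp_all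
    fix \<sigma> :: store and i
    assume "?D \<sigma>" and p: "peek (\<sigma> 6) \<in> - {None}"
    then obtain u ns ch f where a: "at_world \<sigma> u ns ch f" by blast
    then have ch: "ch = True" using p by (auto simp: at_world_def represents_state_def split: if_splits)
    obtain u' ns' ch' v w where r: "round_result u (rev ns) = (u', ns', ch', v, w)" by (rule prod_cases5)
    note n = den_world_step [OF a [unfolded ch] r]
    have len: "length (\<sigma> 2) = total_len ns" if "at_world \<sigma> u ns ch f" for \<sigma> u ns ch f
    proof -
      have "length (rev (\<sigma> 2)) = length (encode_list (rev ns))"
        using that by (simp only: at_world_def represents_state_def prod.case)
      then show ?thesis by (simp add: length_encode_list)
    qed
    have b: "total_len ns' + of_bool ch' \<le> total_len ns" "length u' \<le> length u"
      using round_result_bounds(1,2) [OF r] by simp_all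
    have s6: "length (\<sigma> 6) = 1" "length (den world_step \<sigma> 6) = of_bool ch'"
      using a n ch by (simp_all add: at_world_def represents_state_def)
    have d: "length (den world_step \<sigma> 2) + length (den world_step \<sigma> 6) < length (\<sigma> 2) + length (\<sigma> 6)"
      unfolding s6 len [OF a] len [OF n] using b(1) by simp
    with n show "?D (den world_step \<sigma>) \<and>
        length (den world_step \<sigma> 2) + length (den world_step \<sigma> 6) < length (\<sigma> 2) + length (\<sigma> 6)" by blast
    have "length (den world_step \<sigma> 1) \<le> length (\<sigma> 1)" "den world_step \<sigma> 0 = []" "den world_step \<sigma> 4 = []"
      "den world_step \<sigma> 7 = []" "den world_step \<sigma> 8 = []" "den world_step \<sigma> 10 = []"
      using a n b(2) by (simp_all add: at_world_def represents_state_def)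
    then show "i \<in> ?R \<Longrightarrow> length (den world_step \<sigma> i) \<le> max (length (\<sigma> i)) (length (\<sigma> 2) + length (\<sigma> 6))"
      using d by auto
  next
    show "poly_bounded (\<lambda>n. n + n)" by (intro poly_bounded_add poly_bounded_id)
    show "length (\<sigma> 2) + length (\<sigma> 6) \<le> n + n" if "\<forall>r\<in>?R. length (\<sigma> r) \<le> n" for n and \<sigma> :: store
      using that by (intro add_mono) simp_all
  qed
qed auto

text \<open>The language to be accepted is the complement of satisfiability, so a word that encodes
  no formula over \<open>S\<close> is accepted whatever the certificate is.\<close>

definition verify :: prog where
  "verify = (Push 4 True ;; copy S 2) ;;
     Test 5 {None} (Test 0 {None} (Push 6 True ;; world_loop) (Push 9 True)) (Push 9 True) ;;
     Test 9 {None} (Push 11 False) (Push 11 True)"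

lemma initial_pair: "initial [x, u] = (\<lambda>_. [])(0 := x, 1 := u)"
  by (auto simp: initial_def fun_eq_iff nth_Cons')

lemma verify_copy_valid:
  assumes "operators \<phi> \<subseteq> S"
  shows "den (Push 4 True ;; copy S 2) (initial [encode \<phi>, u]) = (\<lambda>_. [])(1 := u, 2 := rev (encode \<phi>))"
proof -
  have "den (take_item True 2) (initial [encode \<phi>, u]) = (initial [encode \<phi>, u])(0 := [], 2 := rev (encode \<phi>) @ initial [encode \<phi>, u] 2)"
    by (rule den_take_item(1) [OF _ _ _ _ assms]) (simp_all add: initial_pair)
  then show ?thesis by (simp add: take_item_def initial_pair fun_eq_iff)
qed

lemma verify_start:
  assumes "operators \<phi> \<subseteq> S"
  shows "at_world ((\<lambda>_. [])(1 := u, 2 := rev (encode \<phi>), 6 := [True])) u [\<phi>] True False"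
  using assms by (simp add: at_world_def represents_state_def)

lemma verify_copy_iff:
  "den (Push 4 True ;; copy S 2) (initial [x, u]) 5 = [] \<and> den (Push 4 True ;; copy S 2) (initial [x, u]) 0 = [] \<longleftrightarrow>
    x \<in> encode ` formulas S"
  unfolding den.simps by (rule copy_valid_iff [OF S]) (simp_all add: initial_pair)

lemma den_verify:
  "den verify (initial [x, u]) 11 = [x \<notin> encode ` formulas S \<or> (\<exists>\<phi>. x = encode \<phi> \<and> accepting u [\<phi>])]"
proof (cases "x \<in> encode ` formulas S")
  case True
  then obtain \<phi> where \<phi>: "x = encode \<phi>" "operators \<phi> \<subseteq> S" by (auto simp: formulas_def)
  have inj: "(\<exists>\<psi>. x = encode \<psi> \<and> accepting u [\<psi>]) \<longleftrightarrow> accepting u [\<phi>]"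
    using inj_encode \<phi>(1) by (auto dest: injD)
  let ?\<sigma> = "(\<lambda>_. [])(1 := u, 2 := rev (encode \<phi>), 6 := [True])"
  note w = den_world_loop [OF verify_start [OF \<phi>(2), of u]]
  have "den verify (initial [x, u]) = den (Test 9 {None} (Push 11 False) (Push 11 True)) (den world_loop ?\<sigma>)"
    unfolding verify_def den.simps(4) [of "Push 4 True ;; copy S 2"] \<phi>(1) verify_copy_valid [OF \<phi>(2)] by simp
  then show ?thesis unfolding inj using w True by (cases "accepting u [\<phi>]") auto
next
  case False
  let ?\<sigma> = "den (Push 4 True ;; copy S 2) (initial [x, u])"
  have "?\<sigma> 5 \<noteq> [] \<or> ?\<sigma> 0 \<noteq> []" using verify_copy_iff [of x u] False by blast
  moreover have "den (Test 5 {None} (Test 0 {None} (Push 6 True ;; world_loop) (Push 9 True)) (Push 9 True) ;;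
      Test 9 {None} (Push 11 False) (Push 11 True)) \<tau> = \<tau>(9 := True # \<tau> 9, 11 := True # \<tau> 11)"
    if "\<tau> 5 \<noteq> [] \<or> \<tau> 0 \<noteq> []" for \<tau>
    using that by (auto simp: fun_eq_iff)
  ultimately have "den verify (initial [x, u]) = ?\<sigma>(9 := True # ?\<sigma> 9, 11 := True # ?\<sigma> 11)"
    unfolding verify_def den.simps(4) [of "Push 4 True ;; copy S 2"] by blast
  moreover have "?\<sigma> 11 = []"
    using copy_facts [of 2 S "(initial [x, u])(4 := [True])"] by (simp add: initial_pair)
  ultimately show ?thesis using False by simp
qed

lemma polytime_on_verify: "polytime_on UNIV (\<lambda>\<sigma>. \<exists>x u. \<sigma> = initial [x, u]) verify"
proof -
  let ?D = "\<lambda>\<sigma>. \<exists>x u. \<sigma> = initial [x, u]" and ?P = "Push 4 True ;; copy S 2"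
  let ?E = "\<lambda>\<sigma>. \<exists>x u. \<sigma> = den ?P (initial [x, u])"
  have c: "polytime_on UNIV ?D ?P"
    by (intro polytime_on_Seq [where D' = "\<lambda>_. True"] polytime_on_Push
        polytime_on_weaken [OF polytime_on_copy [where D = "\<lambda>_. True"]]) auto
  have w: "polytime_on UNIV (\<lambda>\<sigma>. (?E \<sigma> \<and> peek (\<sigma> 5) \<in> {None}) \<and> peek (\<sigma> 0) \<in> {None}) (Push 6 True ;; world_loop)"
  proof (rule polytime_on_Seq [OF polytime_on_Push polytime_on_world_loop])
    fix \<sigma> assume "(?E \<sigma> \<and> peek (\<sigma> 5) \<in> {None}) \<and> peek (\<sigma> 0) \<in> {None}"
    then obtain x u where x: "\<sigma> = den ?P (initial [x, u])" "\<sigma> 5 = []" "\<sigma> 0 = []" by auto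
    then have "x \<in> encode ` formulas S" using verify_copy_iff [of x u] by blast
    then obtain \<phi> where \<phi>: "x = encode \<phi>" "operators \<phi> \<subseteq> S" by (auto simp: formulas_def)
    have "den (Push 6 True) \<sigma> = (\<lambda>_. [])(1 := u, 2 := rev (encode \<phi>), 6 := [True])"
      unfolding x(1) \<phi>(1) verify_copy_valid [OF \<phi>(2)] by simp
    with verify_start [OF \<phi>(2), of u] show "\<exists>u ns ch f. at_world (den (Push 6 True) \<sigma>) u ns ch f" by metis
  qed
  have "polytime_on UNIV ?E
    (Test 5 {None} (Test 0 {None} (Push 6 True ;; world_loop) (Push 9 True)) (Push 9 True))"
    by (intro polytime_on_Test polytime_on_Push w)
  moreover have "polytime_on UNIV (\<lambda>_. True) (Test 9 {None} (Push 11 False) (Push 11 True))"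
    by (intro polytime_on_Test polytime_on_Push)
  ultimately have t: "polytime_on UNIV ?E
    (Test 5 {None} (Test 0 {None} (Push 6 True ;; world_loop) (Push 9 True)) (Push 9 True) ;;
     Test 9 {None} (Push 11 False) (Push 11 True))"
    by (rule polytime_on_Seq) simp
  show ?thesis unfolding verify_def by (rule polytime_on_Seq [OF c t]) blast
qed

theorem satisfiability_in_coNP: "satisfiability S \<in> coNP"
proof -
  define V where "V = {(x, u). x \<notin> encode ` formulas S \<or> (\<exists>\<phi>. x = encode \<phi> \<and> accepting u [\<phi>])}"
  have "polytime_rel V"
    unfolding polytime_rel_def
  proof (rule polytimeI [OF polytime_on_verify])
    fix xs :: "word list" assume "length xs = 2"
    then have xs: "xs = [xs ! 0, xs ! 1]" by (cases xs; cases "tl xs") auto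
    show "\<exists>x u. initial xs = initial [x, u]" using xs by metis
    show "den verify (initial xs) 11 = [(xs ! 0, xs ! 1) \<in> V]"
      by (subst xs) (simp only: den_verify V_def mem_Collect_eq prod.case)
  qed
  \<comment> \<open>\<open>[:0, 0, 1:]\<close> is the square from
    \<open>unsat_iff_accepting\<close>.\<close>
  moreover have "x \<in> - satisfiability S \<longleftrightarrow> (\<exists>u. length u \<le> poly [:0, 0, 1:] (length x) \<and> (x, u) \<in> V)" for x
  proof (cases "x \<in> encode ` formulas S")
    case True
    then obtain \<phi> where \<phi>: "x = encode \<phi>" "\<phi> \<in> formulas S" by blast
    have ops: "operators \<phi> \<inter> {ONeg, OOr} = {}" using \<phi>(2) S by (auto simp: formulas_def)
    have "x \<in> - satisfiability S \<longleftrightarrow> \<not> satisfiable \<phi>" using \<phi> by (simp add: encode_in_satisfiability_iff)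
    also have "\<dots> \<longleftrightarrow> (\<exists>u. length u \<le> length x * length x \<and> accepting u [\<phi>])"
      unfolding \<phi>(1) by (rule unsat_iff_accepting [OF ops])
    also have "\<dots> \<longleftrightarrow> (\<exists>u. length u \<le> poly [:0, 0, 1:] (length x) \<and> (x, u) \<in> V)"
      using \<phi> inj_encode by (auto simp: V_def dest: injD)
    finally show ?thesis .
  next
    case False
    then have "x \<in> - satisfiability S" "(x, []) \<in> V" by (auto simp: satisfiability_def V_def)
    then show ?thesis by (metis le0 list.size(3))
  qed
  ultimately show ?thesis unfolding coNP_def NP_def by blast
qed

end

theorem theorem9:
  fixes S :: "operator set"
  shows "({OBar, OAnd, OBox, ODia} \<subseteq> S \<and> S \<subseteq> {OBar, OAnd, OBox, ODia, OTrue, OFalse}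
            \<longrightarrow> coNP_complete (satisfiability S))
       \<and> ({OAnd, OBox, ODia, OFalse} \<subseteq> S \<and> S \<subseteq> {OBar, OAnd, OBox, ODia, OTrue, OFalse}
            \<longrightarrow> coNP_complete (satisfiability S))"
proof -
  have complete: "coNP_complete (satisfiability S)"
    if "S \<subseteq> {OBar, OAnd, OBox, ODia, OTrue, OFalse}" "{OAnd, OBox, ODia} \<subseteq> S"
      and F: "\<And>M :: nat model. \<And>w. \<not> holds M w F" "operators F \<subseteq> S" for F
    unfolding coNP_complete_def
  proof (intro conjI ballI)
    show "satisfiability S \<in> coNP" by (rule satisfiability_in_coNP) (use that(1) in auto)
    show "B \<le>\<^sub>p satisfiability S" if "B \<in> coNP" for B
      by (rule coNP_hard [OF F \<open>{OAnd, OBox, ODia} \<subseteq> S\<close> that])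
  qed
  \<comment> \<open>The falsity is a contradictory pair of literals for the first claim and the
    constant for the second.\<close>
  show ?thesis
    using complete [of "And (Var 0) (BarVar 0)"] complete [of Fls] by auto
qed

end
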